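(* Let $\Lambda\in\{\mathsf{MSO},\mathsf{FO(TC^1)},\mathsf{FO(LFP^1)}\}$. $\Lambda$ is completely axiomatized on $\Lambda$-Henkin structures by $\vdash_\Lambda$: for every set of $\Lambda$-formulas $\Gamma$ and every $\Lambda$-formula $\varphi$, $\varphi$ is true in all $\Lambda$-Henkin models of $\Gamma$ if and only if $\Gamma\vdash_\Lambda\varphi$.
   Context: Logics (purely relational vocabulary). $\mathsf{MSO}$ extends first-order logic with set variables $X$, atoms $Xx$ and quantifiers $\exists X$; $\mathsf{FO(TC^1)}$ extends first-order logic with formulas $[TC_{xy}\varphi](u,v)$; $\mathsf{FO(LFP^1)}$ extends first-order logic with set variables, atoms $Xy$ and formulas $[LFP_{Xx}\varphi]y$ with $\varphi$ positive in $X$. Henkin semantics. A frame is a relational structure $\mathfrak M$ with a set $\mathbb A_{\mathfrak M}\subseteq\wp(dom(\mathfrak M))$ of admissible subsets; assignments map set variables to admissible subsets. Evaluation is as usual except: $\exists X\varphi$ holds iff some $A\in\mathbb A_{\mathfrak M}$ witnesses $\varphi$; $[TC_{xy}\varphi](u,v)$ holds under $g$ iff for all $A\in\mathbb A_{\mathfrak M}$, if $g(u)\in A$ and for all $a,b$ ($a\in A$ and $\mathfrak M,g[a/x,b/y]\models\varphi$ imply $b\in A$), then $g(v)\in A$; $[LFP_{Xx}\varphi]y$ holds under $g$ iff for all $A\in\mathbb A_{\mathfrak M}$, if every $a$ with $\mathfrak M,g[a/x,A/X]\models\varphi$ lies in $A$, then $g(y)\in A$. A $\Lambda$-Henkin structure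 is a frame such that for every $\Lambda$-formula $\varphi$ and assignment $g$, $\{a:\mathfrak M,g[a/x]\models\varphi\}\in\mathbb A_{\mathfrak M}$. Proof system $\vdash_\Lambda$. First-order part: all instances of propositional tautologies; $\forall x\varphi\to\varphi[x/t]$ ($t$ substitutable); $\forall x(\varphi\to\psi)\to(\forall x\varphi\to\forall x\psi)$; $\varphi\to\forall x\varphi$ ($x$ not free in $\varphi$); $x=x$; $x=y\to(\varphi\to\psi)$ for atomic $\varphi$ and $\psi$ obtained by replacing $x$ by $y$ in zero or more places; modus ponens; generalization (from $\varphi$ infer $\forall x\varphi$). For $\mathsf{MSO}$ add: $\exists X\forall x(Xx\leftrightarrow\varphi)$ ($X$ not free in $\varphi$); $\forall X\varphi\to\varphi[X/T]$ ($T$ a set variable or unary predicate substitutable for $X$); $\forall X(\varphi\to\psi)\to(\forall X\varphi\to\forall X\psi)$; $\varphi\to\forall X\varphi$ ($X$ not free in $\varphi$); from $\varphi$ infer $\forall X\varphi$. For $\mathsf{FO(TC^1)}$ add: $[TC_{xy}\varphi](u,v)\to((\psi(u)\wedge\forall x\forall y(\psi(x)\wedge\varphi(x,y)\to\psi(y)))\to\psi(v))$ for every formula $\psi$; rule: if $\vdash\xi\to((P(u)\wedge\forall x\forall y(P(x)\wedge\varphi(x,y)\to P(y)))\to P(v))$ with $P$ a unary predicate not occurring in $\xi$, then $\vdash\xi\to[TC_{xy}\varphi](u,v)$. For $\mathsf{FO(LFP^1)}$ add: $[LFP_{Xx}\varphi]y\to(\forall x(\varphi(x,\psi)\to\psi(x))\to\psi(y))$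 for every formula $\psi$ ($\varphi(x,\psi)$: replace each occurrence of $X$ by $\psi$, renaming variables as needed); rule: if $\vdash\xi\to(\forall x(\varphi(x,P)\to P(x))\to P(y))$, with $P$ a unary predicate positive in $\varphi$ not occurring in $\xi$, then $\vdash\xi\to[LFP_{Xx}\varphi]y$. $\Gamma\vdash_\Lambda\varphi$ means that $\vdash_\Lambda(\psi_1\wedge\cdots\wedge\psi_n)\to\varphi$ for some $\psi_1,\ldots,\psi_n\in\Gamma$.
   Formalization: In the TC and LFP rules the predicate P is required not to occur in φ as well as in ξ (otherwise the rules are unsound), and derivations may use countably many additional unary predicates beyond the vocabulary of Γ and φ (otherwise the rules may be unusable). *)

theory Defs
  imports Main
begin

datatype lang = MSO | FO_TC1 | FO_LFP1

text \<open>
  Formulas are taken up to renaming of bound variables, in de Bruijn notation. There are two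
  independent sorts of indices, one for individual variables and one for set variables.
  The following binders occur:
    \<^item> \<open>Forall \<phi>\<close> binds individual index 0, and \<open>ForallS \<phi>\<close> binds set index 0;
    \<^item> \<open>TC \<phi> u v\<close> is \<open>[TC_xy \<phi>](u,v)\<close>, where in \<open>\<phi>\<close> the variable \<open>x\<close> is individual index 1
      and \<open>y\<close> is individual index 0;
    \<^item> \<open>LFP \<phi> y\<close> is \<open>[LFP_Xx \<phi>]y\<close>, where in \<open>\<phi>\<close> the variable \<open>X\<close> is set index 0 and \<open>x\<close> is
      individual index 0.
  The vocabulary is purely relational, so the only terms are variables. One datatype covers
  all three logics; \<open>is_formula\<close> below singles out the formulas of each of them.
\<close>

datatype (preds: 'r) fm =
    Bot
  | Rel 'r "nat list"
  | Eq nat nat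
  | Mem nat nat  \<comment> \<open>\<open>Mem X x\<close> is the atom \<open>Xx\<close>\<close>
  | Imp "'r fm" "'r fm"
  | Forall "'r fm"
  | ForallS "'r fm"
  | TC "'r fm" nat nat
  | LFP "'r fm" nat

abbreviation Neg :: "'r fm \<Rightarrow> 'r fm" where "Neg \<phi> \<equiv> Imp \<phi> Bot"
abbreviation Top :: "'r fm" where "Top \<equiv> Neg Bot"
abbreviation And :: "'r fm \<Rightarrow> 'r fm \<Rightarrow> 'r fm" where "And \<phi> \<psi> \<equiv> Neg (Imp \<phi> (Neg \<psi>))"
abbreviation Iff :: "'r fm \<Rightarrow> 'r fm \<Rightarrow> 'r fm" where "Iff \<phi> \<psi> \<equiv> And (Imp \<phi> \<psi>) (Imp \<psi> \<phi>)"
abbreviation ExistsS :: "'r fm \<Rightarrow> 'r fm" where "ExistsS \<phi> \<equiv> Neg (ForallS (Neg \<phi>))"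

text \<open>
  \<open>pol True X \<phi>\<close>: all free occurrences of the set variable \<open>X\<close> in \<open>\<phi>\<close> are positive;
  \<open>pol False X \<phi>\<close>: they are all negative.
\<close>

fun pol :: "bool \<Rightarrow> nat \<Rightarrow> 'r fm \<Rightarrow> bool" where
  "pol p X Bot = True"
| "pol p X (Rel r xs) = True"
| "pol p X (Eq x y) = True"
| "pol p X (Mem Y y) = (Y = X \<longrightarrow> p)"
| "pol p X (Imp \<phi> \<psi>) = (pol (\<not> p) X \<phi> \<and> pol p X \<psi>)"
| "pol p X (Forall \<phi>) = pol p X \<phi>"
| "pol p X (ForallS \<phi>) = pol p (Suc X) \<phi>"
| "pol p X (TC \<phi> u v) = pol p X \<phi>"
| "pol p X (LFP \<phi> y) = pol p (Suc X) \<phi>"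

abbreviation positive_in :: "nat \<Rightarrow> 'r fm \<Rightarrow> bool" where
  "positive_in X \<phi> \<equiv> pol True X \<phi>"

text \<open>
  The formulas of the logic \<open>\<Lambda>\<close> over the vocabulary \<open>\<sigma>\<close>, a set of relation symbols whose
  arities are given by \<open>ar\<close>.
\<close>

fun is_formula :: "lang \<Rightarrow> ('r \<Rightarrow> nat) \<Rightarrow> 'r set \<Rightarrow> 'r fm \<Rightarrow> bool" where
  "is_formula \<Lambda> ar \<sigma> Bot = True"
| "is_formula \<Lambda> ar \<sigma> (Rel r xs) = (r \<in> \<sigma> \<and> length xs = ar r)"
| "is_formula \<Lambda> ar \<sigma> (Eq x y) = True"
| "is_formula \<Lambda> ar \<sigma> (Mem X x) = (\<Lambda> = MSO \<or> \<Lambda> = FO_LFP1)"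
| "is_formula \<Lambda> ar \<sigma> (Imp \<phi> \<psi>) = (is_formula \<Lambda> ar \<sigma> \<phi> \<and> is_formula \<Lambda> ar \<sigma> \<psi>)"
| "is_formula \<Lambda> ar \<sigma> (Forall \<phi>) = is_formula \<Lambda> ar \<sigma> \<phi>"
| "is_formula \<Lambda> ar \<sigma> (ForallS \<phi>) = (\<Lambda> = MSO \<and> is_formula \<Lambda> ar \<sigma> \<phi>)"
| "is_formula \<Lambda> ar \<sigma> (TC \<phi> u v) = (\<Lambda> = FO_TC1 \<and> is_formula \<Lambda> ar \<sigma> \<phi>)"
| "is_formula \<Lambda> ar \<sigma> (LFP \<phi> y) = (\<Lambda> = FO_LFP1 \<and> is_formula \<Lambda> ar \<sigma> \<phi> \<and> positive_in 0 \<phi>)"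


section \<open>Henkin semantics\<close>

record ('r, 'u) frame =
  dom :: "'u set"
  interp :: "'r \<Rightarrow> 'u list set"
  adm :: "'u set set"

definition is_frame :: "('r \<Rightarrow> nat) \<Rightarrow> 'r set \<Rightarrow> ('r, 'u) frame \<Rightarrow> bool" where
  "is_frame ar \<sigma> M \<longleftrightarrow>
     dom M \<noteq> {} \<and>
     (\<forall>r\<in>\<sigma>. interp M r \<subseteq> {as. length as = ar r \<and> set as \<subseteq> dom M}) \<and>
     adm M \<subseteq> Pow (dom M)"

text \<open>
  An assignment is a pair \<open>e\<close>, \<open>E\<close> of functions on individual and set indices. The function
  \<open>case_nat a e\<close> assigns \<open>a\<close> to index 0 and shifts the values of \<open>e\<close> up by one index.
\<close>

definition assignment :: "('r, 'u) frame \<Rightarrow> (nat \<Rightarrow> 'u) \<Rightarrow> (nat \<Rightarrow> 'u set) \<Rightarrow> bool" where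
  "assignment M e E \<longleftrightarrow> (\<forall>n. e n \<in> dom M) \<and> (\<forall>n. E n \<in> adm M)"

fun sat :: "('r, 'u) frame \<Rightarrow> (nat \<Rightarrow> 'u) \<Rightarrow> (nat \<Rightarrow> 'u set) \<Rightarrow> 'r fm \<Rightarrow> bool" where
  "sat M e E Bot = False"
| "sat M e E (Rel r xs) = (map e xs \<in> interp M r)"
| "sat M e E (Eq x y) = (e x = e y)"
| "sat M e E (Mem X x) = (e x \<in> E X)"
| "sat M e E (Imp \<phi> \<psi>) = (sat M e E \<phi> \<longrightarrow> sat M e E \<psi>)"
| "sat M e E (Forall \<phi>) = (\<forall>a\<in>dom M. sat M (case_nat a e) E \<phi>)"
| "sat M e E (ForallS \<phi>) = (\<forall>A\<in>adm M. sat M e (case_nat A E) \<phi>)"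
| "sat M e E (TC \<phi> u v) =
     (\<forall>A\<in>adm M.
        e u \<in> A \<and>
        (\<forall>a\<in>dom M. \<forall>b\<in>dom M. a \<in> A \<and> sat M (case_nat b (case_nat a e)) E \<phi> \<longrightarrow> b \<in> A)
        \<longrightarrow> e v \<in> A)"
| "sat M e E (LFP \<phi> y) =
     (\<forall>A\<in>adm M.
        (\<forall>a\<in>dom M. sat M (case_nat a e) (case_nat A E) \<phi> \<longrightarrow> a \<in> A)
        \<longrightarrow> e y \<in> A)"

lemma sat_ExistsS: "sat M e E (ExistsS \<phi>) \<longleftrightarrow> (\<exists>A\<in>adm M. sat M e (case_nat A E) \<phi>)"
  by simp

definition henkin_structure ::
    "lang \<Rightarrow> ('r \<Rightarrow> nat) \<Rightarrow> 'r set \<Rightarrow> ('r, 'u) frame \<Rightarrow> bool" where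
  "henkin_structure \<Lambda> ar \<sigma> M \<longleftrightarrow>
     is_frame ar \<sigma> M \<and>
     (\<forall>\<phi> e E. is_formula \<Lambda> ar \<sigma> \<phi> \<longrightarrow> assignment M e E \<longrightarrow>
        {a \<in> dom M. sat M (case_nat a e) E \<phi>} \<in> adm M)"

text \<open>
  Formulas may have free variables, so a model of \<open>\<Gamma>\<close> is a structure together with an
  assignment. HOL cannot quantify over types inside a formula, so the type \<open>'u\<close> from which
  the domains are drawn, as nonempty subsets, is a parameter. Soundness is to be claimed for
  every \<open>'u\<close>; for completeness it suffices to consider one type at least as large as the set of
  formulas, such as \<open>'r fm\<close> itself.
\<close>

definition henkin_consequence ::
    "'u itself \<Rightarrow> lang \<Rightarrow> ('r \<Rightarrow> nat) \<Rightarrow> 'r set \<Rightarrow> 'r fm set \<Rightarrow> 'r fm \<Rightarrow> bool" where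
  "henkin_consequence U \<Lambda> ar \<sigma> \<Gamma> \<phi> \<longleftrightarrow>
     (\<forall>(M :: ('r, 'u) frame) e E.
        henkin_structure \<Lambda> ar \<sigma> M \<longrightarrow> assignment M e E \<longrightarrow>
        (\<forall>\<psi>\<in>\<Gamma>. sat M e E \<psi>) \<longrightarrow> sat M e E \<phi>)"


section \<open>Substitution\<close>

text \<open>\<open>up f\<close> is the renaming \<open>f\<close> moved below a binder.\<close>

definition up :: "(nat \<Rightarrow> nat) \<Rightarrow> nat \<Rightarrow> nat" where
  "up f = case_nat 0 (\<lambda>n. Suc (f n))"

primrec rename :: "(nat \<Rightarrow> nat) \<Rightarrow> (nat \<Rightarrow> nat) \<Rightarrow> 'r fm \<Rightarrow> 'r fm" where
  "rename f F Bot = Bot"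
| "rename f F (Rel r xs) = Rel r (map f xs)"
| "rename f F (Eq x y) = Eq (f x) (f y)"
| "rename f F (Mem X x) = Mem (F X) (f x)"
| "rename f F (Imp \<phi> \<psi>) = Imp (rename f F \<phi>) (rename f F \<psi>)"
| "rename f F (Forall \<phi>) = Forall (rename (up f) F \<phi>)"
| "rename f F (ForallS \<phi>) = ForallS (rename f (up F) \<phi>)"
| "rename f F (TC \<phi> u v) = TC (rename (up (up f)) F \<phi>) (f u) (f v)"
| "rename f F (LFP \<phi> y) = LFP (rename (up f) (up F) \<phi>) (f y)"

text \<open>
  \<open>inst \<psi> t\<close> is \<open>\<psi>(t)\<close>: individual index 0 of \<open>\<psi>\<close> is replaced by the variable \<open>t\<close> and the
  remaining individual indices are lowered by one.
\<close>

definition inst :: "'r fm \<Rightarrow> nat \<Rightarrow> 'r fm" where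
  "inst \<psi> t = rename (case_nat t (\<lambda>n. n)) (\<lambda>X. X) \<psi>"

text \<open>
  Weakening of a formula by one fresh individual (respectively set) variable of index 0.
\<close>

definition lift :: "'r fm \<Rightarrow> 'r fm" where
  "lift \<phi> = rename Suc (\<lambda>X. X) \<phi>"

definition liftS :: "'r fm \<Rightarrow> 'r fm" where
  "liftS \<phi> = rename (\<lambda>x. x) Suc \<phi>"

text \<open>
  A formula \<open>\<psi>(z)\<close> with a distinguished variable \<open>z\<close> is represented with \<open>z\<close> as individual
  index 0 and its other individual variables (the parameters) at the indices above.
  \<open>lift1 \<psi>\<close> weakens it by a fresh individual variable while keeping \<open>z\<close> at index 0.
  The function \<open>subst s \<phi>\<close> replaces every free atom \<open>Xt\<close> in \<open>\<phi>\<close> by \<open>(s X)(t)\<close>; capture is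
  avoided by weakening \<open>s\<close> whenever a binder is crossed.
\<close>

definition lift1 :: "'r fm \<Rightarrow> 'r fm" where
  "lift1 \<psi> = rename (up Suc) (\<lambda>X. X) \<psi>"

definition upS :: "(nat \<Rightarrow> 'r fm) \<Rightarrow> nat \<Rightarrow> 'r fm" where
  "upS s = case_nat (Mem 0 0) (\<lambda>X. liftS (s X))"

primrec subst :: "(nat \<Rightarrow> 'r fm) \<Rightarrow> 'r fm \<Rightarrow> 'r fm" where
  "subst s Bot = Bot"
| "subst s (Rel r xs) = Rel r xs"
| "subst s (Eq x y) = Eq x y"
| "subst s (Mem X x) = inst (s X) x"
| "subst s (Imp \<phi> \<psi>) = Imp (subst s \<phi>) (subst s \<psi>)"
| "subst s (Forall \<phi>) = Forall (subst (lift1 \<circ> s) \<phi>)"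
| "subst s (ForallS \<phi>) = ForallS (subst (upS s) \<phi>)"
| "subst s (TC \<phi> u v) = TC (subst (lift1 \<circ> lift1 \<circ> s) \<phi>) u v"
| "subst s (LFP \<phi> y) = LFP (subst (upS (lift1 \<circ> s)) \<phi>) y"

text \<open>
  \<open>instS \<phi> \<psi>\<close> is \<open>\<phi>[X/\<psi>]\<close> for \<open>X\<close> of set index 0 (the other set indices are lowered by one).
  A set variable \<open>T\<close> or unary predicate \<open>P\<close> is substituted as \<open>Mem T 0\<close> or \<open>Rel P [0]\<close>.
\<close>

definition instS :: "'r fm \<Rightarrow> 'r fm \<Rightarrow> 'r fm" where
  "instS \<phi> \<psi> = subst (case_nat \<psi> (\<lambda>X. Mem X 0)) \<phi>"


section \<open>The proof systems\<close>

text \<open>Propositional evaluation: every formula other than \<open>Bot\<close> and \<open>Imp\<close> is an atom.\<close>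

fun peval :: "('r fm \<Rightarrow> bool) \<Rightarrow> 'r fm \<Rightarrow> bool" where
  "peval v Bot = False"
| "peval v (Imp \<phi> \<psi>) = (peval v \<phi> \<longrightarrow> peval v \<psi>)"
| "peval v \<phi> = v \<phi>"

definition tautology :: "'r fm \<Rightarrow> bool" where
  "tautology \<phi> \<longleftrightarrow> (\<forall>v. peval v \<phi>)"

text \<open>
  \<open>replaced x y \<phi> \<psi>\<close>: \<open>\<phi>\<close> is atomic and \<open>\<psi>\<close> arises from \<open>\<phi>\<close> by replacing \<open>x\<close> by \<open>y\<close> in zero
  or more places.
\<close>

inductive replaced :: "nat \<Rightarrow> nat \<Rightarrow> 'r fm \<Rightarrow> 'r fm \<Rightarrow> bool" for x y where
  "list_all2 (\<lambda>a b. b = a \<or> a = x \<and> b = y) as bs \<Longrightarrow> replaced x y (Rel r as) (Rel r bs)"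
| "list_all2 (\<lambda>a b. b = a \<or> a = x \<and> b = y) [a1, a2] [b1, b2] \<Longrightarrow>
     replaced x y (Eq a1 a2) (Eq b1 b2)"
| "b = a \<or> a = x \<and> b = y \<Longrightarrow> replaced x y (Mem X a) (Mem X b)"

text \<open>
  The induction principle for \<open>[TC_xy \<phi>](u,v)\<close> and \<open>\<psi>\<close>, namely
  \<open>(\<psi>(u) \<and> \<forall>x\<forall>y(\<psi>(x) \<and> \<phi>(x,y) \<longrightarrow> \<psi>(y))) \<longrightarrow> \<psi>(v)\<close>. Under the two quantifiers \<open>x\<close> has index 1 and
  \<open>y\<close> has index 0, so \<open>\<psi>(x)\<close> is \<open>lift \<psi>\<close> and \<open>\<psi>(y)\<close> is \<open>lift1 \<psi>\<close>.
\<close>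

definition tc_ind :: "'r fm \<Rightarrow> nat \<Rightarrow> nat \<Rightarrow> 'r fm \<Rightarrow> 'r fm" where
  "tc_ind \<phi> u v \<psi> =
     Imp (And (inst \<psi> u) (Forall (Forall (Imp (And (lift \<psi>) \<phi>) (lift1 \<psi>))))) (inst \<psi> v)"

text \<open>
  The induction principle for \<open>[LFP_Xx \<phi>]y\<close> and \<open>\<psi>\<close>, namely
  \<open>\<forall>x(\<phi>(x,\<psi>) \<longrightarrow> \<psi>(x)) \<longrightarrow> \<psi>(y)\<close>. Under the quantifier \<open>x\<close> has index 0, so \<open>\<psi>(x)\<close> is \<open>\<psi>\<close>.
\<close>

definition lfp_ind :: "'r fm \<Rightarrow> nat \<Rightarrow> 'r fm \<Rightarrow> 'r fm" where
  "lfp_ind \<phi> y \<psi> = Imp (Forall (Imp (instS \<phi> (lift1 \<psi>)) \<psi>)) (inst \<psi> y)"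

text \<open>
  In the rules \<open>TC_rule\<close> and \<open>LFP_rule\<close> the predicate \<open>P\<close> has to be fresh for \<open>\<phi>\<close> as well as
  for \<open>\<xi>\<close> (otherwise they would be unsound); as \<open>X\<close> is positive in \<open>\<phi>\<close>, so is then \<open>P\<close> in
  \<open>\<phi>(x,P)\<close>.
\<close>

inductive provable :: "lang \<Rightarrow> ('r \<Rightarrow> nat) \<Rightarrow> 'r fm \<Rightarrow> bool"
  for \<Lambda> :: lang and ar :: "'r \<Rightarrow> nat" where
  Taut: "is_formula \<Lambda> ar UNIV \<phi> \<Longrightarrow> tautology \<phi> \<Longrightarrow> provable \<Lambda> ar \<phi>"
| Forall_inst: "is_formula \<Lambda> ar UNIV \<phi> \<Longrightarrow> provable \<Lambda> ar (Imp (Forall \<phi>) (inst \<phi> t))"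
| Forall_Imp: "is_formula \<Lambda> ar UNIV \<phi> \<Longrightarrow> is_formula \<Lambda> ar UNIV \<psi> \<Longrightarrow>
    provable \<Lambda> ar (Imp (Forall (Imp \<phi> \<psi>)) (Imp (Forall \<phi>) (Forall \<psi>)))"
| Forall_vac: "is_formula \<Lambda> ar UNIV \<phi> \<Longrightarrow> provable \<Lambda> ar (Imp \<phi> (Forall (lift \<phi>)))"
| Eq_refl: "provable \<Lambda> ar (Eq x x)"
| Eq_repl: "is_formula \<Lambda> ar UNIV \<phi> \<Longrightarrow> replaced x y \<phi> \<psi> \<Longrightarrow>
    provable \<Lambda> ar (Imp (Eq x y) (Imp \<phi> \<psi>))"
| MP: "provable \<Lambda> ar (Imp \<phi> \<psi>) \<Longrightarrow> provable \<Lambda> ar \<phi> \<Longrightarrow> provable \<Lambda> ar \<psi>"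
| Gen: "provable \<Lambda> ar \<phi> \<Longrightarrow> provable \<Lambda> ar (Forall \<phi>)"

| Compr: "\<Lambda> = MSO \<Longrightarrow> is_formula \<Lambda> ar UNIV \<phi> \<Longrightarrow>
    provable \<Lambda> ar (ExistsS (Forall (Iff (Mem 0 0) (liftS \<phi>))))"
| ForallS_inst_var: "\<Lambda> = MSO \<Longrightarrow> is_formula \<Lambda> ar UNIV \<phi> \<Longrightarrow>
    provable \<Lambda> ar (Imp (ForallS \<phi>) (instS \<phi> (Mem T 0)))"
| ForallS_inst_pred: "\<Lambda> = MSO \<Longrightarrow> is_formula \<Lambda> ar UNIV \<phi> \<Longrightarrow> ar P = 1 \<Longrightarrow>
    provable \<Lambda> ar (Imp (ForallS \<phi>) (instS \<phi> (Rel P [0])))"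
| ForallS_Imp: "\<Lambda> = MSO \<Longrightarrow> is_formula \<Lambda> ar UNIV \<phi> \<Longrightarrow> is_formula \<Lambda> ar UNIV \<psi> \<Longrightarrow>
    provable \<Lambda> ar (Imp (ForallS (Imp \<phi> \<psi>)) (Imp (ForallS \<phi>) (ForallS \<psi>)))"
| ForallS_vac: "\<Lambda> = MSO \<Longrightarrow> is_formula \<Lambda> ar UNIV \<phi> \<Longrightarrow>
    provable \<Lambda> ar (Imp \<phi> (ForallS (liftS \<phi>)))"
| GenS: "\<Lambda> = MSO \<Longrightarrow> provable \<Lambda> ar \<phi> \<Longrightarrow> provable \<Lambda> ar (ForallS \<phi>)"

| TC_ax: "\<Lambda> = FO_TC1 \<Longrightarrow> is_formula \<Lambda> ar UNIV \<phi> \<Longrightarrow> is_formula \<Lambda> ar UNIV \<psi> \<Longrightarrow>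
    provable \<Lambda> ar (Imp (TC \<phi> u v) (tc_ind \<phi> u v \<psi>))"
| TC_rule: "\<Lambda> = FO_TC1 \<Longrightarrow> is_formula \<Lambda> ar UNIV \<phi> \<Longrightarrow>
    ar P = 1 \<Longrightarrow> P \<notin> preds \<xi> \<Longrightarrow> P \<notin> preds \<phi> \<Longrightarrow>
    provable \<Lambda> ar (Imp \<xi> (tc_ind \<phi> u v (Rel P [0]))) \<Longrightarrow>
    provable \<Lambda> ar (Imp \<xi> (TC \<phi> u v))"

| LFP_ax: "\<Lambda> = FO_LFP1 \<Longrightarrow> is_formula \<Lambda> ar UNIV \<phi> \<Longrightarrow> positive_in 0 \<phi> \<Longrightarrow>
    is_formula \<Lambda> ar UNIV \<psi> \<Longrightarrow>
    provable \<Lambda> ar (Imp (LFP \<phi> y) (lfp_ind \<phi> y \<psi>))"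
| LFP_rule: "\<Lambda> = FO_LFP1 \<Longrightarrow> is_formula \<Lambda> ar UNIV \<phi> \<Longrightarrow> positive_in 0 \<phi> \<Longrightarrow>
    ar P = 1 \<Longrightarrow> P \<notin> preds \<xi> \<Longrightarrow> P \<notin> preds \<phi> \<Longrightarrow>
    provable \<Lambda> ar (Imp \<xi> (lfp_ind \<phi> y (Rel P [0]))) \<Longrightarrow>
    provable \<Lambda> ar (Imp \<xi> (LFP \<phi> y))"

text \<open>
  The rules \<open>TC_rule\<close> and \<open>LFP_rule\<close> need fresh unary predicates, which a vocabulary with few
  unary predicates cannot supply. Derivations therefore take place over the vocabulary
  extended by countably many unary predicates \<open>Inr 0, Inr 1, ...\<close>, while \<open>\<Gamma>\<close> and \<open>\<phi>\<close> belong
  to the original vocabulary.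
\<close>

definition derivable :: "lang \<Rightarrow> ('r \<Rightarrow> nat) \<Rightarrow> 'r fm set \<Rightarrow> 'r fm \<Rightarrow> bool" where
  "derivable \<Lambda> ar \<Gamma> \<phi> \<longleftrightarrow>
     (\<exists>\<psi>s. set \<psi>s \<subseteq> \<Gamma> \<and>
        provable \<Lambda> (case_sum ar (\<lambda>_::nat. 1)) (map_fm Inl (Imp (foldr And \<psi>s Top) \<phi>)))"

end

theory Submission imports Defs
begin

text \<open>
  Soundness is an induction on derivations. Only the rules for TC and LFP are delicate, as their
  fresh predicate \<open>P\<close> has to name a counterexample in a structure that is still a Henkin structure.
  For LFP any admissible set will do, since \<open>P\<close> can be replaced by a set variable. For TC it is the
  definable set of all \<open>b\<close> with \<open>[TC_xy \<phi>](u,b)\<close>: if \<open>[TC_xy \<phi>](u,v)\<close> fails at all, then this set is a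
  counterexample.

  Completeness is a Henkin construction with witnessing constants for individuals and for sets. For
  MSO and LFP the admissible sets are those named by a constant. In LFP, where sets cannot be
  quantified, a set constant is conservative because derivations are closed under substitution of
  formulas for set variables, for which replacement of equals is needed. A witness against
  \<open>[LFP_Xx \<phi>]y\<close> comes from the LFP rule with the constant in place of \<open>P\<close>. For TC the admissible sets are
  the definable ones, and the set of all \<open>b\<close> with \<open>[TC_xy \<phi>](u,b)\<close> is the witness again, because
  transitive closures are provably reflexive and closed under steps.
\<close>

section \<open>Renaming and substitution\<close>

text \<open>The equality axioms concern atoms only, but substituting a formula for a set variable
  turns an atom \<open>Mem X a\<close> into an arbitrary formula. Replacement of equals must
  therefore be derived for all formulas; for TC and LFP this passes through their rules and consumes
  fresh unary predicates. Hence the recurring hypothesis that there are infinitely many, which the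
  extension by \<open>Inr n\<close> meets.

  Witness constants are not added to the syntax. A formula with constants is the family of ordinary
  formulas obtained by all replacements of constants by variables. A constant then becomes an
  eigenvariable when it is sent to de Bruijn index 0 and the others are shifted. There are no stages
  either: a constant carries the formula it witnesses together with its parameters, and the nesting
  of constants takes the place of the usual chain of language extensions.\<close>

lemma o_ident [simp]: "f \<circ> (\<lambda>x. x) = f" "(\<lambda>x. x) \<circ> f = f"
  by auto

lemma up_0 [simp]: "up f 0 = 0" and up_Suc [simp]: "up f (Suc n) = Suc (f n)"
  by (simp_all add: up_def)

lemma up_comp [simp]: "up f \<circ> up g = up (f \<circ> g)"
  by (auto simp: fun_eq_iff up_def split: nat.splits)

lemma up_ident [simp]: "up (\<lambda>x. x) = (\<lambda>x. x)"
  by (auto simp: fun_eq_iff up_def split: nat.splits)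

lemma up_o_Suc [simp]: "up f \<circ> Suc = Suc \<circ> f"
  by auto

lemma case_nat_o_Suc [simp]: "case_nat a f \<circ> Suc = f"
  by auto

lemma case_nat_o_up [simp]: "case_nat a f \<circ> up g = case_nat a (f \<circ> g)"
  by (auto simp: fun_eq_iff up_def split: nat.splits)

lemma o_case_nat [simp]: "f \<circ> case_nat a g = case_nat (f a) (f \<circ> g)"
  by (auto simp: fun_eq_iff split: nat.splits)

lemma case_nat_0_Suc [simp]: "case_nat 0 Suc = (\<lambda>n. n)"
  by (auto simp: fun_eq_iff split: nat.splits)

lemma rename_rename [simp]: "rename f F (rename g G \<phi>) = rename (f \<circ> g) (F \<circ> G) \<phi>"
  by (induction \<phi> arbitrary: f F g G) auto

lemma rename_ident [simp]: "rename (\<lambda>x. x) (\<lambda>X. X) \<phi> = \<phi>"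
  by (induction \<phi>) auto

lemma preds_rename [simp]: "preds (rename f F \<phi>) = preds \<phi>"
  by (induction \<phi> arbitrary: f F) auto

lemma rename_inst: "rename f F (inst \<phi> t) = inst (rename (up f) F \<phi>) (f t)"
  by (simp add: inst_def)

lemma rename_lift: "rename (up f) F (lift \<phi>) = lift (rename f F \<phi>)"
  by (simp add: lift_def)

lemma rename_liftS: "rename f (up F) (liftS \<phi>) = liftS (rename f F \<phi>)"
  by (simp add: liftS_def)

lemma rename_lift1: "rename (up (up f)) F (lift1 \<phi>) = lift1 (rename (up f) F \<phi>)"
  by (simp add: lift1_def)

lemma inst_lift [simp]: "inst (lift \<phi>) t = \<phi>"
  by (simp add: inst_def lift_def)

lemma lift1_Mem [simp]: "lift1 (Mem X 0) = Mem X 0"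
  by (simp add: lift1_def)

lemma lift1_Rel [simp]: "lift1 (Rel P [0]) = Rel P [0]"
  by (simp add: lift1_def)

lemma inst_Rel0 [simp]: "inst (Rel P [0]) t = Rel P [t]"
  by (simp add: inst_def)

lemma inst_Mem0 [simp]: "inst (Mem X 0) t = Mem X t"
  by (simp add: inst_def)

lemma lift1_o: "lift1 \<circ> s = (\<lambda>X. rename (up Suc) (\<lambda>X. X) (s X))"
  by (auto simp: lift1_def)

text \<open>
  Renaming and set substitution performed simultaneously. Both are special cases, so that all
  commutation laws below are consequences of a single composition law.
\<close>

primrec bsub :: "(nat \<Rightarrow> nat) \<Rightarrow> (nat \<Rightarrow> 'r fm) \<Rightarrow> 'r fm \<Rightarrow> 'r fm" where
  "bsub f s Bot = Bot"
| "bsub f s (Rel r xs) = Rel r (map f xs)"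
| "bsub f s (Eq x y) = Eq (f x) (f y)"
| "bsub f s (Mem X x) = inst (s X) (f x)"
| "bsub f s (Imp \<phi> \<psi>) = Imp (bsub f s \<phi>) (bsub f s \<psi>)"
| "bsub f s (Forall \<phi>) = Forall (bsub (up f) (lift1 \<circ> s) \<phi>)"
| "bsub f s (ForallS \<phi>) = ForallS (bsub f (upS s) \<phi>)"
| "bsub f s (TC \<phi> u v) = TC (bsub (up (up f)) (lift1 \<circ> lift1 \<circ> s) \<phi>) (f u) (f v)"
| "bsub f s (LFP \<phi> y) = LFP (bsub (up f) (upS (lift1 \<circ> s)) \<phi>) (f y)"

lemma subst_eq_bsub: "subst s \<phi> = bsub (\<lambda>x. x) s \<phi>"
  by (induction \<phi> arbitrary: s) auto

lemma upS_Mem: "upS (\<lambda>X. Mem (F X) 0) = (\<lambda>X. Mem (up F X) 0)"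
  by (auto simp: fun_eq_iff upS_def up_def liftS_def split: nat.splits)

lemma lift1_o_Mem: "lift1 \<circ> (\<lambda>X. Mem (F X) 0) = (\<lambda>X. Mem (F X) 0)"
  by (auto simp: fun_eq_iff)

lemma rename_eq_bsub: "rename f F \<phi> = bsub f (\<lambda>X. Mem (F X) 0) \<phi>"
  by (induction \<phi> arbitrary: f F) (auto simp: lift1_o_Mem upS_Mem comp_assoc)

lemma bsub_ident [simp]: "bsub (\<lambda>x. x) (\<lambda>X. Mem X 0) \<phi> = \<phi>"
  using rename_eq_bsub[of "\<lambda>x. x" "\<lambda>X. X" \<phi>] by simp

lemma lift1_o_Mem0 [simp]: "lift1 \<circ> (\<lambda>X. Mem X 0) = (\<lambda>X. Mem X 0)"
  using lift1_o_Mem[of "\<lambda>X. X"] by simp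

lemma upS_Mem0 [simp]: "upS (\<lambda>X. Mem X 0) = (\<lambda>X. Mem X 0)"
  using upS_Mem[of "\<lambda>X. X"] by simp

lemma rename_upS:
  "(\<lambda>X. rename (up f) (up F) (upS s X)) = upS (\<lambda>X. rename (up f) F (s X))"
  by (auto simp: fun_eq_iff upS_def liftS_def split: nat.splits)

lemma rename_lift1_o:
  "(\<lambda>X. rename (up (up f)) F (lift1 (s X))) = lift1 \<circ> (\<lambda>X. rename (up f) F (s X))"
  by (auto simp: rename_lift1)

lemma rename_bsub:
  "rename f F (bsub g s \<phi>) = bsub (f \<circ> g) (\<lambda>X. rename (up f) F (s X)) \<phi>"
proof (induction \<phi> arbitrary: f F g s)
  case (Mem X x) then show ?case by (simp add: rename_inst)
qed (simp_all add: rename_upS rename_lift1_o, simp_all add: comp_def rename_lift1)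

lemma upS_o_up: "upS s \<circ> up G = upS (s \<circ> G)"
  by (auto simp: fun_eq_iff upS_def up_def split: nat.splits)

lemma bsub_rename: "bsub f s (rename g G \<phi>) = bsub (f \<circ> g) (s \<circ> G) \<phi>"
  by (induction \<phi> arbitrary: f s g G) (auto simp: upS_o_up comp_assoc)

lemma lift1_bsub: "lift1 (bsub (up f) (lift1 \<circ> s) \<phi>) = bsub (up (up f)) (lift1 \<circ> (lift1 \<circ> s)) (lift1 \<phi>)"
  by (simp add: lift1_def lift1_o rename_bsub bsub_rename)

lemma bsub_upS:
  "(\<lambda>X. bsub (up f) (upS (lift1 \<circ> s)) (upS t X)) = upS (\<lambda>X. bsub (up f) (lift1 \<circ> s) (t X))"
proof
  fix X
  show "bsub (up f) (upS (lift1 \<circ> s)) (upS t X) = upS (\<lambda>X. bsub (up f) (lift1 \<circ> s) (t X)) X"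
    by (cases X) (simp_all add: upS_def liftS_def rename_bsub bsub_rename comp_def)
qed

lemma lift1_o_upS: "lift1 \<circ> upS s = upS (lift1 \<circ> s)"
  by (auto simp: fun_eq_iff upS_def lift1_def liftS_def split: nat.splits)

text \<open>Each \<open>t X\<close> has its distinguished variable at index 0, so the outer renaming
  and substitution reach it as if below one individual binder; this accounts for \<open>up f\<close>
  and \<open>lift1 \<circ> s\<close>.\<close>

lemma bsub_bsub:
  "bsub f s (bsub g t \<phi>) = bsub (f \<circ> g) (\<lambda>X. bsub (up f) (lift1 \<circ> s) (t X)) \<phi>"
proof (induction \<phi> arbitrary: f s g t)
  case (Mem X x) then show ?case
    by (simp add: inst_def bsub_rename rename_bsub lift1_o)
next
  case (Forall \<phi>)
  have *: "(\<lambda>X. bsub (up (up f)) (lift1 \<circ> (lift1 \<circ> s)) ((lift1 \<circ> t) X)) =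
        lift1 \<circ> (\<lambda>X. bsub (up f) (lift1 \<circ> s) (t X))"
    by (simp add: comp_def lift1_bsub[unfolded comp_def])
  show ?case by (simp only: bsub.simps Forall.IH up_comp *)
next
  case (ForallS \<phi>)
  show ?case by (simp only: bsub.simps ForallS.IH lift1_o_upS bsub_upS)
next
  case (TC \<phi> u v)
  have *: "(\<lambda>X. bsub (up (up (up f))) (lift1 \<circ> (lift1 \<circ> (lift1 \<circ> s))) ((lift1 \<circ> (lift1 \<circ> t)) X)) =
        lift1 \<circ> (lift1 \<circ> (\<lambda>X. bsub (up f) (lift1 \<circ> s) (t X)))"
    by (simp add: comp_def lift1_bsub[unfolded comp_def])
  show ?case by (simp only: bsub.simps TC.IH up_comp comp_assoc *) simp
next
  case (LFP \<phi> y)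
  have *: "(\<lambda>X. bsub (up (up f)) (lift1 \<circ> (lift1 \<circ> s)) ((lift1 \<circ> t) X)) =
        lift1 \<circ> (\<lambda>X. bsub (up f) (lift1 \<circ> s) (t X))"
    by (simp add: comp_def lift1_bsub[unfolded comp_def])
  show ?case by (simp only: bsub.simps LFP.IH up_comp lift1_o_upS bsub_upS *) simp
qed simp_all

lemma instS_eq_bsub: "instS \<phi> \<psi> = bsub (\<lambda>x. x) (case_nat \<psi> (\<lambda>X. Mem X 0)) \<phi>"
  by (simp add: instS_def subst_eq_bsub)

lemma instS_Mem: "instS \<phi> (Mem T 0) = rename (\<lambda>x. x) (case_nat T (\<lambda>X. X)) \<phi>"
proof -
  have "case_nat (Mem T 0) (\<lambda>X. Mem X 0) = (\<lambda>X. Mem (case_nat T (\<lambda>X. X) X) 0 :: 'a fm)"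
    by (auto simp: fun_eq_iff split: nat.splits)
  then show ?thesis by (simp add: instS_eq_bsub rename_eq_bsub)
qed

lemma instS_liftS [simp]: "instS (liftS \<phi>) \<psi> = \<phi>"
proof -
  show ?thesis by (simp add: instS_eq_bsub liftS_def bsub_rename)
qed

lemma rename_instS:
  "rename f F (instS \<phi> \<psi>) = instS (rename f (up F) \<phi>) (rename (up f) F \<psi>)"
proof -
  have "(\<lambda>X. rename (up f) F (case_nat \<psi> (\<lambda>X. Mem X 0) X)) =
     case_nat (rename (up f) F \<psi>) (\<lambda>X. Mem X 0) \<circ> up F"
    by (auto simp: fun_eq_iff up_def split: nat.splits)
  then show ?thesis
    by (simp add: instS_eq_bsub rename_bsub bsub_rename)
qed

lemma rename_tc_ind:
  "rename f F (tc_ind \<phi> u v \<psi>) =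
   tc_ind (rename (up (up f)) F \<phi>) (f u) (f v) (rename (up f) F \<psi>)"
  by (simp add: tc_ind_def rename_inst rename_lift rename_lift1)

lemma rename_lfp_ind:
  "rename f F (lfp_ind \<phi> y \<psi>) = lfp_ind (rename (up f) (up F) \<phi>) (f y) (rename (up f) F \<psi>)"
  by (simp add: lfp_ind_def rename_inst rename_instS rename_lift1)

lemma bsub_inst:
  "bsub f s (inst \<phi> t) = inst (bsub (up f) (lift1 \<circ> s) \<phi>) (f t)"
  by (simp add: inst_def bsub_rename rename_bsub lift1_o)

lemma bsub_lift: "bsub (up f) (lift1 \<circ> s) (lift \<phi>) = lift (bsub f s \<phi>)"
  by (simp add: lift_def bsub_rename rename_bsub lift1_o)

lemma bsub_instS:
  "bsub f s (instS \<phi> \<psi>) = instS (bsub f (upS s) \<phi>) (bsub (up f) (lift1 \<circ> s) \<psi>)"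
proof -
  define t where "t = case_nat (bsub (up f) (lift1 \<circ> s) \<psi>) (\<lambda>X. Mem X 0)"
  \<comment> \<open>By \<open>bsub_bsub\<close> both sides are single substitutions, to be compared
    on set indices only: index 0 yields the substituted \<psi>, and at the others the weakening by
    \<open>liftS\<close> is cancelled.\<close>
  have *: "bsub (\<lambda>x. x) (lift1 \<circ> t) (upS s X) = bsub (up f) (lift1 \<circ> s) (case_nat \<psi> (\<lambda>X. Mem X 0) X)" for X
  proof (cases X)
    case 0
    then show ?thesis by (simp add: upS_def t_def inst_def lift1_def)
  next
    case (Suc Y)
    have "bsub (\<lambda>x. x) (lift1 \<circ> t) (liftS (s Y)) = s Y"
      by (simp add: liftS_def bsub_rename t_def comp_def)
    then show ?thesis using Suc by (simp add: upS_def inst_def lift1_def)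
  qed
  show ?thesis
    unfolding instS_eq_bsub bsub_bsub t_def[symmetric]
    by (simp add: * cong: if_cong)
qed

lemma bsub_lfp_ind:
  "bsub f s (lfp_ind \<phi> y \<psi>) =
   lfp_ind (bsub (up f) (upS (lift1 \<circ> s)) \<phi>) (f y) (bsub (up f) (lift1 \<circ> s) \<psi>)"
  by (simp add: lfp_ind_def bsub_inst bsub_instS lift1_bsub)

lemma inst_lift1 [simp]: "inst (lift1 \<psi>) 0 = \<psi>"
  by (simp add: inst_def lift1_def)

section \<open>Well-formedness\<close>

lemma pol_rename:
  "(\<And>Y. F Y = Z \<longleftrightarrow> Y = X) \<Longrightarrow> pol p Z (rename f F \<phi>) = pol p X \<phi>"
proof (induction \<phi> arbitrary: p f F X Z)
  case (ForallS \<phi>)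
  have "up F Y = Suc Z \<longleftrightarrow> Y = Suc X" for Y using ForallS.prems by (cases Y) auto
  then show ?case using ForallS.IH by simp
next
  case (LFP \<phi> y)
  have "up F Y = Suc Z \<longleftrightarrow> Y = Suc X" for Y using LFP.prems by (cases Y) auto
  then show ?case using LFP.IH by simp
qed auto

lemma pol_rename_fresh:
  "(\<And>Y. F Y \<noteq> Z) \<Longrightarrow> pol p Z (rename f F \<phi>)"
proof (induction \<phi> arbitrary: p f F Z)
  case (ForallS \<phi>)
  have "up F Y \<noteq> Suc Z" for Y using ForallS.prems by (cases Y) auto
  then show ?case using ForallS.IH by simp
next
  case (LFP \<phi> y)
  have "up F Y \<noteq> Suc Z" for Y using LFP.prems by (cases Y) auto
  then show ?case using LFP.IH by simp
qed auto

lemma pol_rename_up0 [simp]: "pol p 0 (rename f (up F) \<phi>) = pol p 0 \<phi>"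
  by (rule pol_rename) (auto simp: up_def split: nat.splits)

lemma is_formula_rename [simp]: "is_formula \<Lambda> ar \<sigma> (rename f F \<phi>) = is_formula \<Lambda> ar \<sigma> \<phi>"
  by (induction \<phi> arbitrary: f F) auto

lemma is_formula_weaken [simp]:
  "is_formula \<Lambda> ar \<sigma> (inst \<phi> t) = is_formula \<Lambda> ar \<sigma> \<phi>"
  "is_formula \<Lambda> ar \<sigma> (lift \<phi>) = is_formula \<Lambda> ar \<sigma> \<phi>"
  "is_formula \<Lambda> ar \<sigma> (liftS \<phi>) = is_formula \<Lambda> ar \<sigma> \<phi>"
  "is_formula \<Lambda> ar \<sigma> (lift1 \<phi>) = is_formula \<Lambda> ar \<sigma> \<phi>"
  by (simp_all add: inst_def lift_def liftS_def lift1_def)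

lemma preds_weaken [simp]:
  "preds (inst \<phi> t) = preds \<phi>" "preds (lift \<phi>) = preds \<phi>"
  "preds (liftS \<phi>) = preds \<phi>" "preds (lift1 \<phi>) = preds \<phi>"
  by (simp_all add: inst_def lift_def liftS_def lift1_def)

text \<open>\<open>\<forall>q. pol q Z\<close> says that \<open>Z\<close> does not occur free, since
  an occurrence cannot have both polarities. So \<open>Z\<close> enters the result only where
  \<open>X\<close> stood, with the same polarity.\<close>

lemma pol_bsub:
  assumes "\<And>Y. Y \<noteq> X \<Longrightarrow> (\<forall>q. pol q Z (s Y))" "s X = Mem Z 0"
  shows "pol p X \<phi> \<Longrightarrow> pol p Z (bsub f s \<phi>)"
  using assms
proof (induction \<phi> arbitrary: p f s X Z)
  case (Mem Y y)
  then show ?case by (cases "Y = X") (auto simp: inst_def pol_rename[where X=Z])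
next
  case (Forall \<phi>)
  show ?case using Forall.prems
    by (simp, intro Forall.IH[of p X]) (auto simp: lift1_def pol_rename[where X=Z])
next
  case (ForallS \<phi>)
  have "Y \<noteq> Suc X \<Longrightarrow> \<forall>q. pol q (Suc Z) (upS s Y)" for Y
    using ForallS.prems(2)[of "Y - 1"]
    by (cases Y) (auto simp: upS_def liftS_def pol_rename[where X=Z])
  moreover have "upS s (Suc X) = Mem (Suc Z) 0"
    using ForallS.prems by (simp add: upS_def liftS_def)
  ultimately show ?case using ForallS.prems(1)
    by (simp, intro ForallS.IH[of p "Suc X"]) auto
next
  case (TC \<phi> u v)
  show ?case using TC.prems
    by (simp, intro TC.IH[of p X]) (auto simp: lift1_def pol_rename[where X=Z])
next
  case (LFP \<phi> y)
  have "Y \<noteq> Suc X \<Longrightarrow> \<forall>q. pol q (Suc Z) (upS (lift1 \<circ> s) Y)" for Y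
    using LFP.prems(2)[of "Y - 1"]
    by (cases Y) (auto simp: upS_def liftS_def lift1_def pol_rename[where X=Z])
  moreover have "upS (lift1 \<circ> s) (Suc X) = Mem (Suc Z) 0"
    using LFP.prems by (simp add: upS_def liftS_def)
  ultimately show ?case using LFP.prems(1)
    by (simp, intro LFP.IH[of p "Suc X"]) auto
qed auto

lemma pol_bsub_upS: "pol p 0 \<phi> \<Longrightarrow> pol p 0 (bsub f (upS s) \<phi>)"
  by (rule pol_bsub) (auto simp: upS_def liftS_def pol_rename_fresh split: nat.splits)

lemma is_formula_upS:
  "\<Lambda> \<noteq> FO_TC1 \<Longrightarrow> (\<And>X. is_formula \<Lambda> ar \<sigma> (s X)) \<Longrightarrow> is_formula \<Lambda> ar \<sigma> (upS s X)"
  by (cases \<Lambda>) (auto simp: upS_def split: nat.splits)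

lemma is_formula_bsub:
  "is_formula \<Lambda> ar \<sigma> \<phi> \<Longrightarrow> (\<And>X. is_formula \<Lambda> ar \<sigma> (s X)) \<Longrightarrow> is_formula \<Lambda> ar \<sigma> (bsub f s \<phi>)"
proof (induction \<phi> arbitrary: f s)
  case (ForallS \<phi>)
  have "is_formula \<Lambda> ar \<sigma> (upS s X)" for X
    using ForallS.prems by (auto simp: upS_def split: nat.splits)
  then show ?case using ForallS by auto
next
  case (LFP \<phi> y)
  have "is_formula \<Lambda> ar \<sigma> (upS (lift1 \<circ> s) X)" for X
    using LFP.prems by (auto simp: upS_def split: nat.splits)
  then show ?case using LFP by (auto simp: pol_bsub_upS)
qed auto

lemma is_formula_instS:
  assumes "is_formula \<Lambda> ar \<sigma> \<phi>" "is_formula \<Lambda> ar \<sigma> \<psi>" "\<Lambda> \<noteq> FO_TC1"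
  shows "is_formula \<Lambda> ar \<sigma> (instS \<phi> \<psi>)"
  unfolding instS_eq_bsub using assms
  by (intro is_formula_bsub) (auto split: nat.splits intro: lang.exhaust[of \<Lambda>])

lemma is_formula_tc_ind:
  "is_formula \<Lambda> ar \<sigma> \<phi> \<Longrightarrow> is_formula \<Lambda> ar \<sigma> \<psi> \<Longrightarrow> is_formula \<Lambda> ar \<sigma> (tc_ind \<phi> u v \<psi>)"
  by (simp add: tc_ind_def)

lemma is_formula_lfp_ind:
  "is_formula \<Lambda> ar \<sigma> \<phi> \<Longrightarrow> is_formula \<Lambda> ar \<sigma> \<psi> \<Longrightarrow> \<Lambda> \<noteq> FO_TC1 \<Longrightarrow>
   is_formula \<Lambda> ar \<sigma> (lfp_ind \<phi> y \<psi>)"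
  by (simp add: lfp_ind_def is_formula_instS)

lemma preds_bsub: "preds (bsub f s \<phi>) \<subseteq> preds \<phi> \<union> (\<Union>X. preds (s X))"
proof (induction \<phi> arbitrary: f s)
  case (Imp \<phi> \<psi>)
  from Imp.IH[of f s] show ?case by auto
next
  case (Forall \<phi>)
  from this[of "up f" "lift1 \<circ> s"] show ?case by (simp add: comp_def)
next
  case (ForallS \<phi>)
  have "(\<Union>X. preds (upS s X)) \<subseteq> (\<Union>X. preds (s X))"
    by (auto simp: upS_def split: nat.splits)
  with ForallS[of f "upS s"] show ?case by auto
next
  case (TC \<phi> u v)
  from this[of "up (up f)" "lift1 \<circ> lift1 \<circ> s"] show ?case by (simp add: comp_def)
next
  case (LFP \<phi> y)
  have "(\<Union>X. preds (upS (lift1 \<circ> s) X)) \<subseteq> (\<Union>X. preds (s X))"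
    by (auto simp: upS_def split: nat.splits)
  with LFP[of "up f" "upS (lift1 \<circ> s)"] show ?case by auto
qed auto

lemma finite_preds [simp]: "finite (preds \<phi>)"
  by (induction \<phi>) auto

section \<open>Derived rules\<close>

lemma replaced_is_formula:
  "replaced x y \<phi> \<psi> \<Longrightarrow> is_formula \<Lambda> ar \<sigma> \<phi> \<Longrightarrow> is_formula \<Lambda> ar \<sigma> \<psi>"
  by (induction rule: replaced.induct) (auto dest: list_all2_lengthD)

lemma provable_is_formula: "provable \<Lambda> ar \<phi> \<Longrightarrow> is_formula \<Lambda> ar UNIV \<phi>"
proof (induction rule: provable.induct)
  case (Eq_repl \<phi> x y \<psi>)
  then show ?case by (auto dest: replaced_is_formula elim: replaced.cases)
qed (auto simp: is_formula_instS is_formula_tc_ind is_formula_lfp_ind)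

text \<open>Propositional consequence, tested on valuations; together with \<open>prov2\<close> and
  \<open>prov3\<close> it stands in for propositional derivations throughout.\<close>

lemma prov1:
  "provable \<Lambda> ar a \<Longrightarrow> is_formula \<Lambda> ar UNIV b \<Longrightarrow> (\<And>v. peval v a \<Longrightarrow> peval v b) \<Longrightarrow>
   provable \<Lambda> ar b"
  by (rule MP[OF Taut]) (auto simp: tautology_def dest: provable_is_formula)

lemma prov2:
  "provable \<Lambda> ar a \<Longrightarrow> provable \<Lambda> ar b \<Longrightarrow> is_formula \<Lambda> ar UNIV c \<Longrightarrow>
   (\<And>v. peval v a \<Longrightarrow> peval v b \<Longrightarrow> peval v c) \<Longrightarrow> provable \<Lambda> ar c"
  by (rule MP[of _ _ b], rule prov1[of _ _ a]) (auto dest: provable_is_formula)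

lemma prov3:
  "provable \<Lambda> ar a \<Longrightarrow> provable \<Lambda> ar b \<Longrightarrow> provable \<Lambda> ar c \<Longrightarrow> is_formula \<Lambda> ar UNIV d \<Longrightarrow>
   (\<And>v. peval v a \<Longrightarrow> peval v b \<Longrightarrow> peval v c \<Longrightarrow> peval v d) \<Longrightarrow> provable \<Lambda> ar d"
  by (rule MP[of _ _ c], rule prov2[of _ _ a b]) (auto dest: provable_is_formula)

text \<open>Carries a side assumption \<open>a\<close>, later an equation or a negated goal, below
  the quantifier; the occurrence as \<open>lift a\<close> keeps the bound variable out of
  it.\<close>

lemma provable_Forall_mono:
  assumes "provable \<Lambda> ar (Imp (lift a) (Imp b c))"
  shows "provable \<Lambda> ar (Imp a (Imp (Forall b) (Forall c)))"
proof -
  have f: "is_formula \<Lambda> ar UNIV a" "is_formula \<Lambda> ar UNIV b" "is_formula \<Lambda> ar UNIV c"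
    using provable_is_formula[OF assms] by auto
  have 1: "provable \<Lambda> ar (Imp (Forall (lift a)) (Forall (Imp b c)))"
    by (rule MP[OF Forall_Imp Gen[OF assms]]) (use f in auto)
  have 2: "provable \<Lambda> ar (Imp (Forall (Imp b c)) (Imp (Forall b) (Forall c)))"
    by (rule Forall_Imp) (use f in auto)
  show ?thesis
    by (rule prov3[OF 1 2 Forall_vac[OF f(1)]]) (use f in auto)
qed

lemma provable_ForallS_mono:
  assumes "\<Lambda> = MSO" "provable \<Lambda> ar (Imp (liftS a) (Imp b c))"
  shows "provable \<Lambda> ar (Imp a (Imp (ForallS b) (ForallS c)))"
proof -
  have f: "is_formula \<Lambda> ar UNIV a" "is_formula \<Lambda> ar UNIV b" "is_formula \<Lambda> ar UNIV c"
    using provable_is_formula[OF assms(2)] by auto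
  have 1: "provable \<Lambda> ar (Imp (ForallS (liftS a)) (ForallS (Imp b c)))"
    by (rule MP[OF ForallS_Imp GenS[OF assms]]) (use f assms in auto)
  have 2: "provable \<Lambda> ar (Imp (ForallS (Imp b c)) (Imp (ForallS b) (ForallS c)))"
    by (rule ForallS_Imp) (use f assms in auto)
  show ?thesis
    by (rule prov3[OF 1 2 ForallS_vac[OF assms(1) f(1)]]) (use f assms in auto)
qed

lemma fresh_pred:
  assumes "infinite {P. ar P = (1::nat)}" "finite A"
  obtains P where "ar P = 1" "P \<notin> A"
  using infinite_imp_nonempty[OF Diff_infinite_finite[OF assms(2,1)]] by auto

lemma tc_ind_Rel:
  "tc_ind \<phi> u v (Rel P [0]) =
   Imp (And (Rel P [u]) (Forall (Forall (Imp (And (Rel P [1]) \<phi>) (Rel P [0]))))) (Rel P [v])"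
  by (simp add: tc_ind_def lift_def)

section \<open>Closure of provability under renaming\<close>

text \<open>A prime formula such as \<open>Mem X x\<close> may become compound. Pulling the
  valuation back along the substitution absorbs this, so tautologies remain tautologies.\<close>

lemma peval_bsub: "peval v (bsub f s \<phi>) = peval (\<lambda>\<psi>. peval v (bsub f s \<psi>)) \<phi>"
  by (induction \<phi>) simp_all

lemma peval_map_fm: "peval v (map_fm p \<phi>) = peval (\<lambda>\<psi>. v (map_fm p \<psi>)) \<phi>"
  by (induction \<phi>) simp_all

lemma tautology_bsub: "tautology \<phi> \<Longrightarrow> tautology (bsub f s \<phi>)"
  unfolding tautology_def by (subst peval_bsub) simp

lemma tautology_rename: "tautology \<phi> \<Longrightarrow> tautology (rename f F \<phi>)"
  by (simp add: rename_eq_bsub tautology_bsub)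

lemma tautology_map_fm: "tautology \<phi> \<Longrightarrow> tautology (map_fm p \<phi>)"
  by (simp add: tautology_def peval_map_fm)

lemma list_all2_replaced_map:
  "list_all2 (\<lambda>a b. b = a \<or> a = x \<and> b = y) as bs \<Longrightarrow>
   list_all2 (\<lambda>a b. b = a \<or> a = f x \<and> b = f y) (map f as) (map f bs)"
  by (auto simp: list.rel_map elim!: list_all2_mono)

lemma replaced_rename:
  "replaced x y \<phi> \<psi> \<Longrightarrow> replaced (f x) (f y) (rename f F \<phi>) (rename f F \<psi>)"
proof (induction rule: replaced.induct)
  case (1 as bs r)
  then show ?case by (auto intro!: replaced.intros dest: list_all2_replaced_map[where f=f])
qed (auto intro!: replaced.intros)

text \<open>Renaming sends atoms to atoms and adds no predicates, so the equality axioms and the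
  freshness of \<open>P\<close> in the TC and LFP rules survive unchanged. Substitution for set
  variables loses both.\<close>

lemma provable_rename: "provable \<Lambda> ar \<phi> \<Longrightarrow> provable \<Lambda> ar (rename f F \<phi>)"
proof (induction arbitrary: f F rule: provable.induct)
  case (Taut \<phi>)
  then show ?case by (intro provable.Taut) (auto simp: tautology_rename)
next
  case (Forall_inst \<phi> t)
  then show ?case by (simp add: rename_inst provable.Forall_inst)
next
  case (Forall_vac \<phi>)
  then show ?case by (simp add: rename_lift provable.Forall_vac)
next
  case (Eq_repl \<phi> x y \<psi>)
  then show ?case by (simp add: provable.Eq_repl replaced_rename)
next
  case (MP \<phi> \<psi>)
  from provable.MP[OF MP.IH(1)[of f F, simplified] MP.IH(2)] show ?case .
next
  case (Compr \<phi>)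
  then show ?case by (simp add: rename_liftS provable.Compr)
next
  case (ForallS_inst_var \<phi> T)
  then show ?case by (simp add: rename_instS provable.ForallS_inst_var)
next
  case (ForallS_inst_pred \<phi> P)
  then show ?case by (simp add: rename_instS provable.ForallS_inst_pred)
next
  case (ForallS_vac \<phi>)
  then show ?case by (simp add: rename_liftS provable.ForallS_vac)
next
  case (TC_ax \<phi> \<psi> u v)
  then show ?case by (simp add: rename_tc_ind provable.TC_ax)
next
  case (TC_rule \<phi> P \<xi> u v)
  have "provable \<Lambda> ar (Imp (rename f F \<xi>)
     (tc_ind (rename (up (up f)) F \<phi>) (f u) (f v) (Rel P [0])))"
    using TC_rule.IH[of f F] by (simp add: rename_tc_ind)
  from provable.TC_rule[OF _ _ _ _ _ this] TC_rule.hyps show ?case by simp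
next
  case (LFP_ax \<phi> \<psi> y)
  then show ?case by (simp add: rename_lfp_ind provable.LFP_ax)
next
  case (LFP_rule \<phi> P \<xi> y)
  have "provable \<Lambda> ar (Imp (rename f F \<xi>)
     (lfp_ind (rename (up f) (up F) \<phi>) (f y) (Rel P [0])))"
    using LFP_rule.IH[of f F] by (simp add: rename_lfp_ind)
  from provable.LFP_rule[OF _ _ _ _ _ _ this] LFP_rule.hyps show ?case by simp
qed (simp_all add: provable.Forall_Imp provable.Eq_refl provable.Gen provable.ForallS_Imp provable.GenS)

section \<open>Permuting predicates\<close>

lemma map_fm_rename: "map_fm p (rename f F \<phi>) = rename f F (map_fm p \<phi>)"
  by (induction \<phi> arbitrary: f F) auto

lemma map_fm_weaken:
  "map_fm p (inst \<phi> t) = inst (map_fm p \<phi>) t"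
  "map_fm p (lift \<phi>) = lift (map_fm p \<phi>)"
  "map_fm p (liftS \<phi>) = liftS (map_fm p \<phi>)"
  "map_fm p (lift1 \<phi>) = lift1 (map_fm p \<phi>)"
  by (simp_all add: inst_def lift_def liftS_def lift1_def map_fm_rename)

lemma map_fm_bsub: "map_fm p (bsub f s \<phi>) = bsub f (map_fm p \<circ> s) (map_fm p \<phi>)"
proof (induction \<phi> arbitrary: f s)
  case (Mem X x) then show ?case by (simp add: map_fm_weaken)
next
  case (Forall \<phi>)
  have "map_fm p \<circ> (lift1 \<circ> s) = lift1 \<circ> (map_fm p \<circ> s)" by (auto simp: map_fm_weaken)
  then show ?case by (simp only: fm.map bsub.simps Forall.IH)
next
  case (ForallS \<phi>)
  have "map_fm p \<circ> upS s = upS (map_fm p \<circ> s)"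
    by (auto simp: fun_eq_iff upS_def map_fm_weaken split: nat.splits)
  then show ?case by (simp only: fm.map bsub.simps ForallS.IH)
next
  case (TC \<phi> u v)
  have "map_fm p \<circ> (lift1 \<circ> lift1 \<circ> s) = lift1 \<circ> lift1 \<circ> (map_fm p \<circ> s)"
    by (auto simp: map_fm_weaken)
  then show ?case by (simp only: fm.map bsub.simps TC.IH)
next
  case (LFP \<phi> y)
  have "map_fm p \<circ> upS (lift1 \<circ> s) = upS (lift1 \<circ> (map_fm p \<circ> s))"
    by (auto simp: fun_eq_iff upS_def map_fm_weaken split: nat.splits)
  then show ?case by (simp only: fm.map bsub.simps LFP.IH)
qed auto

lemma map_fm_instS: "map_fm p (instS \<phi> \<psi>) = instS (map_fm p \<phi>) (map_fm p \<psi>)"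
proof -
  have "map_fm p \<circ> case_nat \<psi> (\<lambda>X. Mem X 0) = case_nat (map_fm p \<psi>) (\<lambda>X. Mem X 0)"
    by (auto simp: fun_eq_iff split: nat.splits)
  then show ?thesis by (simp only: instS_eq_bsub map_fm_bsub)
qed

lemma map_fm_ind:
  "map_fm p (tc_ind \<phi> u v \<psi>) = tc_ind (map_fm p \<phi>) u v (map_fm p \<psi>)"
  "map_fm p (lfp_ind \<phi> y \<psi>) = lfp_ind (map_fm p \<phi>) y (map_fm p \<psi>)"
  by (simp_all add: tc_ind_def lfp_ind_def map_fm_weaken map_fm_instS)

lemma pol_map_fm [simp]: "pol q X (map_fm p \<phi>) = pol q X \<phi>"
  by (induction \<phi> arbitrary: q X) auto

lemma is_formula_map_fm:
  "(\<And>r. r \<in> \<sigma> \<Longrightarrow> p r \<in> \<sigma>' \<and> ar' (p r) = ar r) \<Longrightarrow> is_formula \<Lambda> ar \<sigma> \<phi> \<Longrightarrow>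
   is_formula \<Lambda> ar' \<sigma>' (map_fm p \<phi>)"
  by (induction \<phi>) auto

lemma preds_map_fm [simp]: "preds (map_fm p \<phi>) = p ` preds \<phi>"
  by (simp add: fm.set_map)

lemma replaced_map_fm:
  "replaced x y \<phi> \<psi> \<Longrightarrow> replaced x y (map_fm p \<phi>) (map_fm p \<psi>)"
  by (induction rule: replaced.induct) (auto intro: replaced.intros)

text \<open>Injectivity keeps the fresh predicate of a TC or LFP rule fresh. The later use is a
  transposition that exchanges such a predicate for another one.\<close>

lemma provable_map_fm:
  assumes "inj p" and arp: "\<And>r. ar (p r) = ar r"
  shows "provable \<Lambda> ar \<phi> \<Longrightarrow> provable \<Lambda> ar (map_fm p \<phi>)"
proof -
  have wf: "is_formula \<Lambda> ar UNIV (map_fm p \<chi>)" if "is_formula \<Lambda> ar UNIV \<chi>" for \<chi> and \<Lambda>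
    using is_formula_map_fm[of UNIV p UNIV ar ar, OF _ that] arp by simp
  show "provable \<Lambda> ar \<phi> \<Longrightarrow> provable \<Lambda> ar (map_fm p \<phi>)"
  proof (induction rule: provable.induct)
    case (Taut \<phi>)
    then show ?case by (intro provable.Taut tautology_map_fm wf)
  next
    case (MP \<phi> \<psi>)
    from provable.MP[OF MP.IH(1)[simplified] MP.IH(2)] show ?case .
  next
    case (TC_rule \<phi> P \<xi> u v)
    have "provable \<Lambda> ar (Imp (map_fm p \<xi>) (tc_ind (map_fm p \<phi>) u v (Rel (p P) [0])))"
      using TC_rule.IH by (simp add: map_fm_ind)
    from provable.TC_rule[OF _ _ _ _ _ this] TC_rule.hyps assms show ?case
      by (simp add: inj_image_mem_iff wf)
  next
    case (LFP_rule \<phi> P \<xi> y)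
    have "provable \<Lambda> ar (Imp (map_fm p \<xi>) (lfp_ind (map_fm p \<phi>) y (Rel (p P) [0])))"
      using LFP_rule.IH by (simp add: map_fm_ind)
    from provable.LFP_rule[OF _ _ _ _ _ _ this] LFP_rule.hyps assms show ?case
      by (simp add: inj_image_mem_iff wf)
  qed (simp_all add: map_fm_weaken map_fm_instS map_fm_ind arp wf replaced_map_fm
      provable.Forall_inst provable.Forall_Imp provable.Forall_vac provable.Eq_refl provable.Eq_repl
      provable.Gen provable.Compr provable.ForallS_inst_var provable.ForallS_inst_pred
      provable.ForallS_Imp provable.ForallS_vac provable.GenS provable.TC_ax provable.LFP_ax)
qed

section \<open>Replacement of equals\<close>

lemma provable_Eq_sym: "provable \<Lambda> ar (Imp (Eq x y) (Eq y x))"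
proof -
  have "provable \<Lambda> ar (Imp (Eq x y) (Imp (Eq x x) (Eq y x)))"
    by (rule Eq_repl) (auto intro: replaced.intros)
  from prov2[OF this Eq_refl[of _ _ x]] show ?thesis by simp
qed

text \<open>The axiom only replaces \<open>x\<close> by \<open>y\<close>, whereas \<open>f\<close>
  and \<open>f'\<close> may differ in both directions at once. Both atoms are compared with the
  common form in which every \<open>x\<close> has become \<open>y\<close>.\<close>

lemma provable_Eq_atomic:
  assumes "is_formula \<Lambda> ar UNIV \<phi>" "\<And>n. f' n = f n \<or> {f n, f' n} \<subseteq> {x, y}"
    and atom: "(\<exists>r xs. \<phi> = Rel r xs) \<or> (\<exists>a b. \<phi> = Eq a b) \<or> (\<exists>X a. \<phi> = Mem X a)"
  shows "provable \<Lambda> ar (Imp (Eq x y) (Imp (rename f F \<phi>) (rename f' F \<phi>)))"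
proof -
  define r where "r = (\<lambda>z. if z = x then y else z)"
  have eq: "r \<circ> f = r \<circ> f'"
    using assms(2) by (fastforce simp: fun_eq_iff r_def)
  have 1: "provable \<Lambda> ar (Imp (Eq x y) (Imp (rename f F \<phi>) (rename (r \<circ> f) F \<phi>)))"
    using assms(1) atom
    by (intro Eq_repl) (auto simp: r_def list_all2_map1 list_all2_map2 list_all2_same intro!: replaced.intros)
  have 2: "provable \<Lambda> ar (Imp (Eq y x) (Imp (rename (r \<circ> f') F \<phi>) (rename f' F \<phi>)))"
    using assms(1) atom
    by (intro Eq_repl) (auto simp: r_def list_all2_map1 list_all2_map2 list_all2_same intro!: replaced.intros)
  show ?thesis
    by (rule prov3[OF 1 2[folded eq] provable_Eq_sym[of _ _ x y]]) (use assms in auto)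
qed

text \<open>Justifies recursion on size in the replacement of equals: its LFP case meets the body
  with \<open>P\<close> in place of the set variable, which is not a subformula.\<close>

lemma size_instS_Rel: "size (instS \<phi> (Rel P [0])) = size \<phi>"
proof -
  have "(\<And>X. (\<exists>Y. s X = Mem Y 0) \<or> s X = Rel P [0]) \<Longrightarrow> size (bsub f s \<phi>) = size \<phi>" for f s
  proof (induction \<phi> arbitrary: f s)
    case (Mem X x)
    from Mem[of X] show ?case by auto
  next
    case (Forall \<phi>)
    have "(\<exists>Y. (lift1 \<circ> s) X = Mem Y 0) \<or> (lift1 \<circ> s) X = Rel P [0]" for X
      using Forall.prems[of X] by auto
    then show ?case by (simp only: bsub.simps fm.size Forall.IH)
  next
    case (ForallS \<phi>)
    have "(\<exists>Y. (upS s) X = Mem Y 0) \<or> (upS s) X = Rel P [0]" for X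
      using ForallS.prems[of "X - 1"] by (cases X) (auto simp: upS_def liftS_def)
    then show ?case by (simp only: bsub.simps fm.size ForallS.IH)
  next
    case (TC \<phi> u v)
    have "(\<exists>Y. (lift1 \<circ> lift1 \<circ> s) X = Mem Y 0) \<or> (lift1 \<circ> lift1 \<circ> s) X = Rel P [0]" for X
      using TC.prems[of X] by auto
    then show ?case by (simp only: bsub.simps fm.size TC.IH)
  next
    case (LFP \<phi> y)
    have "(\<exists>Y. (upS (lift1 \<circ> s)) X = Mem Y 0) \<or> (upS (lift1 \<circ> s)) X = Rel P [0]" for X
      using LFP.prems[of "X - 1"] by (cases X) (auto simp: upS_def liftS_def)
    then show ?case by (simp only: bsub.simps fm.size LFP.IH)
  qed auto
  then show ?thesis unfolding instS_eq_bsub by (auto split: nat.splits)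
qed

text \<open>The condition on \<open>f\<close> and \<open>f'\<close> is symmetric and stable under
  \<open>up\<close>, so the induction can reverse direction in antecedents and pass below binders.
  For TC and LFP the rule reduces the claim to the induction principle for a fresh
  \<open>P\<close>.\<close>

lemma provable_Leibniz:
  assumes inf: "infinite {P. ar P = 1}"
    and "is_formula \<Lambda> ar UNIV \<phi>" "\<And>n. f' n = f n \<or> {f n, f' n} \<subseteq> {x, y}"
  shows "provable \<Lambda> ar (Imp (Eq x y) (Imp (rename f F \<phi>) (rename f' F \<phi>)))"
  using assms(2-)
proof (induction \<phi> arbitrary: f f' F x y rule: measure_induct_rule[of size])
  case (less \<phi>)
  have up: "up f' n = up f n \<or> {up f n, up f' n} \<subseteq> {Suc x, Suc y}" 
    if "\<And>n. f' n = f n \<or> {f n, f' n} \<subseteq> {x, y}" for f f' x y n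
    using that[of "n - 1"] by (cases n) auto
  have liftEq: "lift (Eq x y) = Eq (Suc x) (Suc y)" by (simp add: lift_def)
  show ?case
  proof (cases \<phi>)
    case Bot
    then show ?thesis by (intro Taut) (auto simp: tautology_def)
  next
    case (Imp \<phi>1 \<phi>2)
    have sw: "f n = f' n \<or> {f' n, f n} \<subseteq> {x, y}" for n using less.prems(2)[of n] by auto
    have 1: "provable \<Lambda> ar (Imp (Eq x y) (Imp (rename f' F \<phi>1) (rename f F \<phi>1)))"
      by (rule less.IH[OF _ _ sw]) (use less.prems(1) in \<open>simp_all add: Imp\<close>)
    have 2: "provable \<Lambda> ar (Imp (Eq x y) (Imp (rename f F \<phi>2) (rename f' F \<phi>2)))"
      by (rule less.IH[OF _ _ less.prems(2)]) (use less.prems(1) in \<open>simp_all add: Imp\<close>)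
    show ?thesis by (rule prov2[OF 1 2]) (use less.prems in \<open>auto simp: Imp\<close>)
  next
    case (Forall \<phi>1)
    show ?thesis unfolding Forall rename.simps
      by (rule provable_Forall_mono, unfold liftEq, rule less.IH[OF _ _ up[OF less.prems(2)]];
          use Forall less.prems(1) in simp)
  next
    case (ForallS \<phi>1)
    have "provable \<Lambda> ar (Imp (Eq x y) (Imp (rename f (up F) \<phi>1) (rename f' (up F) \<phi>1)))"
      by (rule less.IH[OF _ _ less.prems(2)]; use ForallS less.prems(1) in auto)
    moreover have "\<Lambda> = MSO" using ForallS less.prems by simp
    ultimately show ?thesis unfolding ForallS by (simp add: provable_ForallS_mono liftS_def)
  next
    case (TC \<phi>1 u v)
    obtain P where P: "ar P = 1" "P \<notin> preds \<phi>1"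
      using fresh_pred[OF inf finite_preds] .
    have L: "\<Lambda> = FO_TC1" "is_formula \<Lambda> ar UNIV \<phi>1" using less.prems by (auto simp: TC)
    let ?r = "\<lambda>f. rename (up (up f)) F \<phi>1"
    let ?b = "\<lambda>f. Imp (And (Rel P [1]) (?r f)) (Rel P [0])"
    have "provable \<Lambda> ar (Imp (Eq (Suc (Suc x)) (Suc (Suc y))) (Imp (?r f) (?r f')))"
      by (rule less.IH[OF _ _ up[OF up[OF less.prems(2)]]]; use TC L in simp)
    \<comment> \<open>The body stands in an antecedent, so closure of \<open>P\<close> under the
      \<open>f'\<close> version gives closure under the \<open>f\<close> version, and to that one
      \<open>TC_ax\<close> applies.\<close>
    then have "provable \<Lambda> ar (Imp (Eq (Suc (Suc x)) (Suc (Suc y))) (Imp (?b f') (?b f)))"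
      by (rule prov1) (use L P in auto)
    then have cl: "provable \<Lambda> ar (Imp (Eq x y)
       (Imp (Forall (Forall (?b f'))) (Forall (Forall (?b f)))))"
      by (auto intro!: provable_Forall_mono simp: lift_def)
    have ax: "provable \<Lambda> ar (Imp (TC (?r f) (f u) (f v)) (tc_ind (?r f) (f u) (f v) (Rel P [0])))"
      by (rule TC_ax) (use L P in auto)
    have eu: "provable \<Lambda> ar (Imp (Eq x y) (Imp (Rel P [f' u]) (Rel P [f u])))"
      using provable_Eq_atomic[of \<Lambda> ar "Rel P [u]" f f' x y] less.prems P by force
    have ev: "provable \<Lambda> ar (Imp (Eq x y) (Imp (Rel P [f v]) (Rel P [f' v])))"
      using provable_Eq_atomic[of \<Lambda> ar "Rel P [v]" f' f x y] less.prems P by force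
    have "provable \<Lambda> ar (Imp (Eq x y) (And (Imp (Rel P [f' u]) (Rel P [f u])) (Imp (Rel P [f v]) (Rel P [f' v]))))"
      by (rule prov2[OF eu ev]) (use L P in auto)
    from prov3[OF this cl ax]
    have "provable \<Lambda> ar (Imp (And (Eq x y) (TC (?r f) (f u) (f v)))
        (tc_ind (?r f') (f' u) (f' v) (Rel P [0])))"
      unfolding tc_ind_Rel using L P by auto
    from TC_rule[OF L(1) _ P(1) _ _ this]
    have "provable \<Lambda> ar (Imp (And (Eq x y) (TC (?r f) (f u) (f v))) (TC (?r f') (f' u) (f' v)))"
      using L P by auto
    then show ?thesis unfolding TC rename.simps
      by (rule prov1) (use L in auto)
  next
    case (LFP \<phi>1 z)
    obtain P where P: "ar P = 1" "P \<notin> preds \<phi>1"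
      using fresh_pred[OF inf finite_preds] .
    have L: "\<Lambda> = FO_LFP1" "is_formula \<Lambda> ar UNIV \<phi>1" "positive_in 0 \<phi>1"
      using less.prems by (auto simp: LFP)
    let ?r = "\<lambda>f. rename (up f) (up F) \<phi>1"
    let ?i = "\<lambda>f. rename (up f) F (instS \<phi>1 (Rel P [0]))"
    let ?b = "\<lambda>f. Imp (?i f) (Rel P [0])"
    have fi: "is_formula \<Lambda> ar UNIV (instS \<phi>1 (Rel P [0]))"
      using L P by (auto intro!: is_formula_instS)
    have ind: "lfp_ind (?r f) y (Rel P [0]) = Imp (Forall (?b f)) (Rel P [y])" for f y
      by (simp add: lfp_ind_def rename_instS)
    have "provable \<Lambda> ar (Imp (Eq (Suc x) (Suc y)) (Imp (?i f) (?i f')))"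
      by (rule less.IH[OF _ _ up[OF less.prems(2)]]; use LFP fi in \<open>simp add: size_instS_Rel\<close>)
    then have "provable \<Lambda> ar (Imp (Eq (Suc x) (Suc y)) (Imp (?b f') (?b f)))"
      by (rule prov1) (use L P fi in auto)
    then have cl: "provable \<Lambda> ar (Imp (Eq x y) (Imp (Forall (?b f')) (Forall (?b f))))"
      by (auto intro!: provable_Forall_mono simp: lift_def)
    have ax: "provable \<Lambda> ar (Imp (LFP (?r f) (f z)) (lfp_ind (?r f) (f z) (Rel P [0])))"
      by (rule LFP_ax) (use L P in auto)
    have ev: "provable \<Lambda> ar (Imp (Eq x y) (Imp (Rel P [f z]) (Rel P [f' z])))"
      using provable_Eq_atomic[of \<Lambda> ar "Rel P [z]" f' f x y] less.prems P by force
    from prov3[OF cl ev ax]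
    have "provable \<Lambda> ar (Imp (And (Eq x y) (LFP (?r f) (f z)))
        (lfp_ind (?r f') (f' z) (Rel P [0])))"
      unfolding ind using L P fi by auto
    from LFP_rule[OF L(1) _ _ P(1) _ _ this]
    have "provable \<Lambda> ar (Imp (And (Eq x y) (LFP (?r f) (f z))) (LFP (?r f') (f' z)))"
      using L P by auto
    then show ?thesis unfolding LFP rename.simps
      by (rule prov1) (use L in auto)
  qed (use provable_Eq_atomic[OF less.prems] in auto)
qed

section \<open>Set substitution in derivations of fixed point logic\<close>

text \<open>Equality axioms for \<open>Mem\<close> turn into replacement of equals in the
  substituted formula. In the LFP rule, \<open>P\<close> may occur in the substituted formulas; as
  these use finitely many predicates, another one is left to swap it with.\<close>

lemma provable_bsub_LFP:
  assumes inf: "infinite {P. ar P = 1}"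
  shows "provable FO_LFP1 ar \<phi> \<Longrightarrow> (\<And>X. is_formula FO_LFP1 ar UNIV (s X)) \<Longrightarrow>
    finite (\<Union>X. preds (s X)) \<Longrightarrow> provable FO_LFP1 ar (bsub f s \<phi>)"
proof (induction arbitrary: f s rule: provable.induct)
  case (Taut \<phi>)
  then show ?case by (intro provable.Taut) (auto simp: tautology_bsub is_formula_bsub)
next
  case (Forall_inst \<phi> t)
  then show ?case by (simp add: bsub_inst provable.Forall_inst is_formula_bsub)
next
  case (Forall_Imp \<phi> \<psi>)
  then show ?case by (simp add: provable.Forall_Imp is_formula_bsub)
next
  case (Forall_vac \<phi>)
  then show ?case by (simp add: bsub_lift provable.Forall_vac is_formula_bsub)
next
  case (Eq_repl \<phi> x y \<psi>)
  from Eq_repl(2) show ?case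
  proof cases
    case (1 as bs r)
    then show ?thesis using Eq_repl(1)
      by (auto intro!: provable.Eq_repl replaced.intros list_all2_replaced_map)
  next
    case (2 a1 a2 b1 b2)
    then show ?thesis by (auto intro!: provable.Eq_repl replaced.intros)
  next
    case (3 b a X)
    have "provable FO_LFP1 ar (Imp (Eq (f x) (f y)) (Imp (inst (s X) (f x)) (inst (s X) (f y))))"
      unfolding inst_def by (rule provable_Leibniz[OF inf]) (auto simp: Eq_repl split: nat.splits)
    moreover have "provable FO_LFP1 ar (Imp (Eq (f x) (f y)) (Imp (inst (s X) (f a)) (inst (s X) (f a))))"
      using Eq_repl by (auto intro!: provable.Taut simp: tautology_def)
    ultimately show ?thesis using 3 by auto
  qed
next
  case (MP \<phi> \<psi>)
  from provable.MP[OF MP.IH(1)[of s f, simplified] MP.IH(2)] MP.prems show ?case by simp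
next
  case (Gen \<phi>)
  then show ?case by (auto intro!: provable.Gen Gen.IH)
next
  case (LFP_ax \<phi> \<psi> y)
  then show ?case
    by (auto simp: bsub_lfp_ind pol_bsub_upS intro!: provable.LFP_ax is_formula_bsub is_formula_upS)
next
  case (LFP_rule \<phi> P \<xi> y)
  have "finite (preds \<xi> \<union> preds \<phi> \<union> {P} \<union> (\<Union>X. preds (s X)))" using LFP_rule.prems by simp
  then obtain Q where Q: "ar Q = 1" "Q \<notin> preds \<xi> \<union> preds \<phi> \<union> {P} \<union> (\<Union>X. preds (s X))"
    using fresh_pred[OF inf] by metis
  \<comment> \<open>\<open>p\<close> swaps \<open>P\<close> and \<open>Q\<close>. The rule is
    applied under the swapped substitution \<open>s'\<close>, which is free of \<open>P\<close>.
    Swapping back restores \<open>s\<close> and fixes the conclusion of the rule, which contains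
    neither predicate.\<close>
  define p where "p = id(P := Q, Q := P)"
  have pp: "p \<circ> p = id" and inj: "inj p" and arp: "ar (p r) = ar r" for r
    using Q(1) LFP_rule.hyps by (auto simp: p_def fun_eq_iff inj_def)
  define s' where "s' = map_fm p \<circ> s"
  have s's: "map_fm p \<circ> s' = s" by (simp add: s'_def fun_eq_iff fm.map_comp pp fm.map_id)
  have fs': "is_formula FO_LFP1 ar UNIV (s' X)" for X
    using LFP_rule.prems(1) by (auto simp: s'_def arp intro!: is_formula_map_fm[of UNIV])
  have "(\<Union>X. preds (s' X)) = p ` (\<Union>X. preds (s X))" by (auto simp: s'_def)
  then have fin: "finite (\<Union>X. preds (s' X))" using LFP_rule.prems by simp
  have Ps': "P \<notin> preds (s' X)" for X using Q(2) by (auto simp: s'_def p_def split: if_splits)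
  have nochange: "map_fm p \<chi> = \<chi>" if "P \<notin> preds \<chi>" "Q \<notin> preds \<chi>" for \<chi>
    using that by (intro fm.map_ident_strong) (auto simp: p_def)
  let ?\<phi> = "bsub (up f) (upS (lift1 \<circ> s')) \<phi>"
  have fr: "P \<notin> preds (bsub f s' \<xi>)" "P \<notin> preds ?\<phi>"
  proof -
    show "P \<notin> preds (bsub f s' \<xi>)" using preds_bsub[of f s' \<xi>] Ps' LFP_rule.hyps by auto
    have "P \<notin> preds (upS (lift1 \<circ> s') X)" for X
      using Ps' by (auto simp: upS_def split: nat.splits)
    then show "P \<notin> preds ?\<phi>"
      using preds_bsub[of "up f" "upS (lift1 \<circ> s')" \<phi>] LFP_rule.hyps by auto
  qed
  have f\<phi>: "is_formula FO_LFP1 ar UNIV ?\<phi>" "positive_in 0 ?\<phi>"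
    using LFP_rule.hyps fs' by (auto intro!: is_formula_bsub pol_bsub_upS is_formula_upS)
  have "provable FO_LFP1 ar (Imp (bsub f s' \<xi>) (lfp_ind ?\<phi> (f y) (Rel P [0])))"
    using LFP_rule.IH[OF fs' fin, of f] by (simp add: bsub_lfp_ind)
  from provable.LFP_rule[OF _ f\<phi> LFP_rule.hyps(4) fr this]
  have "provable FO_LFP1 ar (bsub f s' (Imp \<xi> (LFP \<phi> y)))" by simp
  from provable_map_fm[OF inj arp this]
  have "provable FO_LFP1 ar (bsub f s (map_fm p (Imp \<xi> (LFP \<phi> y))))" by (simp only: map_fm_bsub s's)
  moreover have "map_fm p (Imp \<xi> (LFP \<phi> y)) = Imp \<xi> (LFP \<phi> y)"
    using LFP_rule.hyps Q(2) by (intro nochange) auto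
  ultimately show ?case by simp
qed (auto intro: provable.Eq_refl)

section \<open>Witnesses\<close>

text \<open>If \<theta> fails, the hypothesis makes \<phi> true of the eigenvariable and
  \<open>Forall \<phi>\<close> false; generalizing over the eigenvariable is then
  contradictory.\<close>

lemma Forall_witness:
  assumes "provable \<Lambda> ar (Imp (Imp \<phi> (lift (Forall \<phi>))) (lift \<theta>))"
  shows "provable \<Lambda> ar \<theta>"
proof -
  have f: "is_formula \<Lambda> ar UNIV \<phi>" "is_formula \<Lambda> ar UNIV \<theta>"
    using provable_is_formula[OF assms] by auto
  \<comment> \<open>\<open>Top\<close> fills the antecedent expected by
    \<open>provable_Forall_mono\<close>, which thereby acts as generalization under the assumption
    \<open>Neg \<theta>\<close>.\<close>
  have "provable \<Lambda> ar (Imp (lift (Neg \<theta>)) (Imp Top \<phi>))"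
    by (rule prov1[OF assms]) (use f in \<open>auto simp: lift_def\<close>)
  from provable_Forall_mono[OF this] have 1: "provable \<Lambda> ar (Imp (Neg \<theta>) (Imp (Forall Top) (Forall \<phi>)))" .
  have 2: "provable \<Lambda> ar (Forall Top)" by (intro Gen Taut) (auto simp: tautology_def)
  have "provable \<Lambda> ar (lift (Imp (Forall \<phi>) \<theta>))"
    by (rule prov1[OF assms]) (use f in \<open>auto simp: lift_def\<close>)
  from MP[OF Forall_inst Gen[OF this], of 0] have 3: "provable \<Lambda> ar (Imp (Forall \<phi>) \<theta>)"
    using f by simp
  show ?thesis by (rule prov3[OF 1 2 3]) (use f in auto)
qed

lemma ForallS_witness:
  assumes "\<Lambda> = MSO" "provable \<Lambda> ar (Imp (Imp \<phi> (liftS (ForallS \<phi>))) (liftS \<theta>))"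
  shows "provable \<Lambda> ar \<theta>"
proof -
  have f: "is_formula \<Lambda> ar UNIV \<phi>" "is_formula \<Lambda> ar UNIV \<theta>"
    using provable_is_formula[OF assms(2)] by auto
  have "provable \<Lambda> ar (Imp (liftS (Neg \<theta>)) (Imp Top \<phi>))"
    by (rule prov1[OF assms(2)]) (use f in \<open>auto simp: liftS_def\<close>)
  from provable_ForallS_mono[OF assms(1) this]
  have 1: "provable \<Lambda> ar (Imp (Neg \<theta>) (Imp (ForallS Top) (ForallS \<phi>)))" .
  have 2: "provable \<Lambda> ar (ForallS Top)"
    by (intro GenS assms(1) Taut) (auto simp: tautology_def)
  have "provable \<Lambda> ar (liftS (Imp (ForallS \<phi>) \<theta>))"
    by (rule prov1[OF assms(2)]) (use f assms(1) in \<open>auto simp: liftS_def\<close>)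
  from MP[OF ForallS_inst_var GenS[OF assms(1) this], of 0]
  have 3: "provable \<Lambda> ar (Imp (ForallS \<phi>) \<theta>)"
    using f assms(1) by simp
  show ?thesis by (rule prov3[OF 1 2 3]) (use f in auto)
qed

lemma bsub_liftS_case_nat:
  "bsub (\<lambda>x. x) (case_nat \<psi> (\<lambda>X. Mem X 0)) (liftS \<phi>) = \<phi>"
  by (simp add: liftS_def bsub_rename)

text \<open>Sets cannot be generalized here. Instead \<psi> itself is substituted for the set
  variable, and the comprehension clause becomes the provable
  \<open>Forall (Iff \<psi> \<psi>)\<close>.\<close>

lemma Compr_witness_LFP:
  assumes inf: "infinite {P. ar P = 1}"
    and p: "provable FO_LFP1 ar (Imp (Forall (Iff (Mem 0 0) (liftS \<psi>))) (liftS \<theta>))"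
  shows "provable FO_LFP1 ar \<theta>"
proof -
  have f: "is_formula FO_LFP1 ar UNIV \<psi>" "is_formula FO_LFP1 ar UNIV \<theta>"
    using provable_is_formula[OF p] by auto
  let ?s = "case_nat \<psi> (\<lambda>X. Mem X 0)"
  have "(\<Union>X. preds (?s X)) \<subseteq> preds \<psi>" by (auto split: nat.splits)
  then have "finite (\<Union>X. preds (?s X))" by (rule finite_subset) simp
  moreover have "is_formula FO_LFP1 ar UNIV (?s X)" for X using f by (auto split: nat.splits)
  ultimately have 1: "provable FO_LFP1 ar (Imp (Forall (Iff \<psi> \<psi>)) \<theta>)"
    using provable_bsub_LFP[OF inf p, of ?s "\<lambda>x. x"] by (simp add: bsub_liftS_case_nat)
  have "provable FO_LFP1 ar (Forall (Iff \<psi> \<psi>))"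
    using f by (intro Gen Taut) (auto simp: tautology_def)
  from MP[OF 1 this] show ?thesis .
qed

text \<open>A fresh predicate \<open>P\<close> substituted for the set variable makes up for the
  missing set quantifier. Under \<open>Neg \<theta>\<close> the hypothesis yields the induction
  principle for \<open>P\<close> and refutes the fixed point, while \<open>LFP_rule\<close> derives
  the fixed point from that principle.\<close>

lemma LFP_witness:
  assumes inf: "infinite {P. ar P = 1}"
    and p: "provable FO_LFP1 ar (Imp (Imp (lfp_ind (rename (\<lambda>x. x) (up Suc) \<phi>) y (Mem 0 0))
              (liftS (LFP \<phi> y))) (liftS \<theta>))"
  shows "provable FO_LFP1 ar \<theta>"
proof -
  have f: "is_formula FO_LFP1 ar UNIV (LFP \<phi> y)" "is_formula FO_LFP1 ar UNIV \<theta>"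
    using provable_is_formula[OF p] by auto
  have "finite (preds \<phi> \<union> preds \<theta>)" by simp
  then obtain P where P: "ar P = 1" "P \<notin> preds \<phi> \<union> preds \<theta>" using fresh_pred[OF inf] by metis
  let ?s = "case_nat (Rel P [0]) (\<lambda>X. Mem X 0)"
  have "(\<Union>X. preds (?s X)) \<subseteq> {P}" by (auto split: nat.splits)
  then have fin: "finite (\<Union>X. preds (?s X))" by (rule finite_subset) simp
  have fs: "is_formula FO_LFP1 ar UNIV (?s X)" for X using P by (auto split: nat.splits)
  have "provable FO_LFP1 ar (Imp (Imp (lfp_ind \<phi> y (Rel P [0])) (LFP \<phi> y)) \<theta>)"
    using provable_bsub_LFP[OF inf p fs fin, of "\<lambda>x. x"]
    by (simp add: bsub_liftS_case_nat bsub_lfp_ind bsub_rename upS_o_up)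
  note 1 = this
  have "provable FO_LFP1 ar (Imp (Neg \<theta>) (lfp_ind \<phi> y (Rel P [0])))"
    by (rule prov1[OF 1]) (use f provable_is_formula[OF 1] in auto)
  from LFP_rule[OF _ _ _ P(1) _ _ this] P f
  have 2: "provable FO_LFP1 ar (Imp (Neg \<theta>) (LFP \<phi> y))" by simp
  show ?thesis by (rule prov2[OF 1 2]) (use f in auto)
qed

section \<open>Transitive closures are reflexive and closed under steps\<close>

lemma provable_TC_refl:
  assumes inf: "infinite {P. ar P = 1}" and f: "is_formula FO_TC1 ar UNIV \<phi>"
  shows "provable FO_TC1 ar (TC \<phi> u u)"
proof -
  obtain P where P: "ar P = 1" "P \<notin> preds \<phi>"
    using fresh_pred[OF inf finite_preds] .
  \<comment> \<open>Induction from \<open>u\<close> to \<open>u\<close> leads from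
    \<open>P(u)\<close> to \<open>P(u)\<close>, whatever the closure condition says.\<close>
  have "provable FO_TC1 ar (Imp Top (tc_ind \<phi> u u (Rel P [0])))"
    unfolding tc_ind_Rel using f P by (intro Taut) (auto simp: tautology_def)
  from TC_rule[OF _ _ P(1) _ _ this] P f have "provable FO_TC1 ar (Imp Top (TC \<phi> u u))" by simp
  then show ?thesis by (rule prov1) (use f in auto)
qed

lemma provable_TC_step:
  assumes inf: "infinite {P. ar P = 1}" and f: "is_formula FO_TC1 ar UNIV \<phi>"
  shows "provable FO_TC1 ar (Imp (TC \<phi> u x)
     (Imp (rename (case_nat y (case_nat x (\<lambda>n. n))) (\<lambda>X. X) \<phi>) (TC \<phi> u y)))"
proof -
  obtain P where P: "ar P = 1" "P \<notin> preds \<phi>"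
    using fresh_pred[OF inf finite_preds] .
  let ?\<phi> = "rename (case_nat y (case_nat x (\<lambda>n. n))) (\<lambda>X. X) \<phi>"
  let ?b = "Imp (And (Rel P [1]) \<phi>) (Rel P [0])"
  have 1: "provable FO_TC1 ar (Imp (TC \<phi> u x) (tc_ind \<phi> u x (Rel P [0])))"
    by (rule TC_ax) (use f P in auto)
  have 2: "provable FO_TC1 ar (Imp (Forall (Forall ?b)) (inst (Forall ?b) x))"
    by (rule Forall_inst) (use f P in auto)
  have "provable FO_TC1 ar (Imp (inst (Forall ?b) x) 
     (inst (rename (up (case_nat x (\<lambda>n. n))) (\<lambda>X. X) ?b) y))"
    unfolding inst_def[of "Forall ?b"] rename.simps(6) by (rule Forall_inst) (use f P in auto)
  then have 3: "provable FO_TC1 ar (Imp (inst (Forall ?b) x) (Imp (And (Rel P [x]) ?\<phi>) (Rel P [y])))"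
    by (simp add: inst_def)
  have "provable FO_TC1 ar (Imp (And (TC \<phi> u x) ?\<phi>) (tc_ind \<phi> u y (Rel P [0])))"
    by (rule prov3[OF 1 2 3]) (use f P in \<open>auto simp: tc_ind_Rel\<close>)
  from TC_rule[OF _ _ P(1) _ _ this] P f
  have "provable FO_TC1 ar (Imp (And (TC \<phi> u x) ?\<phi>) (TC \<phi> u y))" by simp
  then show ?thesis by (rule prov1) (use f in auto)
qed

section \<open>Semantics of substitution\<close>

lemma sat_rename: "sat M e E (rename f F \<phi>) = sat M (e \<circ> f) (E \<circ> F) \<phi>"
  by (induction \<phi> arbitrary: e E f F) simp_all

lemma sat_weaken [simp]:
  "sat M e E (inst \<phi> t) = sat M (case_nat (e t) e) E \<phi>"
  "sat M (case_nat a e) E (lift \<phi>) = sat M e E \<phi>"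
  "sat M e (case_nat A E) (liftS \<phi>) = sat M e E \<phi>"
  "sat M (case_nat a (case_nat b e)) E (lift1 \<phi>) = sat M (case_nat a e) E \<phi>"
  by (simp_all add: inst_def lift_def liftS_def lift1_def sat_rename)

definition extension :: "('r, 'u) frame \<Rightarrow> (nat \<Rightarrow> 'u) \<Rightarrow> (nat \<Rightarrow> 'u set) \<Rightarrow> 'r fm \<Rightarrow> 'u set" where
  "extension M e E \<psi> = {a \<in> dom M. sat M (case_nat a e) E \<psi>}"

lemma extension_lift1 [simp]: "extension M (case_nat b e) E (lift1 \<psi>) = extension M e E \<psi>"
  by (simp add: extension_def)

lemma extension_upS:
  "A \<subseteq> dom M \<Longrightarrow>
   (\<lambda>X. extension M e (case_nat A E) (upS s X)) = case_nat A (\<lambda>X. extension M e E (s X))"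
  by (auto simp: fun_eq_iff extension_def upS_def split: nat.splits)

text \<open>Quantified sets range over the same \<open>adm M\<close> on both sides, so the
  extensions assigned to set variables may themselves be inadmissible. That admissible sets lie in
  the domain makes \<open>Mem 0 0\<close> below a set binder denote exactly the bound set.\<close>

lemma sat_bsub:
  assumes "adm M \<subseteq> Pow (dom M)"
  shows "(\<And>n. e n \<in> dom M) \<Longrightarrow>
    sat M e E (bsub f s \<phi>) = sat M (e \<circ> f) (\<lambda>X. extension M e E (s X)) \<phi>"
proof (induction \<phi> arbitrary: e E f s)
  case (Mem X x)
  then show ?case by (simp add: extension_def)
next
  case (Forall \<phi>)
  have "sat M (case_nat a e) E (bsub (up f) (lift1 \<circ> s) \<phi>) =
      sat M (case_nat a (e \<circ> f)) (\<lambda>X. extension M e E (s X)) \<phi>" if "a \<in> dom M" for a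
    using Forall.prems that by (subst Forall.IH) (auto split: nat.splits)
  then show ?case by (simp add: comp_def)
next
  case (ForallS \<phi>)
  have "sat M e (case_nat A E) (bsub f (upS s) \<phi>) =
      sat M (e \<circ> f) (case_nat A (\<lambda>X. extension M e E (s X))) \<phi>" if "A \<in> adm M" for A
    using ForallS.prems that assms by (subst ForallS.IH) (auto simp: extension_upS cong: if_cong)
  then show ?case by (simp add: comp_def)
next
  case (TC \<phi> u v)
  have "sat M (case_nat b (case_nat a e)) E (bsub (up (up f)) (lift1 \<circ> lift1 \<circ> s) \<phi>) =
      sat M (case_nat b (case_nat a (e \<circ> f))) (\<lambda>X. extension M e E (s X)) \<phi>"
    if "a \<in> dom M" "b \<in> dom M" for a b
    using TC.prems that by (subst TC.IH) (auto split: nat.splits)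
  then show ?case by (simp add: comp_def)
next
  case (LFP \<phi> y)
  have "sat M (case_nat a e) (case_nat A E) (bsub (up f) (upS (lift1 \<circ> s)) \<phi>) =
      sat M (case_nat a (e \<circ> f)) (case_nat A (\<lambda>X. extension M e E (s X))) \<phi>"
    if "A \<in> adm M" "a \<in> dom M" for A a
    using LFP.prems that assms
    by (subst LFP.IH) (auto simp: extension_upS split: nat.splits)
  then show ?case by (simp add: comp_def)
qed simp_all

lemma sat_instS:
  assumes "adm M \<subseteq> Pow (dom M)" "\<And>n. e n \<in> dom M" "\<And>n. E n \<in> adm M"
  shows "sat M e E (instS \<phi> \<psi>) = sat M e (case_nat (extension M e E \<psi>) E) \<phi>"
proof -
  have "(\<lambda>X. extension M e E (case_nat \<psi> (\<lambda>X. Mem X 0) X)) = case_nat (extension M e E \<psi>) E"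
    using assms(1,3) by (auto simp: extension_def fun_eq_iff split: nat.splits)
  then show ?thesis unfolding instS_eq_bsub using assms by (subst sat_bsub) auto
qed

lemma sat_tc_ind:
  assumes "\<And>n. e n \<in> dom M"
  shows "sat M e E (tc_ind \<phi> u v \<psi>) \<longleftrightarrow>
     (let A = extension M e E \<psi> in e u \<in> A \<and>
        (\<forall>a\<in>dom M. \<forall>b\<in>dom M. a \<in> A \<and> sat M (case_nat b (case_nat a e)) E \<phi> \<longrightarrow> b \<in> A)
        \<longrightarrow> e v \<in> A)"
  using assms by (auto simp: tc_ind_def extension_def)

lemma sat_lfp_ind:
  assumes "adm M \<subseteq> Pow (dom M)" "\<And>n. e n \<in> dom M" "\<And>n. E n \<in> adm M"
  shows "sat M e E (lfp_ind \<phi> y \<psi>) \<longleftrightarrow>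
     (let A = extension M e E \<psi> in
        (\<forall>a\<in>dom M. sat M (case_nat a e) (case_nat A E) \<phi> \<longrightarrow> a \<in> A) \<longrightarrow> e y \<in> A)"
proof -
  have "sat M (case_nat a e) E (instS \<phi> (lift1 \<psi>)) =
      sat M (case_nat a e) (case_nat (extension M e E \<psi>) E) \<phi>" if "a \<in> dom M" for a
    using assms that by (subst sat_instS) (auto split: nat.splits)
  then show ?thesis using assms by (auto simp: lfp_ind_def extension_def)
qed

lemma peval_sat: "peval (sat M e E) \<phi> = sat M e E \<phi>"
  by (induction \<phi>) auto

lemma map_replaced:
  "list_all2 (\<lambda>a b. b = a \<or> a = x \<and> b = y) as bs \<Longrightarrow> e x = e y \<Longrightarrow> map e as = map e bs"
  by (induction rule: list_all2_induct) auto

lemma sat_replaced: "replaced x y \<phi> \<psi> \<Longrightarrow> e x = e y \<Longrightarrow> sat M e E \<phi> = sat M e E \<psi>"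
proof (induction rule: replaced.induct)
  case (1 as bs r)
  then show ?case using map_replaced[OF 1(1), of e] by simp
qed auto

section \<open>Interpreting a fresh predicate by a definable set\<close>

definition interp_upd :: "('r, 'u) frame \<Rightarrow> 'r \<Rightarrow> 'u set \<Rightarrow> ('r, 'u) frame" where
  "interp_upd M P A = M\<lparr>interp := (interp M)(P := {[a] |a. a \<in> A})\<rparr>"

lemma interp_upd_simps [simp]:
  "dom (interp_upd M P A) = dom M" "adm (interp_upd M P A) = adm M"
  "interp (interp_upd M P A) = (interp M)(P := {[a] |a. a \<in> A})"
  by (simp_all add: interp_upd_def)

lemma sat_interp_upd_fresh: "P \<notin> preds \<phi> \<Longrightarrow> sat (interp_upd M P A) e E \<phi> = sat M e E \<phi>"
  by (induction \<phi> arbitrary: e E) auto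

text \<open>Trades \<open>P\<close> for a set variable, so that the expansion by \<open>P\<close>
  can be described in the original structure. \<open>hd\<close> picks the single argument. No room
  is made for \<open>Y\<close>: an index that is not in use has to be supplied.\<close>

fun pred_to_var :: "'r \<Rightarrow> nat \<Rightarrow> 'r fm \<Rightarrow> 'r fm" where
  "pred_to_var P Y Bot = Bot"
| "pred_to_var P Y (Rel r xs) = (if r = P then Mem Y (hd xs) else Rel r xs)"
| "pred_to_var P Y (Eq x y) = Eq x y"
| "pred_to_var P Y (Mem X x) = Mem X x"
| "pred_to_var P Y (Imp \<phi> \<psi>) = Imp (pred_to_var P Y \<phi>) (pred_to_var P Y \<psi>)"
| "pred_to_var P Y (Forall \<phi>) = Forall (pred_to_var P Y \<phi>)"
| "pred_to_var P Y (ForallS \<phi>) = ForallS (pred_to_var P (Suc Y) \<phi>)"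
| "pred_to_var P Y (TC \<phi> u v) = TC (pred_to_var P Y \<phi>) u v"
| "pred_to_var P Y (LFP \<phi> y) = LFP (pred_to_var P (Suc Y) \<phi>) y"

lemma sat_pred_to_var:
  assumes "ar P = 1"
  shows "is_formula \<Lambda> ar \<sigma> \<phi> \<Longrightarrow> E Y = A \<Longrightarrow>
    sat M e E (pred_to_var P Y \<phi>) = sat (interp_upd M P A) e E \<phi>"
proof (induction \<phi> arbitrary: e E Y)
  case (Rel r xs)
  then show ?case using assms by (cases xs) auto
next
  case (ForallS \<phi>)
  then have "is_formula \<Lambda> ar \<sigma> \<phi>" by auto
  then show ?case using ForallS.IH ForallS.prems(2) by simp
next
  case (TC \<phi> u v)
  then have "is_formula \<Lambda> ar \<sigma> \<phi>" by auto
  then show ?case using TC.IH TC.prems(2) by simp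
next
  case (LFP \<phi> y)
  then have "is_formula \<Lambda> ar \<sigma> \<phi>" by auto
  then show ?case using LFP.IH LFP.prems(2) by simp
qed simp_all

lemma pol_pred_to_var: "X \<noteq> Y \<Longrightarrow> pol p X (pred_to_var P Y \<phi>) = pol p X \<phi>"
  by (induction \<phi> arbitrary: p X Y) auto

lemma is_formula_pred_to_var:
  "is_formula \<Lambda> ar \<sigma> \<phi> \<Longrightarrow> \<Lambda> \<noteq> FO_TC1 \<Longrightarrow> is_formula \<Lambda> ar \<sigma> (pred_to_var P Y \<phi>)"
  by (induction \<phi> arbitrary: Y) (cases \<Lambda>; auto simp: pol_pred_to_var)+

text \<open>The atoms \<open>Mem\<close> created by \<open>pred_to_var\<close> lie outside
  transitive closure logic; substituting formulas for them leads back into it.\<close>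

lemma is_formula_pred_to_var_TC:
  "is_formula FO_TC1 ar \<sigma> \<phi> \<Longrightarrow> (\<And>X. is_formula FO_TC1 ar \<sigma> (s X)) \<Longrightarrow>
   is_formula FO_TC1 ar \<sigma> (bsub f s (pred_to_var P Y \<phi>))"
  by (induction \<phi> arbitrary: f s Y) auto

lemma sat_TC_indep: "is_formula FO_TC1 ar \<sigma> \<phi> \<Longrightarrow> sat M e E \<phi> = sat M e E' \<phi>"
  by (induction \<phi> arbitrary: e) simp_all

lemma henkin_structureD:
  assumes "henkin_structure \<Lambda> ar \<sigma> M"
  shows "dom M \<noteq> {}" "adm M \<subseteq> Pow (dom M)"
    "assignment M e E \<Longrightarrow> is_formula \<Lambda> ar \<sigma> \<phi> \<Longrightarrow> extension M e E \<phi> \<in> adm M"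
  using assms by (auto simp: henkin_structure_def is_frame_def extension_def)

lemma interp_upd_is_frame:
  "is_frame ar \<sigma> M \<Longrightarrow> ar P = 1 \<Longrightarrow> A \<subseteq> dom M \<Longrightarrow> is_frame ar \<sigma> (interp_upd M P A)"
  by (auto simp: is_frame_def subset_iff)

text \<open>A set definable with the help of \<open>P\<close> is definable in \<open>M\<close>
  itself, by the formula with set variable 0 in place of \<open>P\<close> and with \<open>A\<close>
  assigned to that variable.\<close>

lemma henkin_interp_upd:
  assumes M: "henkin_structure \<Lambda> ar \<sigma> M" and "\<Lambda> \<noteq> FO_TC1" "ar P = 1" "A \<in> adm M"
  shows "henkin_structure \<Lambda> ar \<sigma> (interp_upd M P A)"
  unfolding henkin_structure_def
proof (intro conjI allI impI)
  show "is_frame ar \<sigma> (interp_upd M P A)"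
    using assms henkin_structureD(2)[OF M]
    by (intro interp_upd_is_frame) (auto simp: henkin_structure_def)
  fix \<phi> e E
  assume \<phi>: "is_formula \<Lambda> ar \<sigma> \<phi>" and "assignment (interp_upd M P A) e E"
  then have "assignment M e (case_nat A E)"
    using assms(4) by (auto simp: assignment_def split: nat.splits)
  moreover have "is_formula \<Lambda> ar \<sigma> (pred_to_var P 0 (liftS \<phi>))"
    using \<phi> assms(2) by (simp add: is_formula_pred_to_var)
  ultimately have "extension M e (case_nat A E) (pred_to_var P 0 (liftS \<phi>)) \<in> adm M"
    using henkin_structureD(3)[OF M] by blast
  moreover have "sat M e (case_nat A E) (pred_to_var P 0 (liftS \<phi>)) = sat (interp_upd M P A) e E \<phi>" for e
    by (subst sat_pred_to_var[of ar P \<Lambda> \<sigma> _ _ 0 A]) (use \<phi> assms(3) in auto)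
  ultimately show "{a \<in> dom (interp_upd M P A). sat (interp_upd M P A) (case_nat a e) E \<phi>}
      \<in> adm (interp_upd M P A)"
    by (simp add: extension_def)
qed

text \<open>
  Transitive closure logic has no set variables, so that the result may fail to be a Henkin structure
  if the set is admissible but not definable. The parameters of the defining formula and the other
  variables are kept apart as odd and even indices.
\<close>

lemma henkin_interp_upd_TC:
  assumes M: "henkin_structure FO_TC1 ar \<sigma> M" and P: "ar P = 1"
    and d: "is_formula FO_TC1 ar \<sigma> \<delta>" "assignment M d D"
  shows "henkin_structure FO_TC1 ar \<sigma> (interp_upd M P (extension M d D \<delta>))"
  unfolding henkin_structure_def
proof (intro conjI allI impI)
  let ?A = "extension M d D \<delta>"
  let ?N = "interp_upd M P ?A"
  show "is_frame ar \<sigma> ?N"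
    using assms by (intro interp_upd_is_frame) (auto simp: henkin_structure_def extension_def)
  fix \<phi> e E
  assume \<phi>: "is_formula FO_TC1 ar \<sigma> \<phi>" and "assignment ?N e E"
  then have e: "assignment M e E" by (simp add: assignment_def)
  define e' where "e' = (\<lambda>n. if even n then e (n div 2) else d (n div 2))"
  have e': "assignment M e' E" using e d(2) by (auto simp: assignment_def e'_def)
  define \<delta>' where "\<delta>' = rename (up (\<lambda>n. 2 * n + 1)) (\<lambda>X. X) \<delta>"
  \<comment> \<open>Formulas of this logic contain no set variables, so every \<open>Mem\<close>
    produced by \<open>pred_to_var\<close> stems from \<open>P\<close>, and all set indices can be
    sent to \<delta>'.\<close>
  define \<phi>' where "\<phi>' = bsub (up (\<lambda>n. 2 * n)) (\<lambda>X. lift1 \<delta>') (pred_to_var P 0 \<phi>)"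
  have "extension M e' E \<phi>' \<in> adm M"
    using henkin_structureD(3)[OF M e'] \<phi> d(1)
    by (auto simp: \<phi>'_def \<delta>'_def is_formula_pred_to_var_TC)
  moreover have "sat M (case_nat a e') E \<phi>' = sat ?N (case_nat a e) E \<phi>" if a: "a \<in> dom M" for a
  proof -
    have 1: "case_nat a e' \<circ> up (\<lambda>n. 2 * n) = case_nat a e"
      by (auto simp: fun_eq_iff e'_def up_def split: nat.splits)
    have "e' \<circ> (\<lambda>n. 2 * n + 1) = d"
      by (auto simp: fun_eq_iff e'_def)
    then have 2: "extension M e' E \<delta>' = ?A"
      using sat_TC_indep[OF d(1), of M _ E D] by (simp add: extension_def \<delta>'_def sat_rename)
    have "sat M (case_nat a e') E \<phi>' = sat M (case_nat a e) (\<lambda>X. ?A) (pred_to_var P 0 \<phi>)"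
      unfolding \<phi>'_def using a e' henkin_structureD(2)[OF M]
      by (subst sat_bsub) (auto simp: 1[unfolded comp_def] 2 assignment_def comp_def split: nat.splits)
    also have "\<dots> = sat ?N (case_nat a e) (\<lambda>X. ?A) \<phi>"
      by (rule sat_pred_to_var[OF P \<phi>]) simp
    also have "\<dots> = sat ?N (case_nat a e) E \<phi>" by (rule sat_TC_indep[OF \<phi>])
    finally show ?thesis .
  qed
  then have "extension M e' E \<phi>' = extension ?N e E \<phi>" by (auto simp: extension_def)
  ultimately show "{a \<in> dom ?N. sat ?N (case_nat a e) E \<phi>} \<in> adm ?N"
    by (simp add: extension_def)
qed

section \<open>Soundness\<close>

lemma extension_Rel0: "extension (interp_upd M P A) e E (Rel P [0]) = dom M \<inter> A"
  by (auto simp: extension_def)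

lemma provable_sound:
  "provable \<Lambda> ar \<phi> \<Longrightarrow> henkin_structure \<Lambda> ar UNIV M \<Longrightarrow> assignment M e E \<Longrightarrow> sat M e E \<phi>"
proof (induction arbitrary: M e E rule: provable.induct)
  case (Taut \<phi>)
  then show ?case by (metis tautology_def peval_sat)
next
  case (Forall_inst \<phi> t)
  then show ?case by (simp add: assignment_def)
next
  case (Eq_repl \<phi> x y \<psi>)
  then show ?case using sat_replaced[of x y \<phi> \<psi> e M E] by simp
next
  case (MP \<phi> \<psi>)
  then show ?case by (metis sat.simps(5))
next
  case (Gen \<phi>)
  have "assignment M (case_nat a e) E" if "a \<in> dom M" for a
    using Gen.prems that by (auto simp: assignment_def split: nat.splits)
  then show ?case using Gen by simp
next
  case (Compr \<phi>)
  have "extension M e E \<phi> \<in> adm M" using henkin_structureD(3) Compr by blast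
  then show ?case unfolding sat_ExistsS
    by (rule bexI[rotated]) (auto simp: extension_def)
next
  case (ForallS_inst_var \<phi> T)
  have "extension M e E (Mem T 0) \<in> adm M"
    using henkin_structureD(3) ForallS_inst_var by fastforce
  moreover have "adm M \<subseteq> Pow (dom M)" using henkin_structureD(2) ForallS_inst_var by blast
  ultimately show ?case using ForallS_inst_var by (simp add: sat_instS assignment_def)
next
  case (ForallS_inst_pred \<phi> P)
  have "extension M e E (Rel P [0]) \<in> adm M"
    using henkin_structureD(3) ForallS_inst_pred by fastforce
  moreover have "adm M \<subseteq> Pow (dom M)" using henkin_structureD(2) ForallS_inst_pred by blast
  ultimately show ?case using ForallS_inst_pred by (simp add: sat_instS assignment_def)
next
  case (GenS \<phi>)
  have "assignment M e (case_nat A E)" if "A \<in> adm M" for A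
    using GenS.prems that by (auto simp: assignment_def split: nat.splits)
  then show ?case using GenS by simp
next
  case (TC_ax \<phi> \<psi> u v)
  have "extension M e E \<psi> \<in> adm M" using henkin_structureD(3) TC_ax by blast
  moreover have "e n \<in> dom M" for n using TC_ax by (simp add: assignment_def)
  ultimately show ?case unfolding sat.simps(5,8) by (auto simp only: sat_tc_ind Let_def)
next
  case (TC_rule \<phi> P \<xi> u v)
  have e: "e n \<in> dom M" for n using TC_rule.prems by (simp add: assignment_def)
  show ?case unfolding sat.simps(5)
  proof (rule impI, rule ccontr)
    assume \<xi>: "sat M e E \<xi>" and "\<not> sat M e E (TC \<phi> u v)"
    define \<delta> where "\<delta> = TC (rename (up (up Suc)) (\<lambda>X. X) \<phi>) (Suc u) 0"
    let ?A = "extension M e E \<delta>"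
    have sub: "dom M \<inter> ?A = ?A" by (auto simp: extension_def)
    have mem: "b \<in> ?A \<longleftrightarrow> b \<in> dom M \<and> (\<forall>A\<in>adm M. e u \<in> A \<and>
        (\<forall>a\<in>dom M. \<forall>b\<in>dom M. a \<in> A \<and> sat M (case_nat b (case_nat a e)) E \<phi> \<longrightarrow> b \<in> A)
        \<longrightarrow> b \<in> A)" for b
      by (simp add: extension_def \<delta>_def sat_rename)
    let ?N = "interp_upd M P ?A"
    have "henkin_structure FO_TC1 ar UNIV ?N"
      using TC_rule.hyps TC_rule.prems by (intro henkin_interp_upd_TC) (auto simp: \<delta>_def)
    moreover have "assignment ?N e E" using TC_rule.prems by (simp add: assignment_def)
    ultimately have "sat ?N e E (Imp \<xi> (tc_ind \<phi> u v (Rel P [0])))"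
      using TC_rule.IH TC_rule.hyps(1) by blast
    then have "sat ?N e E (tc_ind \<phi> u v (Rel P [0]))"
      using \<xi> TC_rule.hyps by (simp add: sat_interp_upd_fresh)
    then have "e u \<in> ?A \<and> (\<forall>a\<in>dom M. \<forall>b\<in>dom M. a \<in> ?A \<and> 
         sat M (case_nat b (case_nat a e)) E \<phi> \<longrightarrow> b \<in> ?A) \<longrightarrow> e v \<in> ?A"
      using e TC_rule.hyps sub
      by (simp only: sat_tc_ind interp_upd_simps extension_Rel0 Let_def
          sat_interp_upd_fresh[OF TC_rule.hyps(5)])
    \<comment> \<open>By \<open>mem\<close> the set consists of the elements common to all
      admissible closed sets that contain \<open>e u\<close>; hence it contains \<open>e u\<close>
      and is closed itself.\<close>
    moreover have "e u \<in> ?A" using e by (simp add: mem)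
    moreover have "\<forall>a\<in>dom M. \<forall>b\<in>dom M. a \<in> ?A \<and> 
         sat M (case_nat b (case_nat a e)) E \<phi> \<longrightarrow> b \<in> ?A"
      unfolding mem by blast
    ultimately have "e v \<in> ?A" by blast
    then have "sat M e E (TC \<phi> u v)" unfolding mem sat.simps(8) by (rule conjunct2)
    with \<open>\<not> sat M e E (TC \<phi> u v)\<close> show False ..
  qed
next
  case (LFP_ax \<phi> \<psi> y)
  have "extension M e E \<psi> \<in> adm M" using henkin_structureD(3) LFP_ax by blast
  moreover have "adm M \<subseteq> Pow (dom M)" using henkin_structureD(2) LFP_ax by blast
  moreover have "e n \<in> dom M" "E n \<in> adm M" for n using LFP_ax by (simp_all add: assignment_def)
  ultimately show ?case unfolding sat.simps(5,9) by (auto simp only: sat_lfp_ind Let_def)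
next
  case (LFP_rule \<phi> P \<xi> y)
  have e: "e n \<in> dom M" and E: "E n \<in> adm M" for n using LFP_rule.prems by (simp_all add: assignment_def)
  have sub: "adm M \<subseteq> Pow (dom M)" using henkin_structureD(2) LFP_rule.prems by blast
  show ?case unfolding sat.simps(5,9)
  proof (intro impI ballI)
    fix A
    assume \<xi>: "sat M e E \<xi>" and A: "A \<in> adm M"
      and cl: "\<forall>a\<in>dom M. sat M (case_nat a e) (case_nat A E) \<phi> \<longrightarrow> a \<in> A"
    let ?N = "interp_upd M P A"
    have "henkin_structure FO_LFP1 ar UNIV ?N"
      using LFP_rule.hyps LFP_rule.prems A by (intro henkin_interp_upd) auto
    moreover have "assignment ?N e E" using LFP_rule.prems by (simp add: assignment_def)
    ultimately have "sat ?N e E (Imp \<xi> (lfp_ind \<phi> y (Rel P [0])))"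
      using LFP_rule.IH LFP_rule.hyps(1) by blast
    then have "sat ?N e E (lfp_ind \<phi> y (Rel P [0]))"
      using \<xi> LFP_rule.hyps by (simp add: sat_interp_upd_fresh)
    moreover have "dom M \<inter> A = A" using A sub by auto
    ultimately show "e y \<in> A"
      using e E sub cl LFP_rule.hyps
      by (simp add: sat_lfp_ind extension_Rel0 Let_def sat_interp_upd_fresh)
  qed
qed simp_all

section \<open>Passing between the vocabulary and its extension by unary predicates\<close>

fun restrict_fm :: "'r set \<Rightarrow> ('r + nat) fm \<Rightarrow> 'r fm" where
  "restrict_fm \<sigma> Bot = Bot"
| "restrict_fm \<sigma> (Rel r xs) = (case r of Inl r' \<Rightarrow> if r' \<in> \<sigma> then Rel r' xs else Bot | Inr _ \<Rightarrow> Bot)"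
| "restrict_fm \<sigma> (Eq x y) = Eq x y"
| "restrict_fm \<sigma> (Mem X x) = Mem X x"
| "restrict_fm \<sigma> (Imp \<phi> \<psi>) = Imp (restrict_fm \<sigma> \<phi>) (restrict_fm \<sigma> \<psi>)"
| "restrict_fm \<sigma> (Forall \<phi>) = Forall (restrict_fm \<sigma> \<phi>)"
| "restrict_fm \<sigma> (ForallS \<phi>) = ForallS (restrict_fm \<sigma> \<phi>)"
| "restrict_fm \<sigma> (TC \<phi> u v) = TC (restrict_fm \<sigma> \<phi>) u v"
| "restrict_fm \<sigma> (LFP \<phi> y) = LFP (restrict_fm \<sigma> \<phi>) y"

lemma pol_restrict_fm: "pol p X \<phi> \<Longrightarrow> pol p X (restrict_fm \<sigma> \<phi>)"
  by (induction \<phi> arbitrary: p X) (auto split: sum.splits)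

abbreviation ar_ext :: "('r \<Rightarrow> nat) \<Rightarrow> 'r + nat \<Rightarrow> nat" where
  "ar_ext ar \<equiv> case_sum ar (\<lambda>_. 1)"

lemma is_formula_restrict_fm:
  "is_formula \<Lambda> (ar_ext ar) UNIV \<phi> \<Longrightarrow> is_formula \<Lambda> ar \<sigma> (restrict_fm \<sigma> \<phi>)"
  by (induction \<phi>) (auto simp: pol_restrict_fm split: sum.splits)

definition expand :: "'r set \<Rightarrow> ('r, 'u) frame \<Rightarrow> ('r + nat, 'u) frame" where
  "expand \<sigma> M = \<lparr>dom = dom M,
     interp = (\<lambda>r. case r of Inl r' \<Rightarrow> if r' \<in> \<sigma> then interp M r' else {} | Inr _ \<Rightarrow> {}),
     adm = adm M\<rparr>"

lemma expand_simps [simp]: "dom (expand \<sigma> M) = dom M" "adm (expand \<sigma> M) = adm M"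
  by (simp_all add: expand_def)

text \<open>Symbols that the expansion interprets as empty become \<open>Bot\<close>. Therefore
  every set definable in the expansion is already definable over \<sigma>.\<close>

lemma sat_restrict_fm: "sat M e E (restrict_fm \<sigma> \<phi>) = sat (expand \<sigma> M) e E \<phi>"
proof (induction \<phi> arbitrary: e E)
  case (Rel r xs)
  then show ?case by (cases r) (auto simp: expand_def)
qed simp_all

lemma sat_expand: "is_formula \<Lambda> ar \<sigma> \<phi> \<Longrightarrow> sat (expand \<sigma> M) e E (map_fm Inl \<phi>) = sat M e E \<phi>"
proof (induction \<phi> arbitrary: e E)
  case (Rel r xs)
  then show ?case by (simp add: expand_def)
next
  case (ForallS \<phi>)
  then have "is_formula \<Lambda> ar \<sigma> \<phi>" by auto
  then show ?case using ForallS.IH by simp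
next
  case (TC \<phi> u v)
  then have "is_formula \<Lambda> ar \<sigma> \<phi>" by auto
  then show ?case using TC.IH by simp
next
  case (LFP \<phi> y)
  then have "is_formula \<Lambda> ar \<sigma> \<phi>" by auto
  then show ?case using LFP.IH by simp
qed simp_all

lemma henkin_expand:
  assumes "henkin_structure \<Lambda> ar \<sigma> M"
  shows "henkin_structure \<Lambda> (ar_ext ar) UNIV (expand \<sigma> M)"
  unfolding henkin_structure_def
proof (intro conjI allI impI)
  show "is_frame (ar_ext ar) UNIV (expand \<sigma> M)"
    using assms by (auto simp: henkin_structure_def is_frame_def expand_def split: sum.splits)
  fix \<phi> e E
  assume "is_formula \<Lambda> (ar_ext ar) UNIV \<phi>" "assignment (expand \<sigma> M) e E"
  then have "extension M e E (restrict_fm \<sigma> \<phi>) \<in> adm M"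
    by (intro henkin_structureD(3)[OF assms]) (auto simp: is_formula_restrict_fm assignment_def)
  then show "{a \<in> dom (expand \<sigma> M). sat (expand \<sigma> M) (case_nat a e) E \<phi>} \<in> adm (expand \<sigma> M)"
    by (simp add: extension_def sat_restrict_fm)
qed

lemma map_fm_foldr_And: "map_fm p (foldr And \<psi>s Top) = foldr And (map (map_fm p) \<psi>s) Top"
  by (induction \<psi>s) auto

lemma sat_foldr_And: "sat M e E (foldr And \<psi>s Top) = (\<forall>\<psi>\<in>set \<psi>s. sat M e E \<psi>)"
  by (induction \<psi>s) auto

lemma derivable_sound:
  assumes "\<forall>\<psi>\<in>\<Gamma>. is_formula \<Lambda> ar \<sigma> \<psi>" "is_formula \<Lambda> ar \<sigma> \<phi>" "derivable \<Lambda> ar \<Gamma> \<phi>"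
  shows "henkin_consequence TYPE('u) \<Lambda> ar \<sigma> \<Gamma> \<phi>"
  unfolding henkin_consequence_def
proof (intro allI impI)
  fix M :: "('a, 'u) frame" and e E
  assume M: "henkin_structure \<Lambda> ar \<sigma> M" and e: "assignment M e E" and \<Gamma>: "\<forall>\<psi>\<in>\<Gamma>. sat M e E \<psi>"
  obtain \<psi>s where \<psi>s: "set \<psi>s \<subseteq> \<Gamma>" 
    and p: "provable \<Lambda> (ar_ext ar) (map_fm Inl (Imp (foldr And \<psi>s Top) \<phi>))"
    using assms(3) by (auto simp: derivable_def)
  have "assignment (expand \<sigma> M) e E" using e by (simp add: assignment_def)
  from provable_sound[OF p henkin_expand[OF M] this] show "sat M e E \<phi>"
    using assms \<psi>s \<Gamma> by (auto simp: map_fm_foldr_And sat_foldr_And sat_expand[of \<Lambda> ar \<sigma>] subset_iff)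
qed

section \<open>Theories with constants\<close>

text \<open>
  Constants, serving both as names of individuals and as names of admissible sets. The vocabulary
  may be uncountable, so the countably many variables do not suffice. \<open>Wit \<chi> ks ss\<close> is the witness
  belonging to the formula \<open>\<chi>\<close> with constants \<open>ks\<close>, \<open>ss\<close> as parameters.
\<close>

datatype 'r cst = Var nat | Wit "'r fm" "'r cst list" "'r cst list"

text \<open>
  A formula with constants is represented by the map that takes a replacement of constants by
  variables to the resulting formula.
\<close>

type_synonym 'r stmt = "('r cst \<Rightarrow> nat) \<Rightarrow> ('r cst \<Rightarrow> nat) \<Rightarrow> 'r fm"

definition stmt :: "'r fm \<Rightarrow> (nat \<Rightarrow> 'r cst) \<Rightarrow> (nat \<Rightarrow> 'r cst) \<Rightarrow> 'r stmt" where
  "stmt \<phi> e E = (\<lambda>c C. rename (c \<circ> e) (C \<circ> E) \<phi>)"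

abbreviation stmt_Bot :: "'r stmt" where "stmt_Bot \<equiv> \<lambda>c C. Bot"

text \<open>Pads a finite list to an assignment. The default is not a witness, so only the listed
  constants matter for the freshness of witnesses.\<close>

definition params :: "'r cst list \<Rightarrow> nat \<Rightarrow> 'r cst" where
  "params ks i = (if i < length ks then ks ! i else Var 0)"

lemma peval_foldr_Imp:
  "peval v (foldr Imp as b) \<longleftrightarrow> ((\<forall>a\<in>set as. peval v a) \<longrightarrow> peval v b)"
  by (induction as) auto

lemma peval_foldr_And: "peval v (foldr And as Top) \<longleftrightarrow> (\<forall>a\<in>set as. peval v a)"
  by (induction as) auto

lemma is_formula_foldr_Imp:
  "is_formula \<Lambda> ar \<sigma> (foldr Imp as b) \<longleftrightarrow> (\<forall>a\<in>set as. is_formula \<Lambda> ar \<sigma> a) \<and> is_formula \<Lambda> ar \<sigma> b"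
  by (induction as) auto

lemma is_formula_foldr_And:
  "is_formula \<Lambda> ar \<sigma> (foldr And as Top) \<longleftrightarrow> (\<forall>a\<in>set as. is_formula \<Lambda> ar \<sigma> a)"
  by (induction as) auto

lemma lift_foldr_Imp:
  "lift (foldr Imp (map g ts) Bot) = foldr Imp (map (\<lambda>t. lift (g t)) ts) Bot"
  "liftS (foldr Imp (map g ts) Bot) = foldr Imp (map (\<lambda>t. liftS (g t)) ts) Bot"
  by (induction ts) (auto simp: lift_def liftS_def)

lemma rename_finite_support:
  "\<exists>n. \<forall>f f' F F'. (\<forall>i<n. f i = f' i \<and> F i = F' i) \<longrightarrow> rename f F \<phi> = rename f' F' \<phi>"
proof (induction \<phi>)
  case (Rel r xs)
  have "i \<in> set xs \<Longrightarrow> i < Suc (sum_list xs)" for i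
    using member_le_sum_list[of i xs] by simp
  then show ?case by (intro exI[of _ "Suc (sum_list xs)"]) simp
next
  case (Eq x y)
  show ?case by (intro exI[of _ "Suc (x + y)"]) simp
next
  case (Mem x y)
  show ?case by (intro exI[of _ "Suc (x + y)"]) simp
next
  case (Imp \<phi> \<psi>)
  then obtain m n where
    "\<forall>f f' F F'. (\<forall>i<m. f i = f' i \<and> F i = F' i) \<longrightarrow> rename f F \<phi> = rename f' F' \<phi>"
    "\<forall>f f' F F'. (\<forall>i<n. f i = f' i \<and> F i = F' i) \<longrightarrow> rename f F \<psi> = rename f' F' \<psi>"
    by blast
  then show ?case by (intro exI[of _ "m + n"]) (metis rename.simps(5) trans_less_add1 trans_less_add2)
next
  case (Forall \<phi>)
  then obtain n where n:
    "\<And>f f' F F'. (\<forall>i<n. f i = f' i \<and> F i = F' i) \<Longrightarrow> rename f F \<phi> = rename f' F' \<phi>" by blast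
  show ?case
    by (intro exI[of _ n]) (auto simp: up_def intro!: n split: nat.splits)
next
  case (ForallS \<phi>)
  then obtain n where n:
    "\<And>f f' F F'. (\<forall>i<n. f i = f' i \<and> F i = F' i) \<Longrightarrow> rename f F \<phi> = rename f' F' \<phi>" by blast
  show ?case
    by (intro exI[of _ n]) (auto simp: up_def intro!: n split: nat.splits)
next
  case (TC \<phi> u v)
  then obtain n where n:
    "\<And>f f' F F'. (\<forall>i<n. f i = f' i \<and> F i = F' i) \<Longrightarrow> rename f F \<phi> = rename f' F' \<phi>" by blast
  show ?case
    by (intro exI[of _ "n + Suc (u + v)"]) (auto simp: up_def intro!: n split: nat.splits)
next
  case (LFP \<phi> y)
  then obtain n where n:
    "\<And>f f' F F'. (\<forall>i<n. f i = f' i \<and> F i = F' i) \<Longrightarrow> rename f F \<phi> = rename f' F' \<phi>" by blast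
  show ?case
    by (intro exI[of _ "n + Suc y"]) (auto simp: up_def intro!: n split: nat.splits)
qed simp

text \<open>A formula depends on finitely many indices, so its constants fit into two finite lists
  and can serve as arguments of \<open>Wit\<close>.\<close>

lemma stmt_params: "\<exists>ks ss. stmt \<chi> e E = stmt \<chi> (params ks) (params ss)"
proof -
  obtain n where n: "\<And>f f' F F'. (\<forall>i<n. f i = f' i \<and> F i = F' i) \<Longrightarrow> rename f F \<chi> = rename f' F' \<chi>"
    using rename_finite_support by metis
  have "stmt \<chi> e E = stmt \<chi> (params (map e [0..<n])) (params (map E [0..<n]))"
    unfolding stmt_def by (intro ext n) (simp add: params_def)
  then show ?thesis by blast
qed

text \<open>
  Here \<open>a\<close> and \<open>b\<close> stand for the witness as an individual and as a set. In fixed point logic, which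
  lacks set quantifiers, the formulas \<open>Imp (Forall \<psi>) \<chi>\<close> serve as labels for the witnesses of
  comprehension.
\<close>

definition wit_ax :: "lang \<Rightarrow> 'r fm \<Rightarrow> nat \<Rightarrow> nat \<Rightarrow> 'r fm" where
  "wit_ax \<Lambda> \<chi> a b = (case \<chi> of
     Forall \<phi> \<Rightarrow> Imp (inst \<phi> a) (Forall \<phi>)
   | ForallS \<phi> \<Rightarrow> Imp (instS \<phi> (Mem b 0)) (ForallS \<phi>)
   | LFP \<phi> y \<Rightarrow> Imp (lfp_ind \<phi> y (Mem b 0)) (LFP \<phi> y)
   | Imp \<phi> _ \<Rightarrow> (case \<phi> of Forall \<psi> \<Rightarrow> if \<Lambda> = FO_LFP1 then Forall (Iff (Mem b 0) \<psi>) else Top | _ \<Rightarrow> Top)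
   | _ \<Rightarrow> Top)"

lemma rename_wit_ax: "rename f F (wit_ax \<Lambda> \<chi> a b) = wit_ax \<Lambda> (rename f F \<chi>) (f a) (F b)"
  by (cases \<chi>; simp add: wit_ax_def rename_inst rename_instS rename_lfp_ind split: fm.split)

lemma is_formula_wit_ax:
  "is_formula \<Lambda> ar \<sigma> \<chi> \<Longrightarrow> is_formula \<Lambda> ar \<sigma> (wit_ax \<Lambda> \<chi> a b)"
  by (cases \<chi>; auto simp: wit_ax_def is_formula_instS is_formula_lfp_ind split: fm.split)

text \<open>The shape of \<chi> decides whether the witness acts as an individual or as a set. The
  hypothesis is therefore available with either role turned into an eigenvariable at index 0; for
  the remaining shapes the axiom is \<open>Top\<close>.\<close>

lemma wit_ax_elim:
  assumes inf: "infinite {P. ar P = 1}" and \<chi>: "is_formula \<Lambda> ar UNIV \<chi>"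
    and ind: "provable \<Lambda> ar (Imp (wit_ax \<Lambda> (lift \<chi>) 0 b) (lift \<theta>))"
    and set: "provable \<Lambda> ar (Imp (wit_ax \<Lambda> (liftS \<chi>) a 0) (liftS \<theta>))"
  shows "provable \<Lambda> ar \<theta>"
proof -
  have \<theta>: "is_formula \<Lambda> ar UNIV \<theta>" using provable_is_formula[OF ind] by simp
  have Top: "provable \<Lambda> ar \<theta>" if "wit_ax \<Lambda> (lift \<chi>) 0 b = Top"
  proof -
    have "provable \<Lambda> ar (lift \<theta>)" by (rule prov1[OF ind]) (use that \<theta> in auto)
    from MP[OF Forall_inst Gen[OF this], of 0] show ?thesis using \<theta> by simp
  qed
  show ?thesis
  proof (cases \<chi>)
    case (Forall \<phi>)
    then show ?thesis
      using ind Forall_witness[of \<Lambda> ar \<phi> \<theta>] by (simp add: wit_ax_def lift_def inst_def)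
  next
    case (ForallS \<phi>)
    then have "\<Lambda> = MSO" using \<chi> by simp
    with ForallS show ?thesis
      using set ForallS_witness[of \<Lambda> ar \<phi> \<theta>] by (simp add: wit_ax_def liftS_def instS_Mem)
  next
    case (LFP \<phi> y)
    then have "\<Lambda> = FO_LFP1" using \<chi> by simp
    with LFP show ?thesis
      using set LFP_witness[OF inf, of \<phi> y \<theta>] by (simp add: wit_ax_def liftS_def)
  next
    case (Imp \<phi> \<phi>')
    show ?thesis
    proof (cases "(\<exists>\<psi>. \<phi> = Forall \<psi>) \<and> \<Lambda> = FO_LFP1")
      case True
      then obtain \<psi> where "\<phi> = Forall \<psi>" "\<Lambda> = FO_LFP1" by blast
      then show ?thesis
        using set Compr_witness_LFP[OF inf, of \<psi> \<theta>] Imp by (simp add: wit_ax_def liftS_def)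
    next
      case False
      then show ?thesis by (intro Top) (cases \<phi>; auto simp: Imp wit_ax_def lift_def)
    qed
  qed (use Top in \<open>auto simp: wit_ax_def lift_def\<close>)
qed

definition wit_stmt :: "lang \<Rightarrow> 'r fm \<times> 'r cst list \<times> 'r cst list \<Rightarrow> 'r stmt" where
  "wit_stmt \<Lambda> = (\<lambda>(\<chi>, ks, ss) c C.
     wit_ax \<Lambda> (stmt \<chi> (params ks) (params ss) c C) (c (Wit \<chi> ks ss)) (C (Wit \<chi> ks ss)))"

text \<open>Absence of the constant \<open>w\<close>, expressed without syntax for constants:
  sending \<open>w\<close> to the new index 0 and shifting all others does no more than weaken the
  formula.\<close>

definition fresh :: "'r cst \<Rightarrow> 'r stmt \<Rightarrow> bool" where
  "fresh w t \<longleftrightarrow>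
     (\<forall>c C. t ((Suc \<circ> c)(w := 0)) C = lift (t c C) \<and> t c ((Suc \<circ> C)(w := 0)) = liftS (t c C))"

lemma fresh_ind: "fresh w t \<Longrightarrow> t ((Suc \<circ> c)(w := 0)) C = lift (t c C)"
  and fresh_set: "fresh w t \<Longrightarrow> t c ((Suc \<circ> C)(w := 0)) = liftS (t c C)"
  by (simp_all add: fresh_def)

lemma fun_upd_o_notin: "w \<notin> range e \<Longrightarrow> f(w := a) \<circ> e = f \<circ> e"
  by (auto simp: fun_eq_iff)

lemma fresh_stmt: "w \<notin> range e \<Longrightarrow> w \<notin> range E \<Longrightarrow> fresh w (stmt \<phi> e E)"
  by (simp add: fresh_def stmt_def lift_def liftS_def fun_upd_o_notin comp_assoc)

text \<open>Entries of a parameter list are strictly smaller than a witness built from it, so no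
  constant of at least that size is among them.\<close>

lemma not_in_params:
  "size w \<ge> size (Wit \<chi> ks ss) \<Longrightarrow> w \<notin> range (params ks)"
  "size w \<ge> size (Wit \<chi> ks ss) \<Longrightarrow> w \<notin> range (params ss)"
proof -
  have *: "size k < Suc (size_list size ls)" if "k \<in> set ls" for k :: "'a cst" and ls
    using that by (simp add: size_list_estimation' less_Suc_eq_le)
  have "w \<notin> range (params ls)" if "size w \<ge> Suc (size_list size ls)" for ls
  proof
    assume "w \<in> range (params ls)"
    then obtain i where i: "w = params ls i" by blast
    show False
    proof (cases "i < length ls")
      case True
      then have "w \<in> set ls" using i by (simp add: params_def)
      with * that show False by fastforce
    next
      case False
      then show False using i that by (simp add: params_def)
    qed
  qed
  note ** = this
  show "size w \<ge> size (Wit \<chi> ks ss) \<Longrightarrow> w \<notin> range (params ks)"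
    "size w \<ge> size (Wit \<chi> ks ss) \<Longrightarrow> w \<notin> range (params ss)"
    by (rule **; simp)+
qed

lemma fresh_wit_stmt:
  assumes "w \<noteq> Wit \<chi> ks ss" "size w \<ge> size (Wit \<chi> ks ss)"
  shows "fresh w (wit_stmt \<Lambda> (\<chi>, ks, ss))"
  using assms fresh_stmt[OF not_in_params[OF assms(2)], of \<chi>]
  by (simp add: fresh_def wit_stmt_def) (simp add: lift_def liftS_def rename_wit_ax)

section \<open>Maximal consistent theories\<close>

locale henkin_theory =
  fixes \<Lambda> :: lang and ar :: "'r \<Rightarrow> nat"
  assumes inf: "infinite {P. ar P = 1}"
begin

text \<open>The premises are chosen before \<open>c\<close> and \<open>C\<close>, which makes the
  constants generic: one derivation scheme covers every replacement, in particular those that move a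
  witness to index 0 and shift the rest.\<close>

definition entails :: "'r stmt set \<Rightarrow> 'r stmt \<Rightarrow> bool" where
  "entails T t \<longleftrightarrow>
     (\<exists>ts. set ts \<subseteq> T \<and> (\<forall>c C. provable \<Lambda> ar (foldr Imp (map (\<lambda>s. s c C) ts) (t c C))))"

definition wf :: "'r stmt set" where
  "wf = {t. \<forall>c C. is_formula \<Lambda> ar UNIV (t c C)}"

lemma stmt_wf: "is_formula \<Lambda> ar UNIV \<phi> \<Longrightarrow> stmt \<phi> e E \<in> wf"
  by (simp add: wf_def stmt_def)

lemma entails_wf: "entails T t \<Longrightarrow> t \<in> wf"
proof -
  assume "entails T t"
  then obtain ts where p: "provable \<Lambda> ar (foldr Imp (map (\<lambda>s. s c C) ts) (t c C))" for c C
    by (auto simp: entails_def)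
  show "t \<in> wf"
    using provable_is_formula[OF p] by (simp add: wf_def is_formula_foldr_Imp)
qed

lemma entails_assm: "t \<in> T \<Longrightarrow> t \<in> wf \<Longrightarrow> entails T t"
  unfolding entails_def
  by (rule exI[of _ "[t]"]) (auto intro!: Taut simp: tautology_def wf_def)

lemma entails_provable: "(\<And>c C. provable \<Lambda> ar (t c C)) \<Longrightarrow> entails T t"
  unfolding entails_def by (rule exI[of _ "[]"]) simp

lemma entails_MP:
  assumes "entails T (\<lambda>c C. Imp (s c C) (t c C))" "entails T s"
  shows "entails T t"
proof -
  obtain ts us where ts: "set ts \<subseteq> T" "set us \<subseteq> T"
    and p: "\<And>c C. provable \<Lambda> ar (foldr Imp (map (\<lambda>s. s c C) ts) (Imp (s c C) (t c C)))"
      "\<And>c C. provable \<Lambda> ar (foldr Imp (map (\<lambda>s. s c C) us) (s c C))"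
    using assms by (auto simp: entails_def)
  have "provable \<Lambda> ar (foldr Imp (map (\<lambda>s. s c C) (ts @ us)) (t c C))" for c C
    by (rule prov2[OF p[of c C]])
      (use p[of c C, THEN provable_is_formula] in \<open>auto simp: is_formula_foldr_Imp peval_foldr_Imp\<close>)
  then show ?thesis using ts unfolding entails_def by (intro exI[of _ "ts @ us"]) auto
qed

lemma entails_deduct:
  assumes "entails (insert s T) t" "s \<in> wf"
  shows "entails T (\<lambda>c C. Imp (s c C) (t c C))"
proof -
  obtain ts where ts: "set ts \<subseteq> insert s T"
    and p: "\<And>c C. provable \<Lambda> ar (foldr Imp (map (\<lambda>s. s c C) ts) (t c C))"
    using assms by (auto simp: entails_def)
  let ?us = "filter (\<lambda>u. u \<noteq> s) ts"
  have "provable \<Lambda> ar (foldr Imp (map (\<lambda>s. s c C) ?us) (Imp (s c C) (t c C)))" for c C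
    by (rule prov1[OF p[of c C]])
      (use p[of c C, THEN provable_is_formula] assms(2) in
        \<open>auto simp: is_formula_foldr_Imp peval_foldr_Imp wf_def\<close>)
  then show ?thesis using ts unfolding entails_def by (intro exI[of _ ?us]) auto
qed

lemma entails_finite: "entails T t \<Longrightarrow> \<exists>S. finite S \<and> S \<subseteq> T \<and> entails S t"
  unfolding entails_def by (meson List.finite_set order_refl)

lemma entails_mono: "entails S t \<Longrightarrow> S \<subseteq> T \<Longrightarrow> entails T t"
  unfolding entails_def by blast

text \<open>Under the replacement that sends the witness to index 0 and shifts the other constants,
  the premises and \<chi> are merely weakened. The witness is then an eigenvariable, which
  \<open>wit_ax_elim\<close> discharges.\<close>

lemma wit_stmt_elim:
  assumes fr: "\<And>t. t \<in> T \<Longrightarrow> fresh (Wit \<chi> ks ss) t" and \<chi>: "is_formula \<Lambda> ar UNIV \<chi>"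
    and "entails (insert (wit_stmt \<Lambda> (\<chi>, ks, ss)) T) stmt_Bot"
  shows "entails T stmt_Bot"
proof -
  let ?w = "Wit \<chi> ks ss" and ?h = "wit_stmt \<Lambda> (\<chi>, ks, ss)"
  have h: "?h \<in> wf" using \<chi> by (simp add: wf_def wit_stmt_def stmt_def is_formula_wit_ax)
  obtain ts where ts: "set ts \<subseteq> T"
    and p: "\<And>c C. provable \<Lambda> ar (foldr Imp (map (\<lambda>s. s c C) ts) (Imp (?h c C) Bot))"
    using entails_deduct[OF assms(3) h] by (auto simp: entails_def)
  let ?\<theta> = "\<lambda>c C. foldr Imp (map (\<lambda>s. s c C) ts) Bot"
  have q: "provable \<Lambda> ar (Imp (?h c C) (?\<theta> c C))" for c C
    by (rule prov1[OF p[of c C]])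
      (use p[of c C, THEN provable_is_formula] in \<open>auto simp: is_formula_foldr_Imp peval_foldr_Imp\<close>)
  have frt: "t \<in> set ts \<Longrightarrow> fresh ?w t" for t using fr ts by blast
  have fr\<chi>: "fresh ?w (stmt \<chi> (params ks) (params ss))"
    by (intro fresh_stmt not_in_params) auto
  have "provable \<Lambda> ar (?\<theta> c C)" for c C
  proof (rule wit_ax_elim[OF inf, of \<Lambda> "stmt \<chi> (params ks) (params ss) c C"])
    show "is_formula \<Lambda> ar UNIV (stmt \<chi> (params ks) (params ss) c C)"
      using \<chi> by (simp add: stmt_def)
    have "?\<theta> ((Suc \<circ> c)(?w := 0)) C = lift (?\<theta> c C)"
      unfolding lift_foldr_Imp
      by (rule arg_cong[of _ _ "\<lambda>as. foldr Imp as Bot"], rule map_cong[OF refl], rule fresh_ind, rule frt)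
    then show "provable \<Lambda> ar (Imp (wit_ax \<Lambda> (lift (stmt \<chi> (params ks) (params ss) c C)) 0 (C ?w)) (lift (?\<theta> c C)))"
      using q[of "(Suc \<circ> c)(?w := 0)" C] fr\<chi> by (simp add: wit_stmt_def fresh_def)
    have "?\<theta> c ((Suc \<circ> C)(?w := 0)) = liftS (?\<theta> c C)"
      unfolding lift_foldr_Imp
      by (rule arg_cong[of _ _ "\<lambda>as. foldr Imp as Bot"], rule map_cong[OF refl], rule fresh_set, rule frt)
    then show "provable \<Lambda> ar (Imp (wit_ax \<Lambda> (liftS (stmt \<chi> (params ks) (params ss) c C)) (c ?w) 0) (liftS (?\<theta> c C)))"
      using q[of c "(Suc \<circ> C)(?w := 0)"] fr\<chi> by (simp add: wit_stmt_def fresh_def)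
  qed
  then show ?thesis using ts unfolding entails_def by blast
qed

definition wit_keys :: "('r fm \<times> 'r cst list \<times> 'r cst list) set" where
  "wit_keys = {(\<chi>, ks, ss). is_formula \<Lambda> ar UNIV \<chi>}"

lemma wit_stmt_wf: "wit_stmt \<Lambda> ` wit_keys \<subseteq> wf"
  by (auto simp: wit_keys_def wf_def wit_stmt_def stmt_def is_formula_wit_ax)

text \<open>A witness of maximal size does not occur in the other witness axioms.\<close>

lemma consistent_wit_stmts:
  assumes con: "\<not> entails T stmt_Bot" and fr: "\<And>t \<chi> ks ss. t \<in> T \<Longrightarrow> fresh (Wit \<chi> ks ss) t"
  shows "\<not> entails (T \<union> wit_stmt \<Lambda> ` wit_keys) stmt_Bot"
proof
  have *: "S \<subseteq> wit_keys \<Longrightarrow> \<not> entails (T \<union> wit_stmt \<Lambda> ` S) stmt_Bot" if "finite S" for S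
    using that
  proof (induction rule: finite_ranking_induct[where f="\<lambda>(\<chi>, ks, ss). size (Wit \<chi> ks ss)"])
    case empty
    then show ?case using con by simp
  next
    \<comment> \<open>Keys arrive in order of nondecreasing size, so the new witness is at least as
      large as the earlier ones. Ties are harmless: distinct witnesses of equal size are not
      parameters of each other.\<close>
    case (insert x S)
    obtain \<chi> ks ss where x: "x = (\<chi>, ks, ss)" by (cases x)
    show ?case
    proof (cases "x \<in> S")
      case True
      then show ?thesis using insert by (simp add: insert_absorb)
    next
      case False
      have "fresh (Wit \<chi> ks ss) t" if tS: "t \<in> T \<union> wit_stmt \<Lambda> ` S" for t
      proof (cases "t \<in> T")
        case True
        then show ?thesis by (rule fr)
      next
        case False
        then obtain y where y: "t = wit_stmt \<Lambda> y" "y \<in> S" using tS by blast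
        obtain \<chi>' ks' ss' where "y = (\<chi>', ks', ss')" by (cases y)
        with y have t: "t = wit_stmt \<Lambda> (\<chi>', ks', ss')" and S: "(\<chi>', ks', ss') \<in> S" by simp_all
        show ?thesis unfolding t using insert.hyps(2)[OF S] S x \<open>x \<notin> S\<close>
          by (intro fresh_wit_stmt) auto
      qed
      from wit_stmt_elim[OF this] insert show ?thesis
        by (auto simp: x wit_keys_def)
    qed
  qed
  assume "entails (T \<union> wit_stmt \<Lambda> ` wit_keys) stmt_Bot"
  then obtain S where S: "finite S" "S \<subseteq> T \<union> wit_stmt \<Lambda> ` wit_keys" "entails S stmt_Bot"
    using entails_finite by blast
  have "finite (S - T)" "S - T \<subseteq> wit_stmt \<Lambda> ` wit_keys" using S by auto
  then obtain K where "K \<subseteq> wit_keys" "finite K" "S - T = wit_stmt \<Lambda> ` K"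
    by (meson finite_subset_image)
  moreover from this have "entails (T \<union> wit_stmt \<Lambda> ` K) stmt_Bot"
    by (intro entails_mono[OF S(3)]) blast
  ultimately show False using * by blast
qed

definition maxcon :: "'r stmt set \<Rightarrow> bool" where
  "maxcon T \<longleftrightarrow> T \<subseteq> wf \<and> \<not> entails T stmt_Bot \<and> (\<forall>t\<in>wf. t \<notin> T \<longrightarrow> entails (insert t T) stmt_Bot)"

lemma Lindenbaum:
  assumes "T0 \<subseteq> wf" "\<not> entails T0 stmt_Bot"
  shows "\<exists>T. T0 \<subseteq> T \<and> maxcon T"
proof -
  let ?A = "{T. T0 \<subseteq> T \<and> T \<subseteq> wf \<and> \<not> entails T stmt_Bot}"
  have "\<exists>M\<in>?A. \<forall>X\<in>?A. M \<subseteq> X \<longrightarrow> X = M"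
  proof (rule subset_Zorn_nonempty)
    show "?A \<noteq> {}" using assms by blast
    fix C assume C: "C \<noteq> {}" "subset.chain ?A C"
    have CA: "C \<subseteq> ?A" using C(2) by (simp only: subset.chain_def)
    have "\<not> entails (\<Union>C) stmt_Bot"
    proof
      assume "entails (\<Union>C) stmt_Bot"
      then obtain S where S: "finite S" "S \<subseteq> \<Union>C" "entails S stmt_Bot"
        using entails_finite by blast
      from finite_subset_Union_chain[OF S(1,2) C] obtain X where "X \<in> C" "S \<subseteq> X" .
      then show False
        using entails_mono[OF S(3)] CA by blast
    qed
    moreover have "T0 \<subseteq> \<Union>C" "\<Union>C \<subseteq> wf" using C(1) CA by blast+
    ultimately show "\<Union>C \<in> ?A" by simp
  qed
  then obtain M where M: "M \<in> ?A" "\<forall>X\<in>?A. M \<subseteq> X \<longrightarrow> X = M" by (rule bexE)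
  have "entails (insert t M) stmt_Bot" if "t \<in> wf" "t \<notin> M" for t
  proof (rule ccontr)
    assume "\<not> entails (insert t M) stmt_Bot"
    then have "insert t M \<in> ?A" using M(1) that(1) by auto
    from M(2)[rule_format, OF this] have "insert t M = M" by (simp add: subset_insertI)
    with that(2) show False by blast
  qed
  then show ?thesis using M(1) unfolding maxcon_def by blast
qed

end

section \<open>The canonical model\<close>

locale canonical = henkin_theory \<Lambda> ar for \<Lambda> and ar :: "'r \<Rightarrow> nat" +
  fixes T :: "'r stmt set"
  assumes max: "maxcon T" and wit: "wit_stmt \<Lambda> ` wit_keys \<subseteq> T"
begin

lemma T_entails:
  assumes "entails T t"
  shows "t \<in> T"
proof (rule ccontr)
  assume "t \<notin> T"
  moreover have "t \<in> wf" using assms by (rule entails_wf)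
  ultimately have "entails (insert t T) stmt_Bot" using max by (simp add: maxcon_def)
  from entails_MP[OF entails_deduct[OF this \<open>t \<in> wf\<close>] assms] show False
    using max by (simp add: maxcon_def)
qed

lemma T_provable: "(\<And>c C. provable \<Lambda> ar (t c C)) \<Longrightarrow> t \<in> T"
  by (intro T_entails entails_provable)

lemma T_wf: "t \<in> T \<Longrightarrow> t \<in> wf"
  using max by (auto simp: maxcon_def)

lemma T_MP: "(\<lambda>c C. Imp (s c C) (t c C)) \<in> T \<Longrightarrow> s \<in> T \<Longrightarrow> t \<in> T"
  by (rule T_entails) (blast intro: entails_MP entails_assm T_wf)

lemma T_mono: "(\<And>c C. provable \<Lambda> ar (Imp (s c C) (t c C))) \<Longrightarrow> s \<in> T \<Longrightarrow> t \<in> T"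
  by (rule T_MP[OF T_provable])

lemma T_mono2:
  "(\<And>c C. provable \<Lambda> ar (Imp (s c C) (Imp (t c C) (u c C)))) \<Longrightarrow> s \<in> T \<Longrightarrow> t \<in> T \<Longrightarrow> u \<in> T"
  by (rule T_MP[OF T_MP[OF T_provable]])

lemma T_Bot: "stmt_Bot \<notin> T"
  using max entails_assm[of stmt_Bot T] T_wf unfolding maxcon_def by blast

lemma T_Imp:
  assumes "s \<in> wf" "t \<in> wf"
  shows "(\<lambda>c C. Imp (s c C) (t c C)) \<in> T \<longleftrightarrow> (s \<in> T \<longrightarrow> t \<in> T)"
proof
  assume "s \<in> T \<longrightarrow> t \<in> T"
  then consider "t \<in> T" | "s \<notin> T" by blast
  then show "(\<lambda>c C. Imp (s c C) (t c C)) \<in> T"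
  proof cases
    case 1
    then show ?thesis
      using assms by (elim T_mono[rotated]) (auto intro!: Taut simp: tautology_def wf_def)
  next
    case 2
    then have "entails (insert s T) stmt_Bot" using max assms by (simp add: maxcon_def)
    from T_entails[OF entails_deduct[OF this assms(1)]] show ?thesis
      using assms by (elim T_mono[rotated]) (auto intro!: Taut simp: tautology_def wf_def)
  qed
qed (use T_MP in blast)

lemma stmt_Bot_notin [simp]: "stmt Bot e E \<notin> T"
  using T_Bot by (simp add: stmt_def)

lemma stmt_Imp [simp]:
  "is_formula \<Lambda> ar UNIV (Imp \<phi> \<psi>) \<Longrightarrow>
   stmt (Imp \<phi> \<psi>) e E \<in> T \<longleftrightarrow> (stmt \<phi> e E \<in> T \<longrightarrow> stmt \<psi> e E \<in> T)"
  using T_Imp[OF stmt_wf stmt_wf, of \<phi> \<psi> e E e E] by (simp add: stmt_def)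

lemma witness:
  assumes "is_formula \<Lambda> ar UNIV \<chi>"
  shows "\<exists>w. (\<lambda>c C. wit_ax \<Lambda> (stmt \<chi> e E c C) (c w) (C w)) \<in> T"
proof -
  obtain ks ss where "stmt \<chi> e E = stmt \<chi> (params ks) (params ss)" using stmt_params by blast
  moreover have "wit_stmt \<Lambda> (\<chi>, ks, ss) \<in> T" using wit assms by (auto simp: wit_keys_def)
  ultimately show ?thesis by (auto simp: wit_stmt_def)
qed

lemma stmt_Forall:
  assumes "is_formula \<Lambda> ar UNIV \<phi>"
  shows "stmt (Forall \<phi>) e E \<in> T \<longleftrightarrow> (\<forall>k. stmt \<phi> (case_nat k e) E \<in> T)"
proof
  assume "stmt (Forall \<phi>) e E \<in> T"
  then show "\<forall>k. stmt \<phi> (case_nat k e) E \<in> T"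
  proof (intro allI, elim T_mono[rotated])
    fix k c C
    show "provable \<Lambda> ar (Imp (stmt (Forall \<phi>) e E c C) (stmt \<phi> (case_nat k e) E c C))"
      using Forall_inst[of \<Lambda> ar "rename (up (c \<circ> e)) (C \<circ> E) \<phi>" "c k"] assms
      by (simp add: stmt_def inst_def)
  qed
next
  assume *: "\<forall>k. stmt \<phi> (case_nat k e) E \<in> T"
  obtain w where "(\<lambda>c C. wit_ax \<Lambda> (stmt (Forall \<phi>) e E c C) (c w) (C w)) \<in> T"
    using witness[of "Forall \<phi>" e E] assms by auto
  then have "(\<lambda>c C. Imp (stmt \<phi> (case_nat w e) E c C) (stmt (Forall \<phi>) e E c C)) \<in> T"
    by (simp add: wit_ax_def stmt_def inst_def)
  with * show "stmt (Forall \<phi>) e E \<in> T" by (blast intro: T_MP)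
qed

lemma stmt_ForallS:
  assumes "is_formula \<Lambda> ar UNIV (ForallS \<phi>)"
  shows "stmt (ForallS \<phi>) e E \<in> T \<longleftrightarrow> (\<forall>k. stmt \<phi> e (case_nat k E) \<in> T)"
proof
  assume "stmt (ForallS \<phi>) e E \<in> T"
  then show "\<forall>k. stmt \<phi> e (case_nat k E) \<in> T"
  proof (intro allI, elim T_mono[rotated])
    fix k c C
    show "provable \<Lambda> ar (Imp (stmt (ForallS \<phi>) e E c C) (stmt \<phi> e (case_nat k E) c C))"
      using ForallS_inst_var[of \<Lambda> ar "rename (c \<circ> e) (up (C \<circ> E)) \<phi>" "C k"] assms
      by (auto simp: stmt_def instS_Mem)
  qed
next
  assume *: "\<forall>k. stmt \<phi> e (case_nat k E) \<in> T"
  obtain w where "(\<lambda>c C. wit_ax \<Lambda> (stmt (ForallS \<phi>) e E c C) (c w) (C w)) \<in> T"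
    using witness[OF assms] by blast
  then have "(\<lambda>c C. Imp (stmt \<phi> e (case_nat w E) c C) (stmt (ForallS \<phi>) e E c C)) \<in> T"
    by (simp add: wit_ax_def stmt_def instS_Mem)
  with * show "stmt (ForallS \<phi>) e E \<in> T" by (blast intro: T_MP)
qed

definition memT :: "'r cst \<Rightarrow> 'r cst \<Rightarrow> bool" where
  "memT K k \<longleftrightarrow> (\<lambda>c C. Mem (C K) (c k)) \<in> T"

lemma stmt_Mem [simp]: "stmt (Mem X x) e E \<in> T \<longleftrightarrow> memT (E X) (e x)"
  by (simp add: stmt_def memT_def)

text \<open>The quantifier over admissible sets is read as one over set constants:
  \<open>LFP_ax\<close> gives all instances, and the witness of the formula names a counterexample
  when the formula is not in \<open>T\<close>.\<close>

lemma stmt_LFP: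
  assumes "is_formula \<Lambda> ar UNIV (LFP \<phi> y)"
  shows "stmt (LFP \<phi> y) e E \<in> T \<longleftrightarrow>
    (\<forall>K. (\<forall>k. stmt \<phi> (case_nat k e) (case_nat K E) \<in> T \<longrightarrow> memT K k) \<longrightarrow> memT K (e y))"
proof -
  have L: "\<Lambda> = FO_LFP1" and \<phi>: "is_formula \<Lambda> ar UNIV \<phi>" "positive_in 0 \<phi>" using assms by auto
  let ?I = "\<lambda>K c C. lfp_ind (rename (up (c \<circ> e)) (up (C \<circ> E)) \<phi>) (c (e y)) (Mem (C K) 0)"
  have I: "?I K \<in> T \<longleftrightarrow>
    ((\<forall>k. stmt \<phi> (case_nat k e) (case_nat K E) \<in> T \<longrightarrow> memT K k) \<longrightarrow> memT K (e y))" for K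
  proof -
    let ?\<psi> = "Forall (Imp \<phi> (Mem 0 0))"
    have f: "is_formula \<Lambda> ar UNIV (Imp \<phi> (Mem 0 0))" using \<phi> L by simp
    have "?I K = (\<lambda>c C. Imp (stmt ?\<psi> e (case_nat K E) c C) (Mem (C K) (c (e y))))"
      by (simp add: lfp_ind_def stmt_def instS_Mem)
    moreover have "stmt ?\<psi> e (case_nat K E) \<in> wf" using f by (intro stmt_wf) simp
    moreover have "(\<lambda>c C. Mem (C K) (c (e y))) \<in> wf" unfolding wf_def using L by simp
    ultimately have "?I K \<in> T \<longleftrightarrow> (stmt ?\<psi> e (case_nat K E) \<in> T \<longrightarrow> memT K (e y))"
      using T_Imp by (simp add: memT_def)
    then show ?thesis using f by (simp add: stmt_Forall)
  qed
  have "stmt (LFP \<phi> y) e E \<in> T \<longleftrightarrow> (\<forall>K. ?I K \<in> T)"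
  proof
    assume "stmt (LFP \<phi> y) e E \<in> T"
    then show "\<forall>K. ?I K \<in> T"
      using L \<phi> by (auto elim!: T_mono[rotated] simp: stmt_def intro!: LFP_ax)
  next
    assume *: "\<forall>K. ?I K \<in> T"
    obtain w where "(\<lambda>c C. wit_ax \<Lambda> (stmt (LFP \<phi> y) e E c C) (c w) (C w)) \<in> T"
      using witness[OF assms] by blast
    then have "(\<lambda>c C. Imp (?I w c C) (stmt (LFP \<phi> y) e E c C)) \<in> T"
      by (simp add: wit_ax_def stmt_def)
    from T_MP[OF this] * show "stmt (LFP \<phi> y) e E \<in> T" by blast
  qed
  then show ?thesis by (simp only: I)
qed

lemma stmt_tc_ind:
  assumes "is_formula \<Lambda> ar UNIV \<phi>" "is_formula \<Lambda> ar UNIV \<psi>"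
  shows "stmt (tc_ind \<phi> u v \<psi>) e E \<in> T \<longleftrightarrow>
    (stmt \<psi> (case_nat (e u) e) E \<in> T \<and>
     (\<forall>a b. stmt \<psi> (case_nat a e) E \<in> T \<and> stmt \<phi> (case_nat b (case_nat a e)) E \<in> T \<longrightarrow>
        stmt \<psi> (case_nat b e) E \<in> T) \<longrightarrow>
     stmt \<psi> (case_nat (e v) e) E \<in> T)"
proof -
  have "stmt (inst \<psi> x) e E = stmt \<psi> (case_nat (e x) e) E"
    "stmt (lift \<psi>) (case_nat a e) E = stmt \<psi> e E"
    "stmt (lift1 \<psi>) (case_nat b (case_nat a e)) E = stmt \<psi> (case_nat b e) E" for x a b e E
    by (simp_all add: stmt_def inst_def lift_def lift1_def fun_eq_iff)
  then show ?thesis using assms by (simp add: tc_ind_def stmt_Forall) blast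
qed

lemma stmt_TC:
  assumes "is_formula \<Lambda> ar UNIV (TC \<phi> u v)"
  shows "stmt (TC \<phi> u v) e E \<in> T \<longleftrightarrow>
    (\<forall>\<psi> d D. is_formula \<Lambda> ar UNIV \<psi> \<longrightarrow> stmt \<psi> (case_nat (e u) d) D \<in> T \<and>
     (\<forall>a b. stmt \<psi> (case_nat a d) D \<in> T \<and> stmt \<phi> (case_nat b (case_nat a e)) E \<in> T \<longrightarrow>
        stmt \<psi> (case_nat b d) D \<in> T) \<longrightarrow>
     stmt \<psi> (case_nat (e v) d) D \<in> T)"
    (is "_ \<longleftrightarrow> (\<forall>\<psi> d D. _ \<longrightarrow> ?ind \<psi> d D)")
proof
  have L: "\<Lambda> = FO_TC1" and \<phi>: "is_formula \<Lambda> ar UNIV \<phi>" using assms by auto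
  {
    assume TC: "stmt (TC \<phi> u v) e E \<in> T"
    show "\<forall>\<psi> d D. is_formula \<Lambda> ar UNIV \<psi> \<longrightarrow> ?ind \<psi> d D"
    proof (intro allI, rule impI)
      fix \<psi> d D assume \<psi>: "is_formula \<Lambda> ar UNIV \<psi>"
      \<comment> \<open>\<open>TC_ax\<close> needs \<phi> and \<psi> under one assignment, but their
        constants are independent; they are interleaved at even and odd indices.\<close>
      define f g :: "nat \<Rightarrow> nat" where "f = (\<lambda>n. 2 * n)" and "g = (\<lambda>n. 2 * n + 1)"
      define j :: "(nat \<Rightarrow> 'r cst) \<Rightarrow> (nat \<Rightarrow> 'r cst) \<Rightarrow> nat \<Rightarrow> 'r cst"
        where "j = (\<lambda>e d n. if even n then e (n div 2) else d (n div 2))"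
      have j: "j e d \<circ> f = e" "j e d \<circ> g = d" for e d
        by (auto simp: fun_eq_iff j_def f_def g_def)
      define \<phi>' \<psi>' where "\<phi>' = rename (up (up f)) f \<phi>" and "\<psi>' = rename (up g) g \<psi>"
      have st: "stmt \<phi>' (case_nat b (case_nat a (j e d))) (j E D) = stmt \<phi> (case_nat b (case_nat a e)) E"
        "stmt \<psi>' (case_nat b (j e d)) (j E D) = stmt \<psi> (case_nat b d) D" for a b
        by (simp_all add: stmt_def \<phi>'_def \<psi>'_def comp_assoc j)
      have jf: "j e d (f x) = e x" for x using fun_cong[OF j(1)[of e d], of x] by simp
      have "stmt (TC \<phi>' (f u) (f v)) (j e d) (j E D) = stmt (TC \<phi> u v) e E"
        by (simp add: stmt_def \<phi>'_def comp_assoc j jf)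
      then have "stmt (TC \<phi>' (f u) (f v)) (j e d) (j E D) \<in> T" using TC by simp
      then have "stmt (tc_ind \<phi>' (f u) (f v) \<psi>') (j e d) (j E D) \<in> T"
      proof (elim T_mono[rotated])
        fix c C
        show "provable \<Lambda> ar (Imp (stmt (TC \<phi>' (f u) (f v)) (j e d) (j E D) c C)
            (stmt (tc_ind \<phi>' (f u) (f v) \<psi>') (j e d) (j E D) c C))"
          using L \<phi> \<psi> by (simp add: stmt_def rename_tc_ind TC_ax \<phi>'_def \<psi>'_def)
      qed
      moreover have "is_formula \<Lambda> ar UNIV \<phi>'" "is_formula \<Lambda> ar UNIV \<psi>'"
        using \<phi> \<psi> by (simp_all add: \<phi>'_def \<psi>'_def)
      ultimately show "?ind \<psi> d D" by (simp add: stmt_tc_ind st jf)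
    qed
  next
    assume *: "\<forall>\<psi> d D. is_formula \<Lambda> ar UNIV \<psi> \<longrightarrow> ?ind \<psi> d D"
    define \<psi> where "\<psi> = TC (rename (up (up Suc)) (\<lambda>X. X) \<phi>) (Suc u) 0"
    have \<psi>: "stmt \<psi> (case_nat k e) E =
        (\<lambda>c C. TC (rename (up (up (c \<circ> e))) (C \<circ> E) \<phi>) (c (e u)) (c k))" for k
      by (simp add: stmt_def \<psi>_def fun_eq_iff)
    have "?ind \<psi> e E" using * L \<phi> by (simp add: \<psi>_def)
    moreover have "stmt \<psi> (case_nat (e u) e) E \<in> T"
      unfolding \<psi> using L \<phi> by (auto intro!: T_provable provable_TC_refl inf)
    moreover have "stmt \<psi> (case_nat b e) E \<in> T"
      if ab: "stmt \<psi> (case_nat a e) E \<in> T" "stmt \<phi> (case_nat b (case_nat a e)) E \<in> T" for a b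
    proof (rule T_mono2[OF _ ab])
      fix c C
      show "provable \<Lambda> ar (Imp (stmt \<psi> (case_nat a e) E c C)
          (Imp (stmt \<phi> (case_nat b (case_nat a e)) E c C) (stmt \<psi> (case_nat b e) E c C)))"
        using provable_TC_step[of ar "rename (up (up (c \<circ> e))) (C \<circ> E) \<phi>" "c (e u)" "c a" "c b"]
          inf L \<phi> unfolding \<psi> by (simp add: stmt_def)
    qed
    ultimately have "stmt \<psi> (case_nat (e v) e) E \<in> T" by blast
    then show "stmt (TC \<phi> u v) e E \<in> T" by (simp add: \<psi>) (simp add: stmt_def)
  }
qed

section \<open>The quotient of the constants by provable equality\<close>

definition eqT :: "'r cst \<Rightarrow> 'r cst \<Rightarrow> bool" where
  "eqT k l \<longleftrightarrow> (\<lambda>c C. Eq (c k) (c l)) \<in> T"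

lemma eqT_refl: "eqT k k"
  unfolding eqT_def by (rule T_provable) (rule Eq_refl)

lemma eqT_sym: "eqT k l \<Longrightarrow> eqT l k"
  unfolding eqT_def by (erule T_mono[rotated]) (rule provable_Eq_sym)

lemma eqT_trans: "eqT k l \<Longrightarrow> eqT l m \<Longrightarrow> eqT k m"
  unfolding eqT_def
  by (erule T_mono2[rotated 2], rule Eq_repl, simp_all) (auto intro: replaced.intros)

lemma eqT_Leibniz:
  assumes "eqT k l" "stmt \<phi> (case_nat k e) E \<in> T" "is_formula \<Lambda> ar UNIV \<phi>"
  shows "stmt \<phi> (case_nat l e) E \<in> T"
  using assms(1)[unfolded eqT_def] assms(2)
proof (rule T_mono2[rotated])
  fix c C
  show "provable \<Lambda> ar (Imp (Eq (c k) (c l)) (Imp (stmt \<phi> (case_nat k e) E c C) (stmt \<phi> (case_nat l e) E c C)))"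
    unfolding stmt_def by (rule provable_Leibniz[OF inf assms(3)]) (auto split: nat.splits)
qed

definition relT :: "'r \<Rightarrow> 'r cst list \<Rightarrow> bool" where
  "relT r ks \<longleftrightarrow> (\<lambda>c C. Rel r (map c ks)) \<in> T"

text \<open>Arguments are replaced one at a time from the left; \<open>ms\<close> collects those
  already replaced, so that each step concerns a complete atom and is an instance of
  \<open>Eq_repl\<close>.\<close>

lemma relT_cong:
  "list_all2 eqT ks ls \<Longrightarrow> relT r (ms @ ks) \<Longrightarrow> relT r (ms @ ls)"
proof (induction arbitrary: ms rule: list_all2_induct)
  case (Cons k ks l ls)
  have wf: "length (ms @ k # ks) = ar r"
    using T_wf[OF Cons.prems[unfolded relT_def]] by (simp add: wf_def)
  have "relT r (ms @ l # ks)"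
    using Cons.hyps(1) Cons.prems unfolding eqT_def relT_def
    by (rule T_mono2[rotated], intro Eq_repl)
      (use wf in \<open>auto intro!: replaced.intros list_all2_appendI simp: list_all2_same list.rel_map\<close>)
  from Cons.IH[of "ms @ [l]"] this show ?case by simp
qed simp

lemma stmt_Rel: "stmt (Rel r xs) e E \<in> T \<longleftrightarrow> relT r (map e xs)"
  by (simp add: stmt_def relT_def comp_def)

lemma stmt_Eq: "stmt (Eq x y) e E \<in> T \<longleftrightarrow> eqT (e x) (e y)"
  by (simp add: stmt_def eqT_def)

text \<open>\<open>h\<close> is any map whose kernel is provable equality. Its target type stays
  open, so that the domain can later be placed inside a given type.\<close>

context
  fixes h :: "'r cst \<Rightarrow> 'u"
  assumes h: "\<And>k l. h k = h l \<longleftrightarrow> eqT k l"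
begin

definition denot :: "'r fm \<Rightarrow> (nat \<Rightarrow> 'r cst) \<Rightarrow> (nat \<Rightarrow> 'r cst) \<Rightarrow> 'u set" where
  "denot \<psi> e E = h ` {k. stmt \<psi> (case_nat k e) E \<in> T}"

definition named :: "'r cst \<Rightarrow> 'u set" where "named K = denot (Mem 0 0) Var (\<lambda>_. K)"

definition model :: "('r, 'u) frame" where
  "model = \<lparr>dom = range h,
     interp = (\<lambda>r. {map h ks |ks. length ks = ar r \<and> relT r ks}),
     adm = (if \<Lambda> = FO_TC1 then {denot \<psi> e E |\<psi> e E. is_formula \<Lambda> ar UNIV \<psi>} else range named)\<rparr>"

lemma in_denot: "is_formula \<Lambda> ar UNIV \<psi> \<Longrightarrow> h k \<in> denot \<psi> e E \<longleftrightarrow> stmt \<psi> (case_nat k e) E \<in> T"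
  by (auto simp: denot_def h intro: eqT_Leibniz[OF eqT_sym])

lemma in_named: "\<Lambda> \<noteq> FO_TC1 \<Longrightarrow> h k \<in> named K \<longleftrightarrow> memT K k"
  unfolding named_def by (subst in_denot) (auto intro: lang.exhaust[of \<Lambda>])

lemma map_h: "map h ks = map h ls \<longleftrightarrow> list_all2 eqT ks ls"
  by (auto simp: list_eq_iff_nth_eq list_all2_conv_all_nth h)

text \<open>In transitive closure logic the admissible sets have no names, and no atom
  \<open>Mem\<close> occurs; this is why \<open>E'\<close> is tied to the set constants only for the
  other two logics.\<close>

lemma truth:
  "is_formula \<Lambda> ar UNIV \<phi> \<Longrightarrow> (\<Lambda> \<noteq> FO_TC1 \<Longrightarrow> E' = named \<circ> E) \<Longrightarrow>
   sat model (h \<circ> e) E' \<phi> \<longleftrightarrow> stmt \<phi> e E \<in> T"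
proof (induction \<phi> arbitrary: e E E')
  case Bot
  then show ?case by simp
next
  case (Rel r xs)
  have "relT r (map e xs)" if "list_all2 eqT (map e xs) ks" "relT r ks" for ks
  proof -
    have "list_all2 eqT ks (map e xs)"
      using that(1) eqT_sym by (auto simp: list_all2_conv_all_nth)
    from relT_cong[OF this, of r "[]"] that(2) show ?thesis by simp
  qed
  moreover have "list_all2 eqT (map e xs) (map e xs)" by (simp add: list_all2_same eqT_refl)
  moreover have "length (map e xs) = ar r" using Rel.prems by simp
  ultimately have "map h (map e xs) \<in> interp model r \<longleftrightarrow> relT r (map e xs)"
    unfolding model_def frame.simps mem_Collect_eq map_h by blast
  then show ?case by (simp add: stmt_Rel comp_def)
next
  case (Eq x y)
  then show ?case by (simp add: stmt_Eq h)
next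
  case (Mem X x)
  then have "\<Lambda> \<noteq> FO_TC1" by auto
  with Mem show ?case by (simp add: in_named)
next
  case (Imp \<phi> \<psi>)
  from Imp.prems(1) Imp.IH[OF _ Imp.prems(2)] show ?case by simp
next
  case (Forall \<phi>)
  have "sat model (case_nat (h k) (h \<circ> e)) E' \<phi> \<longleftrightarrow> stmt \<phi> (case_nat k e) E \<in> T" for k
    using Forall.IH[OF _ Forall.prems(2), of "case_nat k e"] Forall.prems(1) by simp
  moreover have "dom model = range h" by (simp add: model_def)
  ultimately show ?case using Forall.prems(1) by (simp add: stmt_Forall comp_def)
next
  case (ForallS \<phi>)
  then have L: "\<Lambda> = MSO" "is_formula \<Lambda> ar UNIV \<phi>" by auto
  have "sat model (h \<circ> e) (case_nat (named K) E') \<phi> \<longleftrightarrow> stmt \<phi> e (case_nat K E) \<in> T" for K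
    using ForallS.prems(2) L by (intro ForallS.IH) (simp_all add: fun_eq_iff split: nat.split)
  moreover have "adm model = range named" unfolding model_def using L by simp
  ultimately show ?case by (simp add: stmt_ForallS[OF ForallS.prems(1)] comp_def)
next
  case (TC \<phi> u v)
  then have L: "\<Lambda> = FO_TC1" "is_formula \<Lambda> ar UNIV \<phi>" by auto
  have IH: "sat model (case_nat (h b) (case_nat (h a) (h \<circ> e))) E' \<phi> \<longleftrightarrow>
      stmt \<phi> (case_nat b (case_nat a e)) E \<in> T" for a b
    using TC.IH[OF L(2) TC.prems(2), of "case_nat b (case_nat a e)"] by simp
  have d: "dom model = range h" by (simp add: model_def)
  have a: "adm model = {denot \<psi> e E |\<psi> e E. is_formula \<Lambda> ar UNIV \<psi>}" unfolding model_def using L by simp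
  have all: "(\<forall>A\<in>adm model. Q A) \<longleftrightarrow>
      (\<forall>\<psi> d D. is_formula \<Lambda> ar UNIV \<psi> \<longrightarrow> Q (denot \<psi> d D))" for Q
    unfolding a by blast
  show ?case
    unfolding stmt_TC[OF TC.prems(1)] sat.simps(8) all d ball_simps
    by (simp add: in_denot IH[unfolded comp_def] comp_def)
next
  case (LFP \<phi> y)
  then have L: "\<Lambda> = FO_LFP1" "is_formula \<Lambda> ar UNIV \<phi>" by auto
  have IH: "sat model (case_nat (h k) (h \<circ> e)) (case_nat (named K) E') \<phi> \<longleftrightarrow>
      stmt \<phi> (case_nat k e) (case_nat K E) \<in> T" for k K
  proof -
    have "\<Lambda> \<noteq> FO_TC1 \<Longrightarrow> case_nat (named K) E' = named \<circ> case_nat K E"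
      using LFP.prems(2) by (simp only: o_case_nat not_False_eq_True)
    from LFP.IH[OF L(2) this, of "case_nat k e"] show ?thesis by simp
  qed
  have d: "dom model = range h" by (simp add: model_def)
  have a: "adm model = range named" unfolding model_def using L by simp
  have n: "h k \<in> named K \<longleftrightarrow> memT K k" for k K using L by (intro in_named) simp
  show ?case
    unfolding stmt_LFP[OF LFP.prems(1)] sat.simps(9) a d ball_simps
    by (simp add: n IH[unfolded comp_def] comp_def)
qed

lemma comprehension:
  assumes L: "\<Lambda> \<noteq> FO_TC1" and \<phi>: "is_formula \<Lambda> ar UNIV \<phi>"
  shows "\<exists>K. denot \<phi> e E = named K"
proof -
  let ?\<psi> = "Forall (Iff (Mem 0 0) (liftS \<phi>))"
  have M: "is_formula \<Lambda> ar UNIV (Mem 0 0)" using L by (cases \<Lambda>) auto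
  have "\<exists>K. stmt ?\<psi> e (case_nat K E) \<in> T"
  proof (cases \<Lambda>)
    case MSO
    have "stmt (ExistsS ?\<psi>) e E \<in> T"
    proof (rule T_provable)
      fix c C
      show "provable \<Lambda> ar (stmt (ExistsS ?\<psi>) e E c C)"
        unfolding stmt_def by (rule provable_rename, rule Compr[OF MSO \<phi>])
    qed
    then show ?thesis using MSO \<phi> M by (simp add: stmt_ForallS)
  next
    case FO_LFP1
    \<comment> \<open>A label of the form \<open>Imp (Forall \<phi>) \<chi>\<close> calls up the
      comprehension axiom for \<phi>; \<open>Bot\<close> merely completes the label.\<close>
    obtain w where "(\<lambda>c C. wit_ax \<Lambda> (stmt (Imp (Forall \<phi>) Bot) e E c C) (c w) (C w)) \<in> T"
      using witness[of "Imp (Forall \<phi>) Bot" e E] \<phi> by auto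
    then have "stmt ?\<psi> e (case_nat w E) \<in> T"
      using FO_LFP1 by (simp add: wit_ax_def stmt_def liftS_def)
    then show ?thesis by blast
  qed (use L in simp)
  then obtain K where K: "stmt ?\<psi> e (case_nat K E) \<in> T" by blast
  have "stmt (liftS \<phi>) (case_nat k e) (case_nat K E) = stmt \<phi> (case_nat k e) E" for k
    by (simp add: stmt_def liftS_def fun_eq_iff)
  then have "memT K k \<longleftrightarrow> stmt \<phi> (case_nat k e) E \<in> T" for k
    using K \<phi> M by (simp add: stmt_Forall) blast
  then have "denot \<phi> e E = named K" by (simp add: named_def denot_def)
  then show ?thesis by blast
qed

lemma henkin_model: "henkin_structure \<Lambda> ar UNIV model"
  unfolding henkin_structure_def
proof (intro conjI allI impI)
  show "is_frame ar UNIV model"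
    by (auto simp: is_frame_def model_def named_def denot_def)
  fix \<phi> e' E'
  assume \<phi>: "is_formula \<Lambda> ar UNIV \<phi>" and as: "assignment model e' E'"
  have "\<forall>n. \<exists>k. e' n = h k" using as by (auto simp: assignment_def model_def)
  then obtain e where "\<forall>n. e' n = h (e n)" by metis
  then have e: "e' = h \<circ> e" by auto
  have "\<exists>E. \<Lambda> \<noteq> FO_TC1 \<longrightarrow> E' = named \<circ> E"
  proof (cases "\<Lambda> = FO_TC1")
    case False
    then have "\<forall>n. E' n \<in> range named" using as by (auto simp: assignment_def model_def)
    then have "\<forall>n. \<exists>k. E' n = named k" by blast
    then obtain E where "\<forall>n. E' n = named (E n)" by metis
    then show ?thesis by (intro exI[of _ E]) auto
  qed simp
  then obtain E where E: "\<Lambda> \<noteq> FO_TC1 \<Longrightarrow> E' = named \<circ> E" by blast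
  have "sat model (case_nat (h k) e') E' \<phi> \<longleftrightarrow> stmt \<phi> (case_nat k e) E \<in> T" for k
    using truth[OF \<phi> E, of "case_nat k e"] by (simp add: e)
  then have "{a \<in> dom model. sat model (case_nat a e') E' \<phi>} = denot \<phi> e E"
    by (auto simp: model_def denot_def)
  then show "{a \<in> dom model. sat model (case_nat a e') E' \<phi>} \<in> adm model"
    using \<phi> comprehension[of \<phi> e E] by (auto simp: model_def)
qed

end

end

section \<open>Completeness\<close>

text \<open>
  The constants inject into the formulas over the original vocabulary, from which the domain of the
  model can therefore be drawn.
\<close>

fun code_fm :: "('r + nat) fm \<Rightarrow> 'r fm" where
  "code_fm Bot = Bot"
| "code_fm (Rel r xs) = (case r of Inl r' \<Rightarrow> Rel r' xs | Inr n \<Rightarrow> ForallS (Rel undefined (n # xs)))"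
| "code_fm (Eq x y) = Eq x y"
| "code_fm (Mem X x) = Mem X x"
| "code_fm (Imp \<phi> \<psi>) = Imp (code_fm \<phi>) (code_fm \<psi>)"
| "code_fm (Forall \<phi>) = Forall (code_fm \<phi>)"
| "code_fm (ForallS \<phi>) = ForallS (Forall (code_fm \<phi>))"
| "code_fm (TC \<phi> u v) = TC (code_fm \<phi>) u v"
| "code_fm (LFP \<phi> y) = LFP (code_fm \<phi>) y"

text \<open>The \<open>Forall\<close> inserted below every coded set quantifier keeps it apart from
  the code of an atom with predicate \<open>Inr n\<close>, where \<open>ForallS\<close> is followed
  directly by \<open>Rel\<close>.\<close>

lemma code_fm_inj: "code_fm \<phi> = code_fm \<psi> \<Longrightarrow> \<phi> = \<psi>"
proof (induction \<phi> arbitrary: \<psi>)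
  case (Rel r xs)
  then show ?case by (cases \<psi>) (auto split: sum.splits)
next
  case (ForallS \<phi>)
  then show ?case by (cases \<psi>) (auto split: sum.splits)
qed (case_tac \<psi>; auto split: sum.splits)+

primrec code_list :: "'r fm list \<Rightarrow> 'r fm" where
  "code_list [] = Bot"
| "code_list (x # xs) = Imp x (code_list xs)"

lemma code_list_inj: "code_list xs = code_list ys \<Longrightarrow> xs = ys"
proof (induction xs arbitrary: ys)
  case Nil
  then show ?case by (cases ys) auto
next
  case (Cons x xs)
  then show ?case by (cases ys) auto
qed

primrec code_cst :: "('r + nat) cst \<Rightarrow> 'r fm" where
  "code_cst (Var n) = Eq n n"
| "code_cst (Wit \<chi> ks ss) =
     Imp (code_fm \<chi>) (Imp (code_list (map code_cst ks)) (code_list (map code_cst ss)))"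

lemma code_cst_inj: "code_cst k = code_cst l \<Longrightarrow> k = l"
proof (induction k arbitrary: l)
  case (Var n)
  then show ?case by (cases l) auto
next
  case (Wit \<chi> ks ss)
  then obtain \<chi>' ks' ss' where l: "l = Wit \<chi>' ks' ss'" by (cases l) auto
  then have "\<chi> = \<chi>'" and *: "map code_cst ks = map code_cst ks'" "map code_cst ss = map code_cst ss'"
    using Wit.prems by (auto dest: code_fm_inj code_list_inj)
  moreover have "ks = ks'" using *(1) Wit.IH(1)
    by (auto simp: list_eq_iff_nth_eq)
  moreover have "ss = ss'" using *(2) Wit.IH(2)
    by (auto simp: list_eq_iff_nth_eq)
  ultimately show ?case by (simp add: l)
qed

section \<open>Reducts to the original vocabulary\<close>

definition reduct :: "('r + nat, 'u) frame \<Rightarrow> ('r, 'u) frame" where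
  "reduct M = \<lparr>dom = dom M, interp = interp M \<circ> Inl, adm = adm M\<rparr>"

lemma reduct_simps [simp]:
  "dom (reduct M) = dom M" "adm (reduct M) = adm M" "interp (reduct M) r = interp M (Inl r)"
  by (simp_all add: reduct_def)

lemma sat_reduct: "sat (reduct M) e E \<phi> = sat M e E (map_fm Inl \<phi>)"
  by (induction \<phi> arbitrary: e E) simp_all

lemma is_formula_Inl:
  "is_formula \<Lambda> ar \<sigma> \<phi> \<Longrightarrow> is_formula \<Lambda> (ar_ext ar) UNIV (map_fm Inl \<phi>)"
  by (erule is_formula_map_fm[rotated]) simp

lemma henkin_reduct:
  "henkin_structure \<Lambda> (ar_ext ar) UNIV M \<Longrightarrow> henkin_structure \<Lambda> ar \<sigma> (reduct M)"
proof (unfold henkin_structure_def, elim conjE, intro conjI allI impI)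
  assume "is_frame (ar_ext ar) UNIV M"
  then show "is_frame ar \<sigma> (reduct M)"
    by (fastforce simp: is_frame_def)
next
  fix \<phi> e E
  assume *: "\<forall>\<phi> e E. is_formula \<Lambda> (ar_ext ar) UNIV \<phi> \<longrightarrow> assignment M e E \<longrightarrow>
      {a \<in> dom M. sat M (case_nat a e) E \<phi>} \<in> adm M"
    and \<phi>: "is_formula \<Lambda> ar \<sigma> \<phi>" and "assignment (reduct M) e E"
  then have "assignment M e E" by (simp add: assignment_def)
  with * is_formula_Inl[OF \<phi>]
  show "{a \<in> dom (reduct M). sat (reduct M) (case_nat a e) E \<phi>} \<in> adm (reduct M)"
    by (simp add: sat_reduct)
qed

lemma infinite_unary_ext: "infinite {P. ar_ext ar P = 1}"
proof -
  have "range (Inr :: nat \<Rightarrow> 'a + nat) \<subseteq> {P. ar_ext ar P = 1}" by auto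
  moreover have "infinite (range (Inr :: nat \<Rightarrow> 'a + nat))" by (simp add: finite_image_iff)
  ultimately show ?thesis using finite_subset by blast
qed

lemma derivable_complete:
  fixes \<Gamma> :: "'r fm set"
  assumes \<Gamma>: "\<forall>\<psi>\<in>\<Gamma>. is_formula \<Lambda> ar \<sigma> \<psi>" and \<phi>: "is_formula \<Lambda> ar \<sigma> \<phi>"
    and cons: "henkin_consequence TYPE('r fm) \<Lambda> ar \<sigma> \<Gamma> \<phi>"
  shows "derivable \<Lambda> ar \<Gamma> \<phi>"
proof (rule ccontr)
  assume nd: "\<not> derivable \<Lambda> ar \<Gamma> \<phi>"
  interpret henkin_theory \<Lambda> "ar_ext ar" by unfold_locales (rule infinite_unary_ext)
  let ?n = "Neg (map_fm Inl \<phi>) :: ('r + nat) fm"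
  define \<Delta> where "\<Delta> = insert ?n (map_fm Inl ` \<Gamma>)"
  define T0 where "T0 = (\<lambda>\<chi>. stmt \<chi> Var Var) ` \<Delta>"
  have f\<Delta>: "is_formula \<Lambda> (ar_ext ar) UNIV \<chi>" if "\<chi> \<in> \<Delta>" for \<chi>
    using that \<Gamma> \<phi> is_formula_Inl[of \<Lambda> ar \<sigma>] by (auto simp: \<Delta>_def)
  have "\<not> entails T0 stmt_Bot"
  proof
    assume "entails T0 stmt_Bot"
    then obtain ts where ts: "set ts \<subseteq> T0"
      and p: "\<And>c C. provable \<Lambda> (ar_ext ar) (foldr Imp (map (\<lambda>s. s c C) ts) Bot)"
      unfolding entails_def by blast
    \<comment> \<open>Reading \<open>Var n\<close> as the variable \<open>n\<close> turns each
      \<open>stmt \<chi> Var Var\<close> back into \<chi>. The statements in \<open>T0\<close>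
      mention no witnesses, for which 0 is a default.\<close>
    define c where "c = (\<lambda>k :: ('r + nat) cst. case k of Var n \<Rightarrow> n | Wit _ _ _ \<Rightarrow> 0)"
    have "c \<circ> Var = (\<lambda>n. n)" by (auto simp: c_def)
    then have "stmt \<chi> Var Var c c = \<chi>" for \<chi> by (simp add: stmt_def)
    then have sub: "set (map (\<lambda>s. s c c) ts) \<subseteq> \<Delta>" using ts by (auto simp: T0_def)
    define us where "us = filter (\<lambda>\<chi>. \<chi> \<noteq> ?n) (map (\<lambda>s. s c c) ts)"
    have us: "set us \<subseteq> map_fm Inl ` \<Gamma>" using sub by (auto simp: us_def \<Delta>_def)
    then obtain \<psi>s where \<psi>s: "us = map (map_fm Inl) \<psi>s" "set \<psi>s \<subseteq> \<Gamma>"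
      by (metis image_mono lists_image lists_eq_set mem_Collect_eq imageE)
    have "is_formula \<Lambda> (ar_ext ar) UNIV (Imp (foldr And us Top) (map_fm Inl \<phi>))"
      using us f\<Delta> \<phi> is_formula_Inl[of \<Lambda> ar \<sigma>] by (auto simp: is_formula_foldr_And \<Delta>_def)
    then have "provable \<Lambda> (ar_ext ar) (Imp (foldr And us Top) (map_fm Inl \<phi>))"
      by (rule prov1[OF p[of c c]])
        (auto simp: peval_foldr_Imp peval_foldr_And us_def)
    then show False
      using nd \<psi>s by (auto simp: derivable_def map_fm_foldr_And)
  qed
  moreover have "fresh (Wit \<chi> ks ss) t" if "t \<in> T0" for t \<chi> ks ss
    using that by (auto simp: T0_def intro!: fresh_stmt)
  ultimately have "\<not> entails (T0 \<union> wit_stmt \<Lambda> ` wit_keys) stmt_Bot"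
    by (intro consistent_wit_stmts) auto
  moreover have "T0 \<union> wit_stmt \<Lambda> ` wit_keys \<subseteq> wf"
  proof (rule Un_least)
    show "T0 \<subseteq> wf" unfolding T0_def by (intro image_subsetI stmt_wf f\<Delta>)
  qed (rule wit_stmt_wf)
  ultimately have "\<exists>T. T0 \<union> wit_stmt \<Lambda> ` wit_keys \<subseteq> T \<and> maxcon T" by (intro Lindenbaum)
  then obtain T where T: "T0 \<union> wit_stmt \<Lambda> ` wit_keys \<subseteq> T" "maxcon T" by blast
  interpret canonical \<Lambda> "ar_ext ar" T by unfold_locales (use T in auto)
  \<comment> \<open>If \<open>eqT k l\<close> holds, then \<open>eqT k\<close> and
    \<open>eqT l\<close> are the same predicate, so the choice operator selects the same
    representative for both; its code places the domain in \<open>'r fm\<close>.\<close>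
  define h where "h = (\<lambda>k. code_cst (SOME l. eqT k l))"
  have h: "h k = h l \<longleftrightarrow> eqT k l" for k l
  proof
    assume "h k = h l"
    then have "(SOME l. eqT k l) = (SOME m. eqT l m)" by (simp add: h_def code_cst_inj)
    then show "eqT k l"
      using someI[of "eqT k" k] someI[of "eqT l" l] eqT_refl eqT_sym eqT_trans by metis
  next
    assume "eqT k l"
    then have "eqT k = eqT l" using eqT_sym eqT_trans by blast
    then show "h k = h l" by (simp add: h_def)
  qed
  have st: "stmt \<chi> Var Var \<in> T" if "\<chi> \<in> \<Delta>" for \<chi> using that T by (auto simp: T0_def)
  \<comment> \<open>In transitive closure logic an assignment still needs admissible values for its
    set variables; the set defined by \<open>Bot\<close> provides one.\<close>
  let ?M = "reduct (model h)" and ?E = "if \<Lambda> = FO_TC1 then (\<lambda>_. denot h Bot Var Var) else named h \<circ> Var"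
  have "henkin_structure \<Lambda> ar \<sigma> ?M" by (rule henkin_reduct[OF henkin_model[OF h]])
  moreover have "assignment ?M (h \<circ> Var) ?E"
    unfolding assignment_def reduct_simps model_def[OF h] frame.simps
    by (cases "\<Lambda> = FO_TC1") (auto intro!: exI[of _ Bot])
  moreover have tr: "sat ?M (h \<circ> Var) ?E \<chi> \<longleftrightarrow> stmt (map_fm Inl \<chi>) Var Var \<in> T"
    if "is_formula \<Lambda> ar \<sigma> \<chi>" for \<chi>
    unfolding sat_reduct by (rule truth[OF h is_formula_Inl[OF that]]) simp
  moreover have "\<forall>\<psi>\<in>\<Gamma>. sat ?M (h \<circ> Var) ?E \<psi>" using tr \<Gamma> st by (simp add: \<Delta>_def)
  ultimately have "sat ?M (h \<circ> Var) ?E \<phi>" using cons unfolding henkin_consequence_def by blast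
  then have "stmt (map_fm Inl \<phi>) Var Var \<in> T" using tr[OF \<phi>] by simp
  moreover have "stmt ?n Var Var \<in> T" using st by (simp add: \<Delta>_def)
  ultimately show False using is_formula_Inl[OF \<phi>] by simp
qed

theorem theorem4p5:
  fixes \<Lambda> :: lang
    and ar :: "'r \<Rightarrow> nat"
    and \<sigma> :: "'r set"
    and \<Gamma> :: "'r fm set"
    and \<phi> :: "'r fm"
  assumes "\<forall>\<psi>\<in>\<Gamma>. is_formula \<Lambda> ar \<sigma> \<psi>"
    and "is_formula \<Lambda> ar \<sigma> \<phi>"
  shows "(henkin_consequence TYPE('r fm) \<Lambda> ar \<sigma> \<Gamma> \<phi> \<longleftrightarrow> derivable \<Lambda> ar \<Gamma> \<phi>) \<and>
         (derivable \<Lambda> ar \<Gamma> \<phi> \<longrightarrow> henkin_consequence TYPE('u) \<Lambda> ar \<sigma> \<Gamma> \<phi>)"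
proof (intro conjI iffI impI)
  show "derivable \<Lambda> ar \<Gamma> \<phi>" if "henkin_consequence TYPE('r fm) \<Lambda> ar \<sigma> \<Gamma> \<phi>"
    using that by (rule derivable_complete[OF assms])
qed (rule derivable_sound[OF assms], assumption)+

end
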